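(* Let $M$ be a smooth closed manifold and let $g(t)$, $t\in J\subset[0,\infty)$, be a family of Riemannian metrics on $M$, defined on a time interval $J$, satisfying the Ricci flow equation $\frac{\partial}{\partial t}g(t)=-2\operatorname{Ric}_t$. Let $s(t)$ denote the scalar curvature of $g(t)$. If $$\int_M\frac{\partial}{\partial t}\,s(t)\,d\operatorname{vol}_{g(t)}\le 0\quad\text{for all } t\in J,$$ then the flow is trivial.
   Context: Closed means compact without boundary. $\operatorname{Ric}_t$ is the Ricci tensor of $g(t)$ and $s(t)=\operatorname{Tr}_{g(t)}\operatorname{Ric}_t$. The Ricci flow $g(t)$, $t\in J$, is called trivial if $\operatorname{Ric}_t\equiv 0$ for all $t\in J$ (equivalently, $g(t)$ does not depend on $t$). *)

theory Defs
  imports "HOL-Analysis.Analysis"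
begin

section \<open>Smooth maps\<close>

text \<open>
  The derivatives are taken within \<open>S\<close>, so that the notion also covers \<open>S = J \<times> V\<close> with \<open>V\<close> open
  and \<open>J\<close> a nondegenerate interval that may contain endpoints. It is only used for sets \<open>S\<close> that are
  open or of this product form; there the derivative within \<open>S\<close> is unique.
\<close>

primrec Ck_on :: "nat \<Rightarrow> 'a::euclidean_space set \<Rightarrow> ('a \<Rightarrow> 'b::real_normed_vector) \<Rightarrow> bool" where
  "Ck_on 0 S f \<longleftrightarrow> continuous_on S f"
| "Ck_on (Suc k) S f \<longleftrightarrow>
     f differentiable_on S \<and> (\<forall>v. Ck_on k S (\<lambda>x. frechet_derivative f (at x within S) v))"

definition smooth_on :: "'a::euclidean_space set \<Rightarrow> ('a \<Rightarrow> 'b::real_normed_vector) \<Rightarrow> bool" where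
  "smooth_on S f \<longleftrightarrow> (\<forall>k. Ck_on k S f)"


section \<open>Smooth manifolds\<close>

text \<open>
  The manifold is the whole type \<open>'m\<close>, with the smooth structure given by an atlas. The coordinate
  map of a chart is only meaningful on the domain of the chart.
\<close>

type_synonym ('m, 'n) chart = "'m set \<times> ('m \<Rightarrow> (real, 'n) vec)"

abbreviation chart_dom :: "('m, 'n::finite) chart \<Rightarrow> 'm set" where
  "chart_dom c \<equiv> fst c"

abbreviation coords :: "('m, 'n::finite) chart \<Rightarrow> 'm \<Rightarrow> real^'n" where
  "coords c \<equiv> snd c"

abbreviation chart_inv :: "('m, 'n::finite) chart \<Rightarrow> real^'n \<Rightarrow> 'm" where
  "chart_inv c \<equiv> inv_into (chart_dom c) (coords c)"

abbreviation chart_img :: "('m, 'n::finite) chart \<Rightarrow> (real^'n) set" where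
  "chart_img c \<equiv> coords c ` chart_dom c"

definition is_chart :: "('m::topological_space, 'n::finite) chart \<Rightarrow> bool" where
  "is_chart c \<longleftrightarrow> open (chart_dom c) \<and> open (chart_img c) \<and>
     homeomorphism (chart_dom c) (chart_img c) (coords c) (chart_inv c)"

definition smooth_atlas ::
  "('m::{t2_space, second_countable_topology}, 'n::finite) chart set \<Rightarrow> bool" where
  "smooth_atlas A \<longleftrightarrow>
     (\<forall>c\<in>A. is_chart c) \<and>
     (\<Union>c\<in>A. chart_dom c) = UNIV \<and>
     (\<forall>c\<in>A. \<forall>d\<in>A. smooth_on (coords c ` (chart_dom c \<inter> chart_dom d)) (coords d \<circ> chart_inv c))"

definition closed_manifold ::
  "('m::{t2_space, second_countable_topology}, 'n::finite) chart set \<Rightarrow> bool" where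
  "closed_manifold A \<longleftrightarrow> smooth_atlas A \<and> compact (UNIV :: 'm set)"


section \<open>Tangent vectors and Riemannian metrics\<close>

definition transition_deriv ::
  "('m, 'n::finite) chart \<Rightarrow> ('m, 'n) chart \<Rightarrow> 'm \<Rightarrow> real^'n \<Rightarrow> real^'n" where
  "transition_deriv c d p = frechet_derivative (coords d \<circ> chart_inv c) (at (coords c p))"

text \<open>
  A tangent vector at \<open>p\<close> assigns to every chart around \<open>p\<close> a coordinate vector, compatibly with the
  derivatives of the transition maps; the value \<open>0\<close> at all other arguments only serves to make the
  representation unique.
\<close>

type_synonym ('m, 'n) tangent_vec = "('m, 'n) chart \<Rightarrow> (real, 'n) vec"

definition tangent_space ::
  "('m, 'n::finite) chart set \<Rightarrow> 'm \<Rightarrow> ('m, 'n) tangent_vec set" where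
  "tangent_space A p = {X.
     (\<forall>c\<in>A. \<forall>d\<in>A. p \<in> chart_dom c \<inter> chart_dom d \<longrightarrow> X d = transition_deriv c d p (X c)) \<and>
     (\<forall>c. \<not> (c \<in> A \<and> p \<in> chart_dom c) \<longrightarrow> X c = 0)}"

text \<open>The coordinate vector \<open>\<partial>/\<partial>x\<^sup>i\<close> of the chart \<open>c\<close> at the point \<open>p\<close>.\<close>

definition coord_vec ::
  "('m, 'n::finite) chart set \<Rightarrow> ('m, 'n) chart \<Rightarrow> 'm \<Rightarrow> 'n \<Rightarrow> ('m, 'n) tangent_vec" where
  "coord_vec A c p i =
     (\<lambda>d. if d \<in> A \<and> p \<in> chart_dom d then transition_deriv c d p (axis i 1) else 0)"

text \<open>A field of bilinear forms; only its values on \<^const>\<open>tangent_space\<close> matter.\<close>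

type_synonym ('m, 'n) form_field =
  "'m \<Rightarrow> ('m, 'n) tangent_vec \<Rightarrow> ('m, 'n) tangent_vec \<Rightarrow> real"

definition components ::
  "('m, 'n::finite) chart set \<Rightarrow> ('m, 'n) form_field \<Rightarrow> ('m, 'n) chart \<Rightarrow> real^'n \<Rightarrow> real^'n^'n" where
  "components A g c x =
     (let p = chart_inv c x in \<chi> i j. g p (coord_vec A c p i) (coord_vec A c p j))"

definition riemannian_metric ::
  "('m, 'n::finite) chart set \<Rightarrow> ('m, 'n) form_field \<Rightarrow> bool" where
  "riemannian_metric A g \<longleftrightarrow>
     (\<forall>p. \<forall>X\<in>tangent_space A p. \<forall>Y\<in>tangent_space A p. g p X Y = g p Y X) \<and>
     (\<forall>p. \<forall>X\<in>tangent_space A p. \<forall>Y\<in>tangent_space A p. \<forall>Z\<in>tangent_space A p. \<forall>a b.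
        g p (\<lambda>c. a *\<^sub>R X c + b *\<^sub>R Y c) Z = a * g p X Z + b * g p Y Z) \<and>
     (\<forall>p. \<forall>X\<in>tangent_space A p. X \<noteq> (\<lambda>_. 0) \<longrightarrow> g p X X > 0) \<and>
     (\<forall>c\<in>A. smooth_on (chart_img c) (components A g c))"


section \<open>Curvature\<close>

text \<open>
  Curvature in local coordinates, for a metric \<open>G\<close> given as a matrix-valued function on an open
  subset of Euclidean space.
\<close>

definition pderiv_at :: "'n::finite \<Rightarrow> (real^'n \<Rightarrow> real) \<Rightarrow> real^'n \<Rightarrow> real" where
  "pderiv_at i f x = frechet_derivative f (at x) (axis i 1)"

text \<open>\<open>christoffel G k i j\<close> is \<open>\<Gamma>\<^sup>k\<^sub>i\<^sub>j\<close>.\<close>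

definition christoffel ::
  "(real^'n \<Rightarrow> real^'n^'n) \<Rightarrow> 'n::finite \<Rightarrow> 'n \<Rightarrow> 'n \<Rightarrow> real^'n \<Rightarrow> real" where
  "christoffel G k i j x = 1/2 * (\<Sum>l\<in>UNIV. matrix_inv (G x) $ k $ l *
     (pderiv_at i (\<lambda>y. G y $ j $ l) x + pderiv_at j (\<lambda>y. G y $ i $ l) x
      - pderiv_at l (\<lambda>y. G y $ i $ j) x))"

text \<open>
  \<open>riemann G l k i j\<close> is the coefficient of \<open>\<partial>\<^sub>l\<close> in \<open>R(\<partial>\<^sub>i, \<partial>\<^sub>j) \<partial>\<^sub>k\<close>, where
  \<open>R(X, Y) Z = \<nabla>\<^sub>X \<nabla>\<^sub>Y Z - \<nabla>\<^sub>Y \<nabla>\<^sub>X Z - \<nabla>\<^bsub>[X, Y]\<^esub> Z\<close>; the Ricci tensor \<open>Ric(Y, Z)\<close> is the trace of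
  \<open>X \<mapsto> R(X, Y) Z\<close>.
\<close>

definition riemann ::
  "(real^'n \<Rightarrow> real^'n^'n) \<Rightarrow> 'n::finite \<Rightarrow> 'n \<Rightarrow> 'n \<Rightarrow> 'n \<Rightarrow> real^'n \<Rightarrow> real" where
  "riemann G l k i j x =
     pderiv_at i (christoffel G l j k) x - pderiv_at j (christoffel G l i k) x
     + (\<Sum>m\<in>UNIV. christoffel G l i m x * christoffel G m j k x
                 - christoffel G l j m x * christoffel G m i k x)"

definition local_ricci :: "(real^'n \<Rightarrow> real^'n^'n) \<Rightarrow> real^'n \<Rightarrow> real^'n^'n::finite" where
  "local_ricci G x = (\<chi> j k. \<Sum>i\<in>UNIV. riemann G i k i j x)"

definition local_scalar :: "(real^'n \<Rightarrow> real^'n^'n) \<Rightarrow> real^'n::finite \<Rightarrow> real" where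
  "local_scalar G x = (\<Sum>i\<in>UNIV. \<Sum>j\<in>UNIV. matrix_inv (G x) $ i $ j * local_ricci G x $ i $ j)"

text \<open>The components, in the chart \<open>c\<close>, of the Ricci tensor of the metric \<open>g\<close>.\<close>

definition ricci ::
  "('m, 'n::finite) chart set \<Rightarrow> ('m, 'n) form_field \<Rightarrow> ('m, 'n) chart \<Rightarrow> real^'n \<Rightarrow> real^'n^'n" where
  "ricci A g c = local_ricci (components A g c)"

text \<open>The value does not depend on the chart around \<open>p\<close> that is selected.\<close>

definition scalar_curvature ::
  "('m, 'n::finite) chart set \<Rightarrow> ('m, 'n) form_field \<Rightarrow> 'm \<Rightarrow> real" where
  "scalar_curvature A g p =
     (let c = (SOME c. c \<in> A \<and> p \<in> chart_dom c) in local_scalar (components A g c) (coords c p))"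


section \<open>Riemannian volume\<close>

text \<open>
  The unique Borel measure that in every chart of the atlas has density \<open>sqrt (det g\<^sub>i\<^sub>j)\<close> with respect
  to Lebesgue measure.
\<close>

definition riemannian_volume ::
  "('m::{t2_space, second_countable_topology}, 'n::finite) chart set \<Rightarrow> ('m, 'n) form_field
   \<Rightarrow> 'm measure" where
  "riemannian_volume A g = (THE \<mu>. sets \<mu> = sets borel \<and>
     (\<forall>c\<in>A. \<forall>B\<in>sets borel. B \<subseteq> chart_dom c \<longrightarrow>
        emeasure \<mu> B = (\<integral>\<^sup>+x\<in>coords c ` B. ennreal (sqrt (det (components A g c x))) \<partial>lborel)))"


section \<open>Ricci flow\<close>

text \<open>
  A Ricci flow is a family of metrics that is smooth in space and time (up to the endpoints that
  belong to \<open>J\<close>) and satisfies \<open>\<partial>g/\<partial>t = -2 Ric\<close>; this equation between tensors is expressed by the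
  equality of their components in every chart. Time derivatives at endpoints of \<open>J\<close> are one-sided.
\<close>

definition ricci_flow ::
  "('m, 'n::finite) chart set \<Rightarrow> real set \<Rightarrow> (real \<Rightarrow> ('m, 'n) form_field) \<Rightarrow> bool" where
  "ricci_flow A J g \<longleftrightarrow>
     (\<forall>t\<in>J. riemannian_metric A (g t)) \<and>
     (\<forall>c\<in>A. smooth_on (J \<times> chart_img c) (\<lambda>(t, x). components A (g t) c x)) \<and>
     (\<forall>t\<in>J. \<forall>c\<in>A. \<forall>x\<in>chart_img c.
        ((\<lambda>\<tau>. components A (g \<tau>) c x) has_vector_derivative (-2) *\<^sub>R ricci A (g t) c x)
          (at t within J))"

definition trivial_flow ::
  "('m, 'n::finite) chart set \<Rightarrow> real set \<Rightarrow> (real \<Rightarrow> ('m, 'n) form_field) \<Rightarrow> bool" where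
  "trivial_flow A J g \<longleftrightarrow> (\<forall>t\<in>J. \<forall>c\<in>A. \<forall>x\<in>chart_img c. ricci A (g t) c x = 0)"

end

theory Submission
  imports Defs
begin

text \<open>
  The hypothesis bounds the integral of the time derivative of the scalar curvature \<open>s\<close>, and that
  derivative is a nonnegative term plus a divergence. Write \<open>T = \<partial>\<Gamma>/\<partial>t\<close> for the velocity of the Christoffel
  symbols and put
    \<open>V\<^sup>i = g\<^sup>j\<^sup>k T\<^sup>i\<^sub>j\<^sub>k - g\<^sup>i\<^sup>j T\<^sup>k\<^sub>k\<^sub>j\<close>.
  Palatini's formula for the variation of the Ricci tensor says \<open>g\<^sup>j\<^sup>k \<partial>Ric\<^sub>j\<^sub>k/\<partial>t = div V\<close>, and the flow
  equation \<open>\<partial>g/\<partial>t = -2 Ric\<close> turns the remaining term \<open>(\<partial>g\<^sup>j\<^sup>k/\<partial>t) Ric\<^sub>j\<^sub>k\<close> into \<open>2 |Ric|\<^sup>2\<close>. Hence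
    \<open>\<partial>s/\<partial>t = 2 |Ric|\<^sup>2 + div V\<close>
  (\<open>scalar_evolution\<close>). On a closed manifold the divergence integrates to zero (\<open>divergence_theorem\<close>), so
  the hypothesis forces \<open>\<integral> |Ric|\<^sup>2 \<le> 0\<close>. As \<open>|Ric|\<^sup>2\<close> is continuous and nonnegative, it vanishes
  (\<open>continuous_nonneg_integral_zero\<close>), and since \<open>g\<close> is positive definite, \<open>Ric = 0\<close>
  (\<open>form_norm_sq_eq_0D\<close>).

  The identity is a computation in one chart. To integrate it, its terms must be independent of the chart.
  For \<open>s\<close> and \<open>|Ric|\<^sup>2\<close> this comes from the flow itself: \<open>Ric = - 1/2 \<partial>g/\<partial>t\<close> transforms like \<open>g\<close>, and for
  \<open>g\<close> the transformation rule is bilinearity. For \<open>V\<close> it comes from \<open>T\<close> being a tensor: the term in the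
  transformation rule of \<open>\<Gamma>\<close> that is not tensorial contains only second derivatives of the change of
  coordinates, which do not depend on time (\<open>Tdot_transform\<close>, \<open>Vel_transform\<close>).

  The divergence theorem is reduced by a partition of unity to vector fields of compact support in one
  chart. There it says that the integral over \<open>\<real>\<^sup>n\<close> of a partial derivative of a \<open>C\<^sup>1\<close> function of compact
  support is zero, which follows by differentiating the translation invariance of Lebesgue measure
  (\<open>integral_dir_deriv_zero\<close>). The volume measure has to be constructed first: the densities
  \<open>sqrt (det g\<^sub>i\<^sub>j)\<close> of the charts define the same measure on the overlaps by the change of variables
  formula (\<open>chart_measure_agree\<close>), and finitely many charts cover the manifold.

  All of this is done at times in the interior of \<open>J\<close>, where the metric is smooth on an open set of space
  and time. The flow equation then shows that the metric is constant in time on the interior, by continuity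
  it is constant on \<open>J\<close>, and the flow equation at an endpoint gives \<open>Ric = 0\<close> there as well.
\<close>

section \<open>Functions of class \<open>C\<^sup>k\<close> on open sets\<close>

abbreviation dir_deriv :: "'a::real_normed_vector \<Rightarrow> ('a \<Rightarrow> 'b::real_normed_vector) \<Rightarrow> 'a \<Rightarrow> 'b" where
  "dir_deriv v f x \<equiv> frechet_derivative f (at x) v"

lemma dir_deriv_eqI: "(f has_derivative f') (at x) \<Longrightarrow> dir_deriv v f x = f' v"
  using frechet_derivative_at by metis

lemma frechet_derivative_cong_on:
  assumes "x \<in> S" "\<And>y. y \<in> S \<Longrightarrow> f y = g y"
  shows "frechet_derivative f (at x within S) = frechet_derivative g (at x within S)"
proof -
  have "(f has_derivative D) (at x within S) \<longleftrightarrow> (g has_derivative D) (at x within S)" for D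
    using assms has_derivative_transform[of x S f g D] has_derivative_transform[of x S g f D] by auto
  then show ?thesis by (simp add: frechet_derivative_def)
qed

lemma Ck_on_cong:
  assumes "\<And>x. x \<in> S \<Longrightarrow> f x = g x"
  shows "Ck_on k S f \<longleftrightarrow> Ck_on k S g"
  using assms
proof (induction k arbitrary: f g)
  case 0
  then show ?case by (simp cong: continuous_on_cong)
next
  case (Suc k)
  have "f differentiable_on S \<longleftrightarrow> g differentiable_on S"
    unfolding differentiable_on_def differentiable_def
    using Suc.prems has_derivative_transform[of _ S f g] has_derivative_transform[of _ S g f]
    by (metis (no_types, lifting))
  moreover have "Ck_on k S (\<lambda>x. frechet_derivative f (at x within S) v)
      \<longleftrightarrow> Ck_on k S (\<lambda>x. frechet_derivative g (at x within S) v)" for v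
    by (rule Suc.IH) (simp add: frechet_derivative_cong_on[OF _ Suc.prems])
  ultimately show ?case by simp
qed

lemma Ck_on_Suc_open:
  assumes "open S"
  shows "Ck_on (Suc k) S f \<longleftrightarrow> (\<forall>x\<in>S. f differentiable at x) \<and> (\<forall>v. Ck_on k S (dir_deriv v f))"
proof -
  have "Ck_on k S (\<lambda>x. frechet_derivative f (at x within S) v) \<longleftrightarrow> Ck_on k S (dir_deriv v f)" for v
    by (rule Ck_on_cong) (simp add: at_within_open[OF _ assms])
  then show ?thesis
    by (simp add: differentiable_on_def at_within_open[OF _ assms])
qed

lemma Ck_on_SucD: "Ck_on (Suc k) S f \<Longrightarrow> Ck_on k S f"
proof (induction k arbitrary: f)
  case 0
  then show ?case by (simp add: differentiable_imp_continuous_on)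
next
  case (Suc k)
  have "Ck_on k S (\<lambda>x. frechet_derivative f (at x within S) v)" for v
    using Suc.prems by (intro Suc.IH) (subst (asm) Ck_on.simps(2), blast)
  with Suc.prems show ?case by simp
qed

lemma Ck_on_imp_continuous_on: "Ck_on k S f \<Longrightarrow> continuous_on S f"
  by (induction k) (use Ck_on_SucD in \<open>auto simp: differentiable_imp_continuous_on\<close>)

text \<open>
  On open sets \<open>Ck_on_Suc_open\<close> takes the place of this equation, which speaks of derivatives within the set.
\<close>

declare Ck_on.simps(2) [simp del]

lemma Ck_on_subset_open:
  assumes "open T" "T \<subseteq> S"
  shows "Ck_on k S f \<Longrightarrow> Ck_on k T f"
proof (induction k arbitrary: f)
  case 0
  then show ?case using assms continuous_on_subset by (auto)
next
  case (Suc k)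
  have eq: "at x within S = at x" if "x \<in> T" for x
    using that assms by (meson at_within_interior interior_maximal subsetD)
  have "f differentiable at x" if "x \<in> T" for x
    using Suc.prems that assms by (force simp: Ck_on.simps(2) differentiable_on_def eq dest!: bspec[of _ _ x])
  moreover have "Ck_on k T (dir_deriv v f)" for v
  proof -
    have "Ck_on k T (\<lambda>x. frechet_derivative f (at x within S) v)"
      using Suc.prems by (intro Suc.IH) (auto simp: Ck_on.simps(2))
    then show ?thesis
      by (rule Ck_on_cong[THEN iffD1, rotated]) (simp add: eq)
  qed
  ultimately show ?case by (simp add: Ck_on_Suc_open[OF \<open>open T\<close>])
qed

lemma Ck_on_Un_open:
  assumes "open S" "open T" "Ck_on k S f" "Ck_on k T f"
  shows "Ck_on k (S \<union> T) f"
  using assms(3,4)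
proof (induction k arbitrary: f)
  case 0
  then show ?case using assms continuous_on_open_Un by auto
next
  case (Suc k)
  then show ?case
    by (auto simp: Ck_on_Suc_open[OF assms(1)] Ck_on_Suc_open[OF assms(2)]
      Ck_on_Suc_open[OF open_Un[OF assms(1,2)]])
qed

lemma Ck_on_const: "open S \<Longrightarrow> Ck_on k S (\<lambda>x. c)"
  by (induction k arbitrary: c) (auto simp: Ck_on_Suc_open)

text \<open>
  Together with \<open>Ck_on_SucE\<close> this is the form in which the closure properties below are proved: a known
  derivative, given by a formula, need not be recognised as the Frechet derivative each time.
\<close>

lemma Ck_on_SucI:
  assumes "open S" "\<And>x. x \<in> S \<Longrightarrow> (f has_derivative D x) (at x)" "\<And>v. Ck_on k S (\<lambda>x. D x v)"
  shows "Ck_on (Suc k) S f"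
proof -
  have "Ck_on k S (dir_deriv v f)" for v
    by (rule Ck_on_cong[THEN iffD1, OF _ assms(3)]) (simp add: dir_deriv_eqI[OF assms(2)])
  then show ?thesis
    using assms(2) by (auto simp: Ck_on_Suc_open[OF \<open>open S\<close>] differentiable_def)
qed

lemma Ck_on_SucE:
  assumes "open S" "Ck_on (Suc k) S f"
  shows "x \<in> S \<Longrightarrow> (f has_derivative (\<lambda>v. dir_deriv v f x)) (at x)" "Ck_on k S (dir_deriv v f)"
  using assms by (auto simp: Ck_on_Suc_open frechet_derivative_works[symmetric])

lemma Ck_on_bounded_linear:
  assumes "open S" "bounded_linear L"
  shows "Ck_on k S f \<Longrightarrow> Ck_on k S (\<lambda>x. L (f x))"
proof (induction k arbitrary: f)
  case 0
  then show ?case using bounded_linear.continuous_on[OF assms(2)] by auto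
next
  case (Suc k)
  note E = Ck_on_SucE[OF \<open>open S\<close> Suc.prems]
  show ?case
    by (rule Ck_on_SucI[OF \<open>open S\<close> bounded_linear.has_derivative[OF assms(2) E(1)] Suc.IH[OF E(2)]])
qed

lemma Ck_on_add:
  assumes "open S"
  shows "Ck_on k S f \<Longrightarrow> Ck_on k S g \<Longrightarrow> Ck_on k S (\<lambda>x. f x + g x)"
proof (induction k arbitrary: f g)
  case 0
  then show ?case by (auto intro: continuous_intros)
next
  case (Suc k)
  note E = Ck_on_SucE[OF \<open>open S\<close> Suc.prems(1)] Ck_on_SucE[OF \<open>open S\<close> Suc.prems(2)]
  show ?case
    by (rule Ck_on_SucI[OF \<open>open S\<close> has_derivative_add[OF E(1,3)] Suc.IH[OF E(2,4)]])
qed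

lemma Ck_on_mult:
  fixes f g :: "'a::euclidean_space \<Rightarrow> real"
  assumes "open S"
  shows "Ck_on k S f \<Longrightarrow> Ck_on k S g \<Longrightarrow> Ck_on k S (\<lambda>x. f x * g x)"
proof (induction k arbitrary: f g)
  case 0
  then show ?case by (auto intro: continuous_intros)
next
  case (Suc k)
  note E = Ck_on_SucE[OF \<open>open S\<close> Suc.prems(1)] Ck_on_SucE[OF \<open>open S\<close> Suc.prems(2)]
  show ?case
    by (rule Ck_on_SucI[OF \<open>open S\<close> has_derivative_mult[OF E(1,3)]], assumption, assumption)
      (intro Ck_on_add \<open>open S\<close> Suc.IH E(2,4) Ck_on_SucD[OF Suc.prems(1)] Ck_on_SucD[OF Suc.prems(2)])
qed

lemma Ck_on_inverse:
  fixes f :: "'a::euclidean_space \<Rightarrow> real"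
  assumes "open S" and nz: "\<And>x. x \<in> S \<Longrightarrow> f x \<noteq> 0"
  shows "Ck_on k S f \<Longrightarrow> Ck_on k S (\<lambda>x. inverse (f x))"
proof (induction k)
  case 0
  then show ?case using nz by (auto intro: continuous_intros)
next
  case (Suc k)
  note E = Ck_on_SucE[OF \<open>open S\<close> Suc.prems]
  show ?case
  proof (rule Ck_on_SucI[OF \<open>open S\<close> Deriv.has_derivative_inverse[OF nz E(1)]])
    have "Ck_on k S (\<lambda>x. (-1) * (inverse (f x) * dir_deriv v f x * inverse (f x)))" for v
      by (intro Ck_on_mult \<open>open S\<close> Ck_on_const Suc.IH E(2) Suc.prems[THEN Ck_on_SucD])
    then show "Ck_on k S (\<lambda>x. - (inverse (f x) * dir_deriv v f x * inverse (f x)))" for v by simp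
  qed
qed

lemma Ck_on_sqrt:
  fixes f :: "'a::euclidean_space \<Rightarrow> real"
  assumes "open S" and pos: "\<And>x. x \<in> S \<Longrightarrow> f x > 0"
  shows "Ck_on k S f \<Longrightarrow> Ck_on k S (\<lambda>x. sqrt (f x))"
proof (induction k)
  case 0
  then show ?case by (auto intro: continuous_intros)
next
  case (Suc k)
  note E = Ck_on_SucE[OF \<open>open S\<close> Suc.prems]
  show ?case
  proof (rule Ck_on_SucI[OF \<open>open S\<close>])
    show "((\<lambda>x. sqrt (f x)) has_derivative (\<lambda>v. dir_deriv v f x * (1/2 * inverse (sqrt (f x))))) (at x)"
      if "x \<in> S" for x
      using has_derivative_real_sqrt[OF pos[OF that] E(1)[OF that]] by (simp add: field_simps)
    have "sqrt (f x) \<noteq> 0" if "x \<in> S" for x using pos[OF that] by simp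
    then show "Ck_on k S (\<lambda>x. dir_deriv v f x * (1/2 * inverse (sqrt (f x))))" for v
      by (intro Ck_on_mult \<open>open S\<close> Ck_on_const Ck_on_inverse E(2) Suc.IH Suc.prems[THEN Ck_on_SucD])
  qed
qed

lemma Ck_on_diff:
  fixes f g :: "'a::euclidean_space \<Rightarrow> 'b::real_normed_vector"
  assumes "open S" "Ck_on k S f" "Ck_on k S g"
  shows "Ck_on k S (\<lambda>x. f x - g x)"
  using Ck_on_add[OF assms(1,2) Ck_on_bounded_linear[OF assms(1) bounded_linear_minus[OF bounded_linear_ident] assms(3)]]
  by simp

lemma Ck_on_sum:
  assumes "open S" "\<And>i. i \<in> A \<Longrightarrow> Ck_on k S (f i)"
  shows "Ck_on k S (\<lambda>x. \<Sum>i\<in>A. f i x)"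
  using assms(2)
  by (induction A rule: infinite_finite_induct) (auto intro: Ck_on_const Ck_on_add \<open>open S\<close>)

lemma Ck_on_prod:
  fixes f :: "'i \<Rightarrow> 'a::euclidean_space \<Rightarrow> real"
  assumes "open S" "\<And>i. i \<in> A \<Longrightarrow> Ck_on k S (f i)"
  shows "Ck_on k S (\<lambda>x. \<Prod>i\<in>A. f i x)"
  using assms(2)
  by (induction A rule: infinite_finite_induct) (auto intro: Ck_on_const Ck_on_mult \<open>open S\<close>)

lemma Ck_on_det:
  fixes M :: "'a::euclidean_space \<Rightarrow> real^'n^'n"
  assumes "open S" "\<And>i j. Ck_on k S (\<lambda>x. M x $ i $ j)"
  shows "Ck_on k S (\<lambda>x. det (M x))"
  unfolding det_def by (intro Ck_on_sum Ck_on_prod Ck_on_mult Ck_on_const assms)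

lemma matrix_inv_inverse:
  fixes A :: "real^'n^'n"
  assumes "det A \<noteq> 0"
  shows "A ** matrix_inv A = mat 1" "matrix_inv A ** A = mat 1"
proof -
  have "\<exists>B. A ** B = mat 1 \<and> B ** A = mat 1"
    using assms by (simp add: invertible_det_nz[symmetric] invertible_def)
  from someI_ex[OF this] show "A ** matrix_inv A = mat 1" "matrix_inv A ** A = mat 1"
    by (simp_all add: matrix_inv_def)
qed

text \<open>
  Smoothness of the inverse matrix is read off from Cramer's rule, which expresses its entries by
  determinants, that is, by polynomials in the entries of the matrix, and one reciprocal.
\<close>

lemma matrix_inv_cramer:
  fixes A :: "real^'n^'n"
  assumes "det A \<noteq> 0"
  shows "matrix_inv A $ k $ l = det (\<chi> i j. if j = k then (if i = l then 1 else 0) else A$i$j) * inverse (det A)"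
proof -
  have "A ** matrix_inv A = mat 1"
    using assms by (rule matrix_inv_inverse)
  then have "A *v column l (matrix_inv A) = axis l 1"
    by (simp add: vec_eq_iff matrix_matrix_mult_def matrix_vector_mult_def column_def mat_def axis_def)
  then have "column l (matrix_inv A) = (\<chi> k. det(\<chi> i j. if j=k then axis l 1 $ i else A$i$j) / det A)"
    using cramer[OF assms] by blast
  then have "column l (matrix_inv A) $ k = det(\<chi> i j. if j=k then axis l 1 $ i else A$i$j) / det A"
    by simp
  moreover have "(\<chi> i j. if j=k then axis l 1 $ i else A$i$j)
     = (\<chi> i j. if j = k then (if i = l then 1 else 0) else A$i$j)"
    by (simp add: vec_eq_iff axis_def)
  ultimately show ?thesis by (simp add: column_def field_simps)
qed

lemma Ck_on_matrix_inv:
  fixes M :: "'a::euclidean_space \<Rightarrow> real^'n^'n"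
  assumes "open S" "\<And>i j. Ck_on k S (\<lambda>x. M x $ i $ j)" "\<And>x. x \<in> S \<Longrightarrow> det (M x) \<noteq> 0"
  shows "Ck_on k S (\<lambda>x. matrix_inv (M x) $ a $ b)"
proof (rule Ck_on_cong[THEN iffD1])
  have ite: "Ck_on k S (\<lambda>x. if P then f x else h x)" if "Ck_on k S f" "Ck_on k S h"
    for P and f h :: "'a \<Rightarrow> real"
    using that by (cases P) simp_all
  have "Ck_on k S (\<lambda>x. (\<chi> i j. if j = a then (if i = b then 1 else 0) else M x$i$j) $ i $ j)" for i j
    by (simp only: vec_lambda_beta) (intro ite Ck_on_const assms)
  then show "Ck_on k S (\<lambda>x. det (\<chi> i j. if j = a then (if i = b then 1 else 0) else M x$i$j) * inverse (det (M x)))"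
    by (intro Ck_on_mult Ck_on_det Ck_on_inverse assms)
qed (simp add: matrix_inv_cramer assms)

lemma smooth_on_cong: "(\<And>x. x \<in> S \<Longrightarrow> f x = g x) \<Longrightarrow> smooth_on S f \<longleftrightarrow> smooth_on S g"
  unfolding smooth_on_def using Ck_on_cong by blast

lemma smooth_on_subset_open: "smooth_on S f \<Longrightarrow> open T \<Longrightarrow> T \<subseteq> S \<Longrightarrow> smooth_on T f"
  unfolding smooth_on_def using Ck_on_subset_open by blast

lemma smooth_on_differentiable: "smooth_on S f \<Longrightarrow> open S \<Longrightarrow> x \<in> S \<Longrightarrow> f differentiable at x"
  unfolding smooth_on_def using Ck_on_Suc_open by blast

lemma smooth_on_dir_deriv: "smooth_on S f \<Longrightarrow> open S \<Longrightarrow> smooth_on S (dir_deriv v f)"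
  unfolding smooth_on_def using Ck_on_Suc_open by blast

lemma smooth_on_imp_Ck: "smooth_on S f \<Longrightarrow> Ck_on k S f"
  unfolding smooth_on_def by blast

lemma smooth_on_const: "open S \<Longrightarrow> smooth_on S (\<lambda>x. c)"
  by (simp add: smooth_on_def Ck_on_const)

lemma smooth_on_bounded_linear:
  "open S \<Longrightarrow> bounded_linear L \<Longrightarrow> smooth_on S f \<Longrightarrow> smooth_on S (\<lambda>x. L (f x))"
  by (simp add: smooth_on_def Ck_on_bounded_linear)

lemma smooth_on_vec_nth: "open S \<Longrightarrow> smooth_on S f \<Longrightarrow> smooth_on S (\<lambda>x. f x $ i)"
  by (rule smooth_on_bounded_linear[OF _ bounded_linear_vec_nth])

lemma smooth_on_add: "open S \<Longrightarrow> smooth_on S f \<Longrightarrow> smooth_on S g \<Longrightarrow> smooth_on S (\<lambda>x. f x + g x)"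
  by (simp add: smooth_on_def Ck_on_add)

lemma smooth_on_diff: "open S \<Longrightarrow> smooth_on S f \<Longrightarrow> smooth_on S g \<Longrightarrow> smooth_on S (\<lambda>x. f x - g x)"
  by (simp add: smooth_on_def Ck_on_diff)

lemma smooth_on_mult:
  fixes f g :: "'a::euclidean_space \<Rightarrow> real"
  shows "open S \<Longrightarrow> smooth_on S f \<Longrightarrow> smooth_on S g \<Longrightarrow> smooth_on S (\<lambda>x. f x * g x)"
  by (simp add: smooth_on_def Ck_on_mult)

lemma smooth_on_sum: "open S \<Longrightarrow> (\<And>i. i \<in> A \<Longrightarrow> smooth_on S (f i)) \<Longrightarrow> smooth_on S (\<lambda>x. \<Sum>i\<in>A. f i x)"
  by (simp add: smooth_on_def Ck_on_sum)

lemma smooth_on_det: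
  fixes M :: "'a::euclidean_space \<Rightarrow> real^'n^'n"
  shows "open S \<Longrightarrow> (\<And>i j. smooth_on S (\<lambda>x. M x $ i $ j)) \<Longrightarrow> smooth_on S (\<lambda>x. det (M x))"
  by (simp add: smooth_on_def Ck_on_det)

lemma smooth_on_matrix_inv:
  fixes M :: "'a::euclidean_space \<Rightarrow> real^'n^'n"
  shows "open S \<Longrightarrow> (\<And>i j. smooth_on S (\<lambda>x. M x $ i $ j)) \<Longrightarrow> (\<And>x. x \<in> S \<Longrightarrow> det (M x) \<noteq> 0)
    \<Longrightarrow> smooth_on S (\<lambda>x. matrix_inv (M x) $ a $ b)"
  by (simp add: smooth_on_def Ck_on_matrix_inv)

lemma smooth_on_sqrt:
  fixes f :: "'a::euclidean_space \<Rightarrow> real"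
  shows "open S \<Longrightarrow> smooth_on S f \<Longrightarrow> (\<And>x. x \<in> S \<Longrightarrow> f x > 0) \<Longrightarrow> smooth_on S (\<lambda>x. sqrt (f x))"
  by (simp add: smooth_on_def Ck_on_sqrt)

lemma has_derivative_dir_deriv:
  "f differentiable at x \<Longrightarrow> (f has_derivative (\<lambda>v. dir_deriv v f x)) (at x)"
  by (simp add: frechet_derivative_works[symmetric])

lemma dir_deriv_add:
  assumes "f differentiable at x" "g differentiable at x"
  shows "dir_deriv v (\<lambda>x. f x + g x) x = dir_deriv v f x + dir_deriv v g x"
  by (rule dir_deriv_eqI[OF has_derivative_add[OF assms[THEN has_derivative_dir_deriv]]])

lemma dir_deriv_diff:
  assumes "f differentiable at x" "g differentiable at x"
  shows "dir_deriv v (\<lambda>x. f x - g x) x = dir_deriv v f x - dir_deriv v g x"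
  by (rule dir_deriv_eqI[OF has_derivative_diff[OF assms[THEN has_derivative_dir_deriv]]])

lemma dir_deriv_mult:
  fixes f g :: "'a::real_normed_vector \<Rightarrow> real"
  assumes "f differentiable at x" "g differentiable at x"
  shows "dir_deriv v (\<lambda>x. f x * g x) x = dir_deriv v f x * g x + f x * dir_deriv v g x"
  using dir_deriv_eqI[OF has_derivative_mult[OF assms[THEN has_derivative_dir_deriv]]] by simp

lemma dir_deriv_sum:
  assumes "\<And>i. i \<in> A \<Longrightarrow> f i differentiable at x"
  shows "dir_deriv v (\<lambda>x. \<Sum>i\<in>A. f i x) x = (\<Sum>i\<in>A. dir_deriv v (f i) x)"
  by (rule dir_deriv_eqI[OF has_derivative_sum]) (use assms has_derivative_dir_deriv in auto)

lemma dir_deriv_cong_open: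
  assumes "open S" "x \<in> S" "\<And>y. y \<in> S \<Longrightarrow> f y = g y"
  shows "dir_deriv v f x = dir_deriv v g x"
  using frechet_derivative_cong_on[of x S f g] assms at_within_open[of x S] by metis

lemma dir_deriv_linear:
  assumes "f differentiable at x"
  shows "linear (\<lambda>v. dir_deriv v f x)"
  using assms by (simp add: linear_frechet_derivative)

section \<open>Symmetry of second derivatives\<close>

lemma has_real_derivative_along_line:
  fixes f :: "'a::real_normed_vector \<Rightarrow> real"
  assumes "f differentiable at (a + s *\<^sub>R u)"
  shows "((\<lambda>s. f (a + s *\<^sub>R u)) has_real_derivative dir_deriv u f (a + s *\<^sub>R u)) (at s)"
proof -
  have "((\<lambda>s. a + s *\<^sub>R u) has_derivative (\<lambda>h. h *\<^sub>R u)) (at s)"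
    by (auto intro!: derivative_eq_intros)
  from diff_chain_at[OF this has_derivative_dir_deriv[OF assms]]
  show ?thesis
    using linear_cmul[OF dir_deriv_linear[OF assms]]
    by (simp add: o_def has_field_derivative_def mult.commute[of _ "dir_deriv u f (a + s *\<^sub>R u)"] mult_commute_abs)
qed

text \<open>
  The second difference on the left is symmetric in \<open>u\<close> and \<open>v\<close>, the expression on the right is not.
  Applying the lemma in both orders and letting \<open>h\<close> tend to \<open>0\<close> gives the symmetry of second derivatives.
  The mean value theorem is applied first in direction \<open>u\<close> to the difference in direction \<open>v\<close>, and then in
  direction \<open>v\<close>.
\<close>

lemma second_difference_mean_value:
  fixes f :: "'a::euclidean_space \<Rightarrow> real"
  assumes "open S" and C2: "Ck_on 2 S f" and "h > 0"
    and inS: "\<And>s t. 0 \<le> s \<Longrightarrow> s \<le> h \<Longrightarrow> 0 \<le> t \<Longrightarrow> t \<le> h \<Longrightarrow> x + s *\<^sub>R u + t *\<^sub>R v \<in> S"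
  obtains s t where "0 \<le> s" "s \<le> h" "0 \<le> t" "t \<le> h"
    "f (x + h *\<^sub>R u + h *\<^sub>R v) - f (x + h *\<^sub>R u) - f (x + h *\<^sub>R v) + f x
      = h * h * dir_deriv v (dir_deriv u f) (x + s *\<^sub>R u + t *\<^sub>R v)"
proof -
  have C2': "Ck_on (Suc (Suc 0)) S f" using C2 by (simp add: numeral_2_eq_2)
  have df: "f differentiable at y" if "y \<in> S" for y
    using C2' that by (simp add: Ck_on_Suc_open[OF \<open>open S\<close>] del: Ck_on.simps)
  have ddf: "dir_deriv u f differentiable at y" if "y \<in> S" for y
    using C2' that by (simp add: Ck_on_Suc_open[OF \<open>open S\<close>] del: Ck_on.simps)
  define \<phi> where "\<phi> s = f ((x + h *\<^sub>R v) + s *\<^sub>R u) - f (x + s *\<^sub>R u)" for s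
  have "(\<phi> has_real_derivative
      dir_deriv u f ((x + h *\<^sub>R v) + s *\<^sub>R u) - dir_deriv u f (x + s *\<^sub>R u)) (at s)" if "0 \<le> s" "s \<le> h" for s
    unfolding \<phi>_def using inS[of s h] inS[of s 0] that \<open>h > 0\<close>
    by (intro DERIV_diff has_real_derivative_along_line df) (auto simp: algebra_simps)
  from MVT2[OF \<open>h > 0\<close>, of \<phi>, OF this] obtain s where s: "0 < s" "s < h"
    "\<phi> h - \<phi> 0 = h * (dir_deriv u f ((x + h *\<^sub>R v) + s *\<^sub>R u) - dir_deriv u f (x + s *\<^sub>R u))"
    by auto
  have "((\<lambda>t. dir_deriv u f ((x + s *\<^sub>R u) + t *\<^sub>R v)) has_real_derivative
      dir_deriv v (dir_deriv u f) ((x + s *\<^sub>R u) + t *\<^sub>R v)) (at t)" if "0 \<le> t" "t \<le> h" for t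
    using inS[of s t] that s by (intro has_real_derivative_along_line ddf) (auto simp: algebra_simps)
  from MVT2[OF \<open>h > 0\<close>, of "\<lambda>t. dir_deriv u f ((x + s *\<^sub>R u) + t *\<^sub>R v)", OF this] obtain t where t: "0 < t" "t < h"
    "dir_deriv u f ((x + s *\<^sub>R u) + h *\<^sub>R v) - dir_deriv u f (x + s *\<^sub>R u)
       = h * dir_deriv v (dir_deriv u f) ((x + s *\<^sub>R u) + t *\<^sub>R v)"
    by auto
  have "\<phi> h - \<phi> 0 = f (x + h *\<^sub>R u + h *\<^sub>R v) - f (x + h *\<^sub>R u) - f (x + h *\<^sub>R v) + f x"
    by (simp add: \<phi>_def algebra_simps)
  moreover have "x + h *\<^sub>R v + s *\<^sub>R u = x + s *\<^sub>R u + h *\<^sub>R v" by simp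
  ultimately show ?thesis
    using s t by (intro that[of s t]) auto
qed

lemma dir_deriv_commute:
  fixes f :: "'a::euclidean_space \<Rightarrow> real"
  assumes "open S" and C2: "Ck_on 2 S f" and "x \<in> S"
  shows "dir_deriv v (dir_deriv u f) x = dir_deriv u (dir_deriv v f) x"
proof (rule ccontr)
  have C2': "Ck_on (Suc (Suc 0)) S f" using C2 by (simp add: numeral_2_eq_2)
  have cont: "isCont (dir_deriv b (dir_deriv a f)) x" for a b
  proof -
    have "continuous_on S (dir_deriv b (dir_deriv a f))"
      using C2' by (simp add: Ck_on_Suc_open[OF \<open>open S\<close>] del: Ck_on.simps(2))
    then show ?thesis using assms by (simp add: continuous_on_eq_continuous_at)
  qed
  let ?A = "dir_deriv v (dir_deriv u f)" and ?B = "dir_deriv u (dir_deriv v f)"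
  assume "?A x \<noteq> ?B x"
  define e where "e = \<bar>?A x - ?B x\<bar> / 2"
  have "e > 0" using \<open>?A x \<noteq> ?B x\<close> by (simp add: e_def)
  obtain r where "r > 0" "ball x r \<subseteq> S" using assms open_contains_ball by blast
  obtain d1 where d1: "d1 > 0" "\<And>y. dist y x < d1 \<Longrightarrow> \<bar>?A y - ?A x\<bar> < e"
    using cont[where a=u and b=v, unfolded continuous_at_eps_delta, rule_format, OF \<open>e > 0\<close>]
    unfolding dist_real_def by blast
  obtain d2 where d2: "d2 > 0" "\<And>y. dist y x < d2 \<Longrightarrow> \<bar>?B y - ?B x\<bar> < e"
    using cont[where a=v and b=u, unfolded continuous_at_eps_delta, rule_format, OF \<open>e > 0\<close>]
    unfolding dist_real_def by blast
  define d where "d = min r (min d1 d2)"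
  \<comment> \<open>With this side length the parallelogram at \<open>x\<close> spanned by \<open>h u\<close> and \<open>h v\<close> lies in the ball of radius \<open>d\<close>.\<close>
  define h where "h = d / (2 * (norm u + norm v + 1))"
  have "d > 0" using d1 d2 \<open>r > 0\<close> by (simp add: d_def)
  have np: "norm u + norm v + 1 > 0" by (smt (verit) norm_ge_zero)
  have "h > 0" using \<open>d > 0\<close> np by (simp add: h_def)
  have close: "dist (x + s *\<^sub>R u + t *\<^sub>R v) x < d" if "0 \<le> s" "s \<le> h" "0 \<le> t" "t \<le> h" for s t
  proof -
    have "dist (x + s *\<^sub>R u + t *\<^sub>R v) x \<le> norm (s *\<^sub>R u) + norm (t *\<^sub>R v)"
      using norm_triangle_ineq[of "s *\<^sub>R u" "t *\<^sub>R v"] by (simp add: dist_norm add.assoc)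
    also have "\<dots> \<le> h * norm u + h * norm v"
      using that by (simp add: mult_mono add_mono)
    also have "\<dots> \<le> h * (norm u + norm v + 1)" using \<open>h > 0\<close> by (simp add: algebra_simps)
    also have "\<dots> = d / 2" using np unfolding h_def by (metis (no_types, lifting) less_irrefl mult.commute nonzero_mult_div_cancel_left times_divide_times_eq nonzero_eq_divide_eq divide_divide_eq_left)
    also have "\<dots> < d" using \<open>d > 0\<close> by simp
    finally show ?thesis .
  qed
  have inS: "x + s *\<^sub>R u + t *\<^sub>R v \<in> S" if "0 \<le> s" "s \<le> h" "0 \<le> t" "t \<le> h" for s t
    using close[OF that] \<open>ball x r \<subseteq> S\<close> by (auto simp: d_def dist_commute)
  obtain s t where st: "0 \<le> s" "s \<le> h" "0 \<le> t" "t \<le> h"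
    "f (x + h *\<^sub>R u + h *\<^sub>R v) - f (x + h *\<^sub>R u) - f (x + h *\<^sub>R v) + f x = h * h * ?A (x + s *\<^sub>R u + t *\<^sub>R v)"
    using second_difference_mean_value[OF \<open>open S\<close> C2 \<open>h > 0\<close> inS] by blast
  have inS': "x + s *\<^sub>R v + t *\<^sub>R u \<in> S" if "0 \<le> s" "s \<le> h" "0 \<le> t" "t \<le> h" for s t
    using inS[of t s] that by (simp add: algebra_simps)
  obtain s' t' where st': "0 \<le> s'" "s' \<le> h" "0 \<le> t'" "t' \<le> h"
    "f (x + h *\<^sub>R v + h *\<^sub>R u) - f (x + h *\<^sub>R v) - f (x + h *\<^sub>R u) + f x = h * h * ?B (x + s' *\<^sub>R v + t' *\<^sub>R u)"
    using second_difference_mean_value[OF \<open>open S\<close> C2 \<open>h > 0\<close> inS'] by blast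
  have "h * h * ?A (x + s *\<^sub>R u + t *\<^sub>R v) = h * h * ?B (x + s' *\<^sub>R v + t' *\<^sub>R u)"
    using st(5) st'(5) by (simp add: algebra_simps)
  then have eq: "?A (x + s *\<^sub>R u + t *\<^sub>R v) = ?B (x + s' *\<^sub>R v + t' *\<^sub>R u)"
    using \<open>h > 0\<close> by simp
  have "\<bar>?A (x + s *\<^sub>R u + t *\<^sub>R v) - ?A x\<bar> < e"
    using close[OF st(1-4)] by (intro d1) (simp add: d_def)
  moreover have "\<bar>?B (x + s' *\<^sub>R v + t' *\<^sub>R u) - ?B x\<bar> < e"
    using close[OF st'(3,4,1,2)] by (intro d2) (simp add: d_def algebra_simps)
  moreover have False if "\<bar>a - p\<bar> < \<bar>p - q\<bar> / 2" "\<bar>b - q\<bar> < \<bar>p - q\<bar> / 2" "a = b" for a b p q :: real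
    using that by (simp add: abs_if split: if_splits)
  ultimately show False using eq unfolding e_def by blast
qed

section \<open>Positive definite matrices, determinants and inverses\<close>

text \<open>
  The set \<open>B\<close> is a \<open>G\<close>-orthonormal set of maximal cardinality. It spans the whole space: if not, a vector outside of the span, made orthogonal and normalised, could be added.
\<close>

lemma orthonormal_basis_of_form:
  fixes G :: "real^'n^'n"
  assumes sym: "\<And>v w. v \<bullet> (G *v w) = w \<bullet> (G *v v)" and pos: "\<And>v. v \<noteq> 0 \<Longrightarrow> v \<bullet> (G *v v) > 0"
  obtains B where "finite B" "\<And>v. v = (\<Sum>b\<in>B. (b \<bullet> (G *v v)) *\<^sub>R b)"
proof -
  define ON where "ON B \<longleftrightarrow> finite B \<and> (\<forall>b\<in>B. \<forall>c\<in>B. b \<bullet> (G *v c) = (if b = c then 1 else 0))"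
    for B :: "(real^'n) set"
  have coeff: "b \<bullet> (G *v (\<Sum>c\<in>B. u c *\<^sub>R c)) = u b" if "ON B" "b \<in> B" for B b and u :: "real^'n \<Rightarrow> real"
  proof -
    have "b \<bullet> (G *v (\<Sum>c\<in>B. u c *\<^sub>R c)) = (\<Sum>c\<in>B. u c * (b \<bullet> (G *v c)))"
      by (simp add: linear_sum[OF matrix_vector_mul_linear] inner_sum_right matrix_vector_mult_scaleR)
    also have "\<dots> = (\<Sum>c\<in>B. if b = c then u c else 0)"
      using that by (intro sum.cong) (auto simp: ON_def)
    finally show ?thesis using that by (simp add: ON_def)
  qed
  have indep: "independent B" if "ON B" for B
  proof (rule independent_if_scalars_zero)
    show "finite B" using that by (simp add: ON_def)
    fix f :: "real^'n \<Rightarrow> real" and x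
    assume "(\<Sum>x\<in>B. f x *\<^sub>R x) = 0" "x \<in> B"
    then show "f x = 0" using coeff[OF that, of x f] by simp
  qed
  have "ON {}" by (simp add: ON_def)
  moreover have "\<forall>B. ON B \<longrightarrow> card B \<le> DIM(real^'n)"
    using indep independent_bound by blast
  ultimately obtain B where B: "ON B" and max: "\<And>C. ON C \<Longrightarrow> card C \<le> card B"
    using ex_has_greatest_nat[of ON "{}" card] by (metis less_Suc_eq_le)
  have finB: "finite B" using B by (simp add: ON_def)
  have span: "span B = UNIV"
  proof (rule ccontr)
    assume "span B \<noteq> UNIV"
    then obtain v where v: "v \<notin> span B" by auto
    \<comment> \<open>the component of \<open>v\<close> that is orthogonal to the span of \<open>B\<close>\<close>
  define w where "w = v - (\<Sum>b\<in>B. (b \<bullet> (G *v v)) *\<^sub>R b)"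
    have w_notin: "w \<notin> span B"
    proof
      assume "w \<in> span B"
      then have "w + (\<Sum>b\<in>B. (b \<bullet> (G *v v)) *\<^sub>R b) \<in> span B"
        by (rule span_add) (intro span_sum span_scale span_base)
      then show False using v by (simp add: w_def)
    qed
    then have "w \<noteq> 0" using span_zero by metis
    have orth: "b \<bullet> (G *v w) = 0" if "b \<in> B" for b
      using coeff[OF B that, of "\<lambda>c. c \<bullet> (G *v v)"]
      by (simp add: w_def matrix_vector_mult_diff_distrib inner_diff_right)
    define k where "k = inverse (sqrt (w \<bullet> (G *v w)))"
    have "k \<noteq> 0" "k * k * (w \<bullet> (G *v w)) = 1"
      using pos[OF \<open>w \<noteq> 0\<close>] by (simp_all add: k_def field_simps)
    have "ON (insert (k *\<^sub>R w) B)"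
    proof -
      have kw: "k *\<^sub>R w \<notin> B"
        using w_notin \<open>k \<noteq> 0\<close> span_base span_scale[of "k *\<^sub>R w" B "inverse k"] by force
      have "(k *\<^sub>R w) \<bullet> (G *v (k *\<^sub>R w)) = 1"
        using \<open>k * k * (w \<bullet> (G *v w)) = 1\<close> by (simp add: matrix_vector_mult_scaleR)
      moreover have "b \<bullet> (G *v (k *\<^sub>R w)) = 0" "(k *\<^sub>R w) \<bullet> (G *v b) = 0" if "b \<in> B" for b
        using orth[OF that] sym[of w b] by (simp_all add: matrix_vector_mult_scaleR)
      ultimately show ?thesis using B kw unfolding ON_def by auto
    qed
    then have "card (insert (k *\<^sub>R w) B) \<le> card B" by (rule max)
    then have "k *\<^sub>R w \<in> B" using finB by (metis card_insert_disjoint not_less_eq_eq order_refl)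
    then have "inverse k *\<^sub>R (k *\<^sub>R w) \<in> span B" by (intro span_scale span_base)
    then show False using w_notin \<open>k \<noteq> 0\<close> by simp
  qed
  have "v = (\<Sum>b\<in>B. (b \<bullet> (G *v v)) *\<^sub>R b)" for v
  proof -
    have "v \<in> span B" using span by simp
    then obtain u where u: "v = (\<Sum>b\<in>B. u b *\<^sub>R b)"
      unfolding span_finite[OF finB] by auto
    have "b \<bullet> (G *v v) = u b" if "b \<in> B" for b
      using coeff[OF B that] u by simp
    then show ?thesis using u by simp
  qed
  then show ?thesis using that finB by blast
qed

lemma sum4_tuple:
  fixes f :: "'n::finite \<Rightarrow> 'n \<Rightarrow> 'n \<Rightarrow> 'n \<Rightarrow> 'c::comm_monoid_add"
  shows "(\<Sum>i\<in>UNIV. \<Sum>j\<in>UNIV. \<Sum>k\<in>UNIV. \<Sum>m\<in>UNIV. f i j k m) = (\<Sum>(i, j, k, m)\<in>UNIV. f i j k m)"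
  by (simp add: sum.cartesian_product UNIV_Times_UNIV split_def)

lemma sum3_tuple:
  fixes f :: "'n::finite \<Rightarrow> 'n \<Rightarrow> 'n \<Rightarrow> 'c::comm_monoid_add"
  shows "(\<Sum>i\<in>UNIV. \<Sum>j\<in>UNIV. \<Sum>k\<in>UNIV. f i j k) = (\<Sum>(i, j, k)\<in>UNIV. f i j k)"
  by (simp add: sum.cartesian_product UNIV_Times_UNIV split_def)

text \<open>
  The squared norm \<open>Q\<^sup>i\<^sup>k Q\<^sup>j\<^sup>l R\<^sub>i\<^sub>j R\<^sub>k\<^sub>l\<close> of a bilinear form \<open>R\<close> with respect to a metric with inverse matrix \<open>Q\<close>.
\<close>

definition form_norm_sq :: "real^'n^'n \<Rightarrow> real^'n^'n \<Rightarrow> real" where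
  "form_norm_sq Q R = (\<Sum>i\<in>UNIV. \<Sum>j\<in>UNIV. \<Sum>k\<in>UNIV. \<Sum>l\<in>UNIV. Q$i$k * Q$j$l * R$i$j * R$k$l)"

lemma inner_matrix_vector: "v \<bullet> (A *v w) = (\<Sum>i\<in>UNIV. \<Sum>j\<in>UNIV. v$i * A$i$j * w$j)"
  for A :: "real^'n^'n"
  by (simp add: inner_vec_def matrix_vector_mult_def sum_distrib_left mult.assoc)

text \<open>
  A basis \<open>B\<close> that is orthonormal for \<open>G\<close> satisfies \<open>G\<^sup>-\<^sup>1 = \<Sum>\<^sub>b b b\<^sup>T\<close>. Therefore the squared norm of \<open>R\<close> is the sum
  of the squares of the entries \<open>R(b, c)\<close> of \<open>R\<close> in this basis.
\<close>

lemma
  fixes G R :: "real^'n^'n"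
  assumes sym: "\<And>i j. G $ i $ j = G $ j $ i" and pos: "\<And>v. v \<noteq> 0 \<Longrightarrow> v \<bullet> (G *v v) > 0"
  shows form_norm_sq_nonneg: "form_norm_sq (matrix_inv G) R \<ge> 0"
    and form_norm_sq_eq_0D: "form_norm_sq (matrix_inv G) R = 0 \<Longrightarrow> R = 0"
    and posdef_det_nonzero: "det G \<noteq> 0"
proof -
  have sym': "v \<bullet> (G *v w) = w \<bullet> (G *v v)" for v w
    unfolding inner_matrix_vector by (subst sum.swap) (simp add: sym[of _ "_::'n"] mult_ac)
  obtain B where "finite B" and B: "\<And>v. v = (\<Sum>b\<in>B. (b \<bullet> (G *v v)) *\<^sub>R b)"
    using orthonormal_basis_of_form[OF sym' pos] by blast
  have "G *v x = 0 \<Longrightarrow> x = 0" for x using pos[of x] by (cases "x = 0") auto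
  then have "\<forall>x. G *v x = 0 \<longrightarrow> x = 0" by blast
  then have "\<exists>H. H ** G = mat 1" by (simp add: matrix_left_invertible_ker)
  then show det: "det G \<noteq> 0" by (metis invertible_det_nz invertible_left_inverse)
  define P :: "real^'n^'n" where "P = (\<chi> i j. \<Sum>b\<in>B. b$i * b$j)"
  have "P ** G = mat 1"
  proof -
    have "(P ** G) $ i $ j = (\<Sum>b\<in>B. b \<bullet> (G *v axis j 1) * b$i)" for i j
    proof -
      have "(P ** G) $ i $ j = (\<Sum>k\<in>UNIV. \<Sum>b\<in>B. b$i * b$k * G$k$j)"
        by (simp add: matrix_matrix_mult_def P_def sum_distrib_right)
      also have "\<dots> = (\<Sum>b\<in>B. \<Sum>k\<in>UNIV. b$i * b$k * G$k$j)" by (rule sum.swap)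
      also have "\<dots> = (\<Sum>b\<in>B. b \<bullet> (G *v axis j 1) * b$i)"
        by (simp add: inner_matrix_vector axis_def sum_distrib_left sum_distrib_right mult_ac if_distrib cong: if_cong)
      finally show ?thesis .
    qed
    moreover have "(\<Sum>b\<in>B. b \<bullet> (G *v axis j 1) * b$i) = axis j 1 $ i" for i j
      using arg_cong[OF B[of "axis j 1"], of "\<lambda>v. v $ i"] by (simp add: sum_component)
    ultimately show ?thesis by (simp add: vec_eq_iff mat_def axis_def)
  qed
  then have "P ** G ** matrix_inv G = matrix_inv G" by simp
  then have P: "matrix_inv G = P"
    using matrix_inv_inverse(1)[OF det] by (simp add: matrix_mul_assoc[symmetric])
  have N: "form_norm_sq (matrix_inv G) R = (\<Sum>b\<in>B. \<Sum>c\<in>B. (b \<bullet> (R *v c))\<^sup>2)"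
  proof -
    have "P$i$k * P$j$l * R$i$j * R$k$l = (\<Sum>b\<in>B. \<Sum>c\<in>B. (b$i * R$i$j * c$j) * (b$k * R$k$l * c$l))"
      for i j k l
      by (simp add: P_def sum_product) (simp add: sum_distrib_left sum_distrib_right mult_ac)
    then have "form_norm_sq (matrix_inv G) R = (\<Sum>(i, j, k, l)\<in>UNIV. \<Sum>b\<in>B. \<Sum>c\<in>B.
        (b$i * R$i$j * c$j) * (b$k * R$k$l * c$l))"
      unfolding form_norm_sq_def P by (simp only: sum4_tuple)
    also have "\<dots> = (\<Sum>b\<in>B. \<Sum>c\<in>B. \<Sum>(i, j, k, l)\<in>UNIV. (b$i * R$i$j * c$j) * (b$k * R$k$l * c$l))"
      unfolding split_def by (subst sum.swap) (intro sum.cong refl sum.swap)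
    also have "\<dots> = (\<Sum>b\<in>B. \<Sum>c\<in>B. \<Sum>i\<in>UNIV. \<Sum>j\<in>UNIV. \<Sum>k\<in>UNIV. \<Sum>l\<in>UNIV.
        (b$i * R$i$j * c$j) * (b$k * R$k$l * c$l))" by (simp only: sum4_tuple)
    also have "\<dots> = (\<Sum>b\<in>B. \<Sum>c\<in>B. (b \<bullet> (R *v c))\<^sup>2)"
      unfolding inner_matrix_vector power2_eq_square
      by (simp only: sum_distrib_right) (simp only: sum_distrib_left)
    finally show ?thesis .
  qed
  show "form_norm_sq (matrix_inv G) R \<ge> 0" unfolding N by (intro sum_nonneg) auto
  assume "form_norm_sq (matrix_inv G) R = 0"
  then have "(\<Sum>b\<in>B. \<Sum>c\<in>B. (b \<bullet> (R *v c))\<^sup>2) = 0" unfolding N .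
  then have z: "b \<bullet> (R *v c) = 0" if "b \<in> B" "c \<in> B" for b c
    using that \<open>finite B\<close> by (simp add: sum_nonneg_eq_0_iff sum_nonneg)
  have "v \<bullet> (R *v w) = 0" for v w
  proof -
    have 1: "b \<bullet> (R *v w) = 0" if "b \<in> B" for b
      by (subst B[of w]) (simp add: linear_sum[OF matrix_vector_mul_linear] inner_sum_right matrix_vector_mult_scaleR z that)
    show ?thesis
      by (subst B[of v]) (simp add: inner_sum_left 1)
  qed
  then have "R *v w = 0" for w by (metis inner_eq_zero_iff)
  then show "R = 0" by (metis matrix_eq matrix_vector_mult_0)
qed

text \<open>
  The segment from the identity matrix to \<open>G\<close> consists of positive definite matrices, so the determinant
  has no zero on it and keeps the sign that it has at the identity matrix.
\<close>

lemma posdef_det_pos: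
  fixes G :: "real^'n^'n"
  assumes sym: "\<And>i j. G $ i $ j = G $ j $ i" and pos: "\<And>v. v \<noteq> 0 \<Longrightarrow> v \<bullet> (G *v v) > 0"
  shows "det G > 0"
proof (rule ccontr)
  assume "\<not> det G > 0"
  \<comment> \<open>the segment between the identity matrix and \<open>G\<close>\<close>
  define H :: "real \<Rightarrow> real^'n^'n" where "H s = (\<chi> i j. (1 - s) * mat 1 $ i $ j + s * G $ i $ j)" for s
  have ends: "H 0 = mat 1" "H 1 = G" by (simp_all add: H_def vec_eq_iff)
  have "continuous_on {0..1} (\<lambda>s. det (H s))"
    unfolding det_def H_def by (auto intro!: continuous_intros)
  moreover have "det (H 0) \<ge> 0" "det (H 1) \<le> 0"
    using \<open>\<not> det G > 0\<close> unfolding ends by simp_all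
  ultimately obtain s where s: "0 \<le> s" "s \<le> 1" "det (H s) = 0"
    using IVT2'[of "\<lambda>s. det (H s)" 1 0 0] by auto
  have "det (H s) \<noteq> 0"
  proof (rule posdef_det_nonzero)
    show "H s $ i $ j = H s $ j $ i" for i j by (simp add: H_def mat_def sym[of i j])
    fix v :: "real^'n" assume "v \<noteq> 0"
    have "H s = (1 - s) *\<^sub>R mat 1 + s *\<^sub>R G" by (simp add: H_def vec_eq_iff)
    then have "v \<bullet> (H s *v v) = (1 - s) * (v \<bullet> v) + s * (v \<bullet> (G *v v))"
      by (simp add: matrix_vector_mult_add_rdistrib scaleR_matrix_vector_assoc[symmetric] inner_add_right)
    moreover have "(1 - s) * (v \<bullet> v) \<ge> 0" "s * (v \<bullet> (G *v v)) \<ge> 0"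
      using s pos[OF \<open>v \<noteq> 0\<close>] by simp_all
    moreover have "(1 - s) * (v \<bullet> v) > 0 \<or> s * (v \<bullet> (G *v v)) > 0"
      using s pos[OF \<open>v \<noteq> 0\<close>] \<open>v \<noteq> 0\<close> by (cases "s = 1") auto
    ultimately show "v \<bullet> (H s *v v) > 0" by linarith
  qed
  then show False using s by simp
qed

text \<open>
  Jacobi's formula. The product rule produces, for each row \<open>i\<close>, the determinant of \<open>M x\<close> with the row \<open>i\<close>
  replaced by its derivative; Cramer's rule evaluates it.
\<close>

lemma det_derivative:
  fixes M :: "'a::real_normed_vector \<Rightarrow> real^'n^'n"
  assumes diff: "\<And>i j. (\<lambda>y. M y $ i $ j) differentiable at x" and det: "det (M x) \<noteq> 0"
  shows "dir_deriv v (\<lambda>y. det (M y)) x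
    = det (M x) * (\<Sum>i\<in>UNIV. \<Sum>j\<in>UNIV. matrix_inv (M x) $ j $ i * dir_deriv v (\<lambda>y. M y $ i $ j) x)"
proof -
  define D where "D i j = dir_deriv v (\<lambda>y. M y $ i $ j) x" for i j
  let ?P = "{p. p permutes (UNIV :: 'n set)}"
  have "((\<lambda>y. det (M y)) has_derivative (\<lambda>v. \<Sum>p\<in>?P. of_int (sign p) *
      (\<Sum>i\<in>UNIV. dir_deriv v (\<lambda>y. M y $ i $ p i) x * (\<Prod>j\<in>UNIV - {i}. M x $ j $ p j)))) (at x)"
    unfolding det_def
    by (intro has_derivative_sum has_derivative_mult_right has_derivative_prod has_derivative_dir_deriv diff)
  then have "dir_deriv v (\<lambda>y. det (M y)) x = (\<Sum>p\<in>?P. of_int (sign p) *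
      (\<Sum>i\<in>UNIV. D i (p i) * (\<Prod>j\<in>UNIV - {i}. M x $ j $ p j)))"
    unfolding D_def by (rule dir_deriv_eqI)
  also have "\<dots> = (\<Sum>p\<in>?P. \<Sum>i\<in>UNIV. of_int (sign p) *
      (\<Prod>j\<in>UNIV. (\<chi> k. if k = i then (\<chi> l. D i l) else row k (M x)) $ j $ p j))"
  proof (intro sum.cong refl)
    fix p
    have "D i (p i) * (\<Prod>j\<in>UNIV - {i}. M x $ j $ p j)
       = (\<Prod>j\<in>UNIV. (\<chi> k. if k = i then (\<chi> l. D i l) else row k (M x)) $ j $ p j)" for i
      by (subst prod.remove[of UNIV i]) (auto simp: row_def intro!: prod.cong)
    then show "of_int (sign p) * (\<Sum>i\<in>UNIV. D i (p i) * (\<Prod>j\<in>UNIV - {i}. M x $ j $ p j))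
      = (\<Sum>i\<in>UNIV. of_int (sign p) * (\<Prod>j\<in>UNIV. (\<chi> k. if k = i then (\<chi> l. D i l) else row k (M x)) $ j $ p j))"
      by (simp add: sum_distrib_left)
  qed
  also have "\<dots> = (\<Sum>i\<in>UNIV. det (\<chi> k. if k = i then (\<chi> l. D i l) else row k (M x)))"
    unfolding det_def by (rule sum.swap)
  also have "\<dots> = (\<Sum>i\<in>UNIV. (\<Sum>j\<in>UNIV. matrix_inv (M x) $ j $ i * D i j) * det (M x))"
  proof (intro sum.cong refl)
    fix i
    define r :: "real^'n" where "r = (\<chi> l. D i l)"
    define c where "c = r v* matrix_inv (M x)"
    have "c v* M x = r"
      unfolding c_def vector_matrix_mul_assoc by (simp add: matrix_inv_inverse[OF det])
    moreover have "c v* M x = (\<Sum>k\<in>UNIV. c$k *s row k (M x))"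
      by (simp add: vec_eq_iff vector_matrix_mult_def row_def sum_component mult.commute)
    ultimately have "(\<Sum>k\<in>UNIV. c$k *s row k (M x)) = r" by simp
    from cramer_lemma_transpose[of i c "M x", unfolded this]
    have "det (\<chi> k. if k = i then r else row k (M x)) = c $ i * det (M x)" .
    moreover have "c $ i = (\<Sum>j\<in>UNIV. matrix_inv (M x) $ j $ i * D i j)"
      by (simp add: c_def r_def vector_matrix_mult_def mult.commute)
    ultimately show "det (\<chi> k. if k = i then (\<chi> l. D i l) else row k (M x))
      = (\<Sum>j\<in>UNIV. matrix_inv (M x) $ j $ i * D i j) * det (M x)"
      unfolding r_def by simp
  qed
  finally show ?thesis
    unfolding D_def sum_distrib_right[symmetric] by (simp only: mult.commute)
qed

lemma matrix_inv_derivative: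
  fixes M :: "'a::euclidean_space \<Rightarrow> real^'n^'n"
  assumes "open S" and smooth: "\<And>i j. smooth_on S (\<lambda>y. M y $ i $ j)"
    and det: "\<And>y. y \<in> S \<Longrightarrow> det (M y) \<noteq> 0" and "x \<in> S"
  shows "(\<chi> i j. dir_deriv v (\<lambda>y. matrix_inv (M y) $ i $ j) x)
    = - (matrix_inv (M x) ** (\<chi> i j. dir_deriv v (\<lambda>y. M y $ i $ j) x) ** matrix_inv (M x))"
proof -
  note diffI = smooth_on_differentiable[OF _ \<open>open S\<close> \<open>x \<in> S\<close>]
  have smooth_inv: "smooth_on S (\<lambda>y. matrix_inv (M y) $ i $ j)" for i j
    by (rule smooth_on_matrix_inv[OF \<open>open S\<close> smooth det])
  let ?I = "matrix_inv (M x)"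
  let ?DM = "(\<chi> i j. dir_deriv v (\<lambda>y. M y $ i $ j) x) :: real^'n^'n"
  let ?DI = "(\<chi> i j. dir_deriv v (\<lambda>y. matrix_inv (M y) $ i $ j) x) :: real^'n^'n"
  have "(?DI ** M x + ?I ** ?DM) $ i $ j = 0" for i j
  proof -
    have "dir_deriv v (\<lambda>y. \<Sum>k\<in>UNIV. matrix_inv (M y) $ i $ k * M y $ k $ j) x
      = dir_deriv v (\<lambda>y. mat 1 $ i $ j :: real) x"
    proof (rule dir_deriv_cong_open[OF \<open>open S\<close> \<open>x \<in> S\<close>])
      show "(\<Sum>k\<in>UNIV. matrix_inv (M y) $ i $ k * M y $ k $ j) = mat 1 $ i $ j" if "y \<in> S" for y
        using matrix_inv_inverse(2)[OF det[OF that]] unfolding matrix_matrix_mult_def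
        by (metis (no_types, lifting) sum.cong vec_lambda_beta)
    qed
    also have "\<dots> = 0" by simp
    also have "dir_deriv v (\<lambda>y. \<Sum>k\<in>UNIV. matrix_inv (M y) $ i $ k * M y $ k $ j) x
      = (?DI ** M x + ?I ** ?DM) $ i $ j"
      by (subst dir_deriv_sum)
        (auto intro!: differentiable_mult diffI[OF smooth] diffI[OF smooth_inv]
          simp: dir_deriv_mult[OF diffI diffI] smooth smooth_inv matrix_matrix_mult_def sum.distrib)
    finally show ?thesis .
  qed
  then have "?DI ** M x + ?I ** ?DM = 0" by (simp add: vec_eq_iff)
  then have "?DI ** M x = - (?I ** ?DM)" by (simp add: eq_neg_iff_add_eq_0)
  then have "?DI ** M x ** ?I = - (?I ** ?DM) ** ?I" by simp
  moreover have "?DI ** M x ** ?I = ?DI"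
    by (simp add: matrix_mul_assoc[symmetric] matrix_inv_inverse[OF det[OF \<open>x \<in> S\<close>]])
  moreover have "- (?I ** ?DM) ** ?I = - (?I ** ?DM ** ?I)"
    by (simp add: vec_eq_iff matrix_matrix_mult_def sum_negf)
  ultimately show ?thesis by simp
qed

section \<open>Curvature of a time-dependent metric in coordinates\<close>

lemma dir_deriv_space_slice:
  fixes f :: "'a::euclidean_space \<times> 'b::euclidean_space \<Rightarrow> 'c::real_normed_vector"
  assumes "f differentiable at (t, x)"
  shows "(\<lambda>y. f (t, y)) differentiable at x" "dir_deriv v (\<lambda>y. f (t, y)) x = dir_deriv (0, v) f (t, x)"
proof -
  have "((\<lambda>y. (t, y)) has_derivative (\<lambda>h. (0, h))) (at x)"
    by (auto intro!: derivative_eq_intros)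
  from diff_chain_at[OF this has_derivative_dir_deriv[OF assms]]
  have "((\<lambda>y. f (t, y)) has_derivative (\<lambda>h. dir_deriv (0, h) f (t, x))) (at x)"
    by (simp add: o_def)
  then show "(\<lambda>y. f (t, y)) differentiable at x" "dir_deriv v (\<lambda>y. f (t, y)) x = dir_deriv (0, v) f (t, x)"
    using dir_deriv_eqI by (auto simp: differentiable_def)
qed

lemma has_real_derivative_time_slice:
  fixes f :: "real \<times> 'b::euclidean_space \<Rightarrow> real"
  assumes "f differentiable at (t, x)"
  shows "((\<lambda>\<tau>. f (\<tau>, x)) has_real_derivative dir_deriv (1, 0) f (t, x)) (at t)"
proof -
  have "((\<lambda>\<tau>. (\<tau>, x)) has_derivative (\<lambda>h. (h, 0))) (at t)"
    by (auto intro!: derivative_eq_intros)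
  from diff_chain_at[OF this has_derivative_dir_deriv[OF assms]]
  have "((\<lambda>\<tau>. f (\<tau>, x)) has_derivative (\<lambda>h. dir_deriv (h, 0) f (t, x))) (at t)"
    by (simp add: o_def)
  moreover have "(\<lambda>h. dir_deriv (h, 0) f (t, x)) = (*) (dir_deriv (1, 0) f (t, x))"
  proof
    show "dir_deriv (h, 0) f (t, x) = dir_deriv (1, 0) f (t, x) * h" for h
      using linear_cmul[OF dir_deriv_linear[OF assms], of h "(1,0)"] by (simp add: mult.commute)
  qed
  ultimately show ?thesis by (simp add: has_field_derivative_def)
qed

text \<open>
  The algebra behind \<open>g\<^sup>j\<^sup>k \<partial>Ric\<^sub>j\<^sub>k/\<partial>t = div V\<close>, at one point. Here \<open>q\<close> is the inverse metric, \<open>C\<close> are the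
  Christoffel symbols, \<open>T\<close> their time derivatives, and \<open>dT i l j k\<close> and \<open>dq i j k\<close> stand for
  \<open>\<partial>\<^sub>i T\<^sup>l\<^sub>j\<^sub>k\<close> and \<open>\<partial>\<^sub>i g\<^sup>j\<^sup>k\<close>. The left-hand side is the variation of the Ricci tensor, contracted with \<open>q\<close>. The
  right-hand side is \<open>C\<^sup>l\<^sub>l\<^sub>i V\<^sup>i + \<partial>\<^sub>i V\<^sup>i\<close>. After the derivatives of \<open>q\<close> are eliminated by \<open>dq\<close>, both
  sides are sums of monomials in \<open>q\<close>, \<open>C\<close>, \<open>T\<close> and \<open>dT\<close>, which are matched by renaming indices.
\<close>

lemma palatini_index_identity:
  fixes q :: "'n::finite \<Rightarrow> 'n \<Rightarrow> real" and C T :: "'n \<Rightarrow> 'n \<Rightarrow> 'n \<Rightarrow> real" and dT dq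
  assumes q: "\<And>j k. q j k = q k j" and C: "\<And>k i j. C k i j = C k j i" and T: "\<And>k i j. T k i j = T k j i"
    and dq: "\<And>i j k. dq i j k = - (\<Sum>m\<in>UNIV. C j i m * q m k + q j m * C k i m)"
  shows "(\<Sum>j\<in>UNIV. \<Sum>k\<in>UNIV. q j k * (\<Sum>i\<in>UNIV. dT i i j k - dT j i i k
      + (\<Sum>m\<in>UNIV. T i i m * C m j k + C i i m * T m j k - (T i j m * C m i k + C i j m * T m i k))))
    = (\<Sum>i\<in>UNIV. (\<Sum>l\<in>UNIV. C l l i) * ((\<Sum>j\<in>UNIV. \<Sum>k\<in>UNIV. q j k * T i j k) - (\<Sum>j\<in>UNIV. q i j * (\<Sum>k\<in>UNIV. T k k j)))
      + ((\<Sum>j\<in>UNIV. \<Sum>k\<in>UNIV. dq i j k * T i j k + q j k * dT i i j k)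
         - (\<Sum>j\<in>UNIV. dq i i j * (\<Sum>k\<in>UNIV. T k k j) + q i j * (\<Sum>k\<in>UNIV. dT i k k j))))"
    (is "?L = ?R")
proof -
  let ?S3 = "\<lambda>f. \<Sum>(i, j, k)\<in>(UNIV::('n\<times>'n\<times>'n) set). f i j k :: real"
  let ?S4 = "\<lambda>f. \<Sum>(i, j, k, m)\<in>(UNIV::('n\<times>'n\<times>'n\<times>'n) set). f i j k m :: real"
  have L: "?L = ?S3 (\<lambda>j k i. q j k * dT i i j k) - ?S3 (\<lambda>j k i. q j k * dT j i i k)
      + ?S4 (\<lambda>j k i m. q j k * (T i i m * C m j k)) + ?S4 (\<lambda>j k i m. q j k * (C i i m * T m j k))
      - ?S4 (\<lambda>j k i m. q j k * (T i j m * C m i k)) - ?S4 (\<lambda>j k i m. q j k * (C i j m * T m i k))"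
    unfolding sum3_tuple[symmetric] sum4_tuple[symmetric]
    by (simp add: distrib_left right_diff_distrib sum_distrib_left sum.distrib sum_subtractf)
  have R: "?R = ?S4 (\<lambda>i j k l. C l l i * (q j k * T i j k)) - ?S4 (\<lambda>i j k l. C l l i * (q i j * T k k j))
      - ?S4 (\<lambda>i j k m. C j i m * q m k * T i j k) - ?S4 (\<lambda>i j k m. q j m * C k i m * T i j k)
      + ?S3 (\<lambda>i j k. q j k * dT i i j k)
      + ?S4 (\<lambda>i j k m. C i i m * q m j * T k k j) + ?S4 (\<lambda>i j k m. q i m * C j i m * T k k j)
      - ?S3 (\<lambda>i j k. q i j * dT i k k j)"
    unfolding sum3_tuple[symmetric] sum4_tuple[symmetric] dq
    by (simp add: distrib_left distrib_right right_diff_distrib left_diff_distrib sum_distrib_left sum_distrib_right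
        sum.distrib sum_subtractf sum_negf sum_product)
  have 1: "?S3 (\<lambda>j k i. q j k * dT i i j k) = ?S3 (\<lambda>i j k. q j k * dT i i j k)"
    by (rule sum.reindex_bij_witness[of _ "\<lambda>(i,j,k). (j,k,i)" "\<lambda>(j,k,i). (i,j,k)"]) auto
  have 2: "?S3 (\<lambda>j k i. q j k * dT j i i k) = ?S3 (\<lambda>i j k. q i j * dT i k k j)"
    by (rule sum.reindex_bij_witness[of _ "\<lambda>x. x" "\<lambda>x. x"]) auto
  have 3: "?S4 (\<lambda>j k i m. q j k * (T i i m * C m j k)) = ?S4 (\<lambda>i j k m. q i m * C j i m * T k k j)"
    by (rule sum.reindex_bij_witness[of _ "\<lambda>(i,j,k,m). (i,m,k,j)" "\<lambda>(j,k,i,m). (j,m,i,k)"]) auto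
  have 4: "?S4 (\<lambda>j k i m. q j k * (C i i m * T m j k)) = ?S4 (\<lambda>i j k l. C l l i * (q j k * T i j k))"
    by (rule sum.reindex_bij_witness[of _ "\<lambda>(i,j,k,l). (j,k,l,i)" "\<lambda>(j,k,i,m). (m,j,k,i)"]) auto
  have 5: "?S4 (\<lambda>j k i m. q j k * (T i j m * C m i k)) = ?S4 (\<lambda>i j k m. C j i m * q m k * T i j k)"
    by (rule sum.reindex_bij_witness[of _ "\<lambda>(i,j,k,m). (k,m,i,j)" "\<lambda>(j,k,i,m). (i,m,j,k)"])
      (auto simp: q[of _ "_::'n"] T mult_ac)
  have 6: "?S4 (\<lambda>j k i m. q j k * (C i j m * T m i k)) = ?S4 (\<lambda>i j k m. q j m * C k i m * T i j k)"
    by (rule sum.reindex_bij_witness[of _ "\<lambda>(i,j,k,m). (m,j,k,i)" "\<lambda>(j,k,i,m). (m,k,i,j)"])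
      (auto simp: q C T mult_ac)
  have 7: "?S4 (\<lambda>i j k l. C l l i * (q i j * T k k j)) = ?S4 (\<lambda>i j k m. C i i m * q m j * T k k j)"
    by (rule sum.reindex_bij_witness[of _ "\<lambda>(i,j,k,m). (m,j,k,i)" "\<lambda>(i,j,k,l). (l,j,k,i)"]) auto
  show ?thesis unfolding L R using 1 2 3 4 5 6 7 by linarith
qed

abbreviation dt :: "(real \<times> (real^'n) \<Rightarrow> real) \<Rightarrow> real \<times> (real^'n::finite) \<Rightarrow> real" where
  "dt \<equiv> dir_deriv (1, 0)"

abbreviation dx :: "'n \<Rightarrow> (real \<times> (real^'n) \<Rightarrow> real) \<Rightarrow> real \<times> (real^'n::finite) \<Rightarrow> real" where
  "dx i \<equiv> dir_deriv (0, axis i 1)"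

text \<open>
  The components in one chart of a family of Riemannian metrics, smooth in time and space together.
  All quantities below are functions of \<open>z = (t, x)\<close>, so that derivatives in time and in space commute by
  \<open>dir_deriv_commute\<close>.
\<close>

locale metric_family =
  fixes I :: "real set" and U :: "(real^'n::finite) set" and G :: "real \<Rightarrow> real^'n \<Rightarrow> real^'n^'n"
  assumes open_I: "open I" and open_U: "open U"
    and smooth_G: "smooth_on (I \<times> U) (\<lambda>(t, x). G t x)"
    and sym_G: "t \<in> I \<Longrightarrow> x \<in> U \<Longrightarrow> G t x $ i $ j = G t x $ j $ i"
    and pos_G: "t \<in> I \<Longrightarrow> x \<in> U \<Longrightarrow> v \<noteq> 0 \<Longrightarrow> v \<bullet> (G t x *v v) > 0"
begin

text \<open>
  \<open>dens\<close> is the volume density. \<open>Tdot\<close> is the tensor \<open>T\<close> and \<open>Vel\<close> the vector field \<open>V\<close> of the introduction.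
\<close>

definition "met j k z = G (fst z) (snd z) $ j $ k"
definition "minv j k z = matrix_inv (G (fst z) (snd z)) $ j $ k"
definition "Gam k i j z = christoffel (G (fst z)) k i j (snd z)"
definition "Tdot k i j z = dt (Gam k i j) z"
definition "Ric j k z = local_ricci (G (fst z)) (snd z) $ j $ k"
definition "Scal z = local_scalar (G (fst z)) (snd z)"
definition "dens z = sqrt (det (G (fst z) (snd z)))"
definition "Vel i z = (\<Sum>j\<in>UNIV. \<Sum>k\<in>UNIV. minv j k z * Tdot i j k z) - (\<Sum>j\<in>UNIV. minv i j z * (\<Sum>k\<in>UNIV. Tdot k k j z))"

lemma open_IU: "open (I \<times> U)" using open_I open_U by (rule open_Times)

lemma det_nz: "z \<in> I \<times> U \<Longrightarrow> det (G (fst z) (snd z)) \<noteq> 0"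
  by (rule posdef_det_nonzero) (auto intro: sym_G pos_G)

lemma smooth_met: "smooth_on (I \<times> U) (met j k)"
  using smooth_on_vec_nth[OF open_IU smooth_on_vec_nth[OF open_IU smooth_G], of j k]
  unfolding met_def by (simp add: split_def)

lemma smooth_minv: "smooth_on (I \<times> U) (minv j k)"
  unfolding minv_def
  by (rule smooth_on_matrix_inv[OF open_IU smooth_met[unfolded met_def] det_nz])

lemma pderiv_slice:
  assumes "smooth_on (I \<times> U) f" "z \<in> I \<times> U"
  shows "pderiv_at i (\<lambda>y. f (fst z, y)) (snd z) = dx i f z"
  using dir_deriv_space_slice(2)[of f "fst z" "snd z"] smooth_on_differentiable[OF assms(1) open_IU assms(2)]
  by (simp add: pderiv_at_def)

lemma Gam_eq:
  assumes "z \<in> I \<times> U"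
  shows "Gam k i j z = 1/2 * (\<Sum>l\<in>UNIV. minv k l z * (dx i (met j l) z + dx j (met i l) z - dx l (met i j) z))"
  unfolding Gam_def christoffel_def
  by (simp only: pderiv_slice[OF smooth_met assms, symmetric] minv_def) (simp add: met_def)

lemma smooth_Gam: "smooth_on (I \<times> U) (Gam k i j)"
proof -
  have "smooth_on (I \<times> U) (\<lambda>z. 1/2 * (\<Sum>l\<in>UNIV. minv k l z * (dx i (met j l) z + dx j (met i l) z - dx l (met i j) z)))"
    by (intro smooth_on_mult smooth_on_const smooth_on_sum smooth_on_add smooth_on_diff open_IU
        smooth_minv smooth_on_dir_deriv smooth_met)
  then show ?thesis
    by (rule smooth_on_cong[THEN iffD1, rotated]) (simp add: Gam_eq)
qed

lemma smooth_Tdot: "smooth_on (I \<times> U) (Tdot k i j)"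
  unfolding Tdot_def by (intro smooth_on_dir_deriv smooth_Gam open_IU)

lemma Ric_eq:
  assumes "z \<in> I \<times> U"
  shows "Ric j k z = (\<Sum>i\<in>UNIV. dx i (Gam i j k) z - dx j (Gam i i k) z
     + (\<Sum>m\<in>UNIV. Gam i i m z * Gam m j k z - Gam i j m z * Gam m i k z))"
  unfolding Ric_def local_ricci_def riemann_def
  by (simp only: pderiv_slice[OF smooth_Gam assms, symmetric]) (simp add: Gam_def)

lemma smooth_Ric: "smooth_on (I \<times> U) (Ric j k)"
proof -
  have "smooth_on (I \<times> U) (\<lambda>z. (\<Sum>i\<in>UNIV. dx i (Gam i j k) z - dx j (Gam i i k) z
     + (\<Sum>m\<in>UNIV. Gam i i m z * Gam m j k z - Gam i j m z * Gam m i k z)))"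
    by (intro smooth_on_mult smooth_on_const smooth_on_sum smooth_on_add smooth_on_diff open_IU
        smooth_on_dir_deriv smooth_Gam)
  then show ?thesis
    by (rule smooth_on_cong[THEN iffD1, rotated]) (simp add: Ric_eq)
qed

lemma Scal_eq: "Scal = (\<lambda>z. \<Sum>j\<in>UNIV. \<Sum>k\<in>UNIV. minv j k z * Ric j k z)"
  by (simp add: fun_eq_iff Scal_def local_scalar_def Ric_def minv_def)

lemma smooth_Scal: "smooth_on (I \<times> U) Scal"
  unfolding Scal_eq by (intro smooth_on_mult smooth_on_sum open_IU smooth_minv smooth_Ric)

lemma smooth_Vel: "smooth_on (I \<times> U) (Vel i)"
  unfolding Vel_def
  by (intro smooth_on_mult smooth_on_sum smooth_on_diff open_IU smooth_minv smooth_Tdot)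

lemma det_pos:
  assumes "z \<in> I \<times> U"
  shows "det (G (fst z) (snd z)) > 0"
  by (rule posdef_det_pos) (use assms in \<open>auto intro: sym_G pos_G\<close>)

lemma smooth_dens: "smooth_on (I \<times> U) dens"
  unfolding dens_def
  by (rule smooth_on_sqrt[OF open_IU smooth_on_det[OF open_IU smooth_met[unfolded met_def]] det_pos])

lemmas diff_rules = 
   smooth_on_differentiable[OF smooth_met open_IU] smooth_on_differentiable[OF smooth_minv open_IU]
   smooth_on_differentiable[OF smooth_Gam open_IU] smooth_on_differentiable[OF smooth_Tdot open_IU]
   smooth_on_differentiable[OF smooth_Ric open_IU] smooth_on_differentiable[OF smooth_Scal open_IU]
   smooth_on_differentiable[OF smooth_Vel open_IU] smooth_on_differentiable[OF smooth_dens open_IU]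
   smooth_on_differentiable[OF smooth_on_dir_deriv[OF smooth_Gam open_IU] open_IU]

lemma met_sym: "z \<in> I \<times> U \<Longrightarrow> met i j z = met j i z"
  by (auto simp: met_def sym_G)

lemma minv_sym: "z \<in> I \<times> U \<Longrightarrow> minv i j z = minv j i z"
proof -
  assume z: "z \<in> I \<times> U"
  let ?G = "G (fst z) (snd z)"
  have "transpose ?G = ?G" using z by (auto simp: vec_eq_iff transpose_def sym_G)
  have "transpose (matrix_inv ?G) ** ?G = transpose (?G ** matrix_inv ?G)"
    by (simp add: matrix_transpose_mul \<open>transpose ?G = ?G\<close>)
  also have "\<dots> = mat 1" by (simp add: matrix_inv_inverse[OF det_nz[OF z]])
  finally have "transpose (matrix_inv ?G) ** ?G ** matrix_inv ?G = matrix_inv ?G" by simp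
  then have "transpose (matrix_inv ?G) = matrix_inv ?G"
    by (simp add: matrix_mul_assoc[symmetric] matrix_inv_inverse[OF det_nz[OF z]])
  then have "transpose (matrix_inv ?G) $ i $ j = matrix_inv ?G $ i $ j" by simp
  then show ?thesis by (simp add: minv_def transpose_def)
qed

lemma d_met_sym: "z \<in> I \<times> U \<Longrightarrow> dir_deriv v (met i j) z = dir_deriv v (met j i) z"
  by (rule dir_deriv_cong_open[OF open_IU]) (auto intro: met_sym)

lemma Gam_sym: "z \<in> I \<times> U \<Longrightarrow> Gam k i j z = Gam k j i z"
  by (simp add: Gam_eq d_met_sym[where i=i and j=j] add.commute)

lemma Tdot_sym: "z \<in> I \<times> U \<Longrightarrow> Tdot k i j z = Tdot k j i z"
  unfolding Tdot_def by (rule dir_deriv_cong_open[OF open_IU]) (auto intro: Gam_sym)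

lemma met_minv:
  assumes "z \<in> I \<times> U"
  shows "(\<Sum>m\<in>UNIV. met i m z * minv m j z) = (if i = j then 1 else 0)"
    "(\<Sum>m\<in>UNIV. minv i m z * met m j z) = (if i = j then 1 else 0)"
  using matrix_inv_inverse[OF det_nz[OF assms], THEN arg_cong[of _ _ "\<lambda>A. A $ i $ j"]]
  by (simp_all add: matrix_matrix_mult_def met_def minv_def mat_def)

lemma met_Gam:
  assumes "z \<in> I \<times> U"
  shows "(\<Sum>m\<in>UNIV. met a m z * Gam m i b z) = 1/2 * (dx i (met b a) z + dx b (met i a) z - dx a (met i b) z)"
proof -
  define E where "E l = 1/2 * (dx i (met b l) z + dx b (met i l) z - dx l (met i b) z)" for l
  have Gam: "Gam m i b z = (\<Sum>l\<in>UNIV. minv m l z * E l)" for m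
    unfolding Gam_eq[OF assms] E_def sum_distrib_left by (intro sum.cong refl) simp
  have "(\<Sum>m\<in>UNIV. met a m z * Gam m i b z) = (\<Sum>m\<in>UNIV. \<Sum>l\<in>UNIV. met a m z * minv m l z * E l)"
    unfolding Gam by (simp only: sum_distrib_left mult.assoc)
  also have "\<dots> = (\<Sum>l\<in>UNIV. (\<Sum>m\<in>UNIV. met a m z * minv m l z) * E l)"
    unfolding sum_distrib_right by (rule sum.swap)
  also have "\<dots> = (\<Sum>l\<in>UNIV. if a = l then E l else 0)"
    by (intro sum.cong) (auto simp: met_minv[OF assms])
  finally show ?thesis by (simp add: E_def)
qed

text \<open>
  The Levi-Civita connection preserves the metric: \<open>\<nabla>g = 0\<close>. The next lemma is the same statement for the
  inverse metric.
\<close>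

lemma metric_compatible:
  assumes "z \<in> I \<times> U"
  shows "dx i (met a b) z = (\<Sum>m\<in>UNIV. met a m z * Gam m i b z) + (\<Sum>m\<in>UNIV. met b m z * Gam m i a z)"
  using d_met_sym[OF assms, where i=a and j=b] d_met_sym[OF assms, where i=a and j=i] d_met_sym[OF assms, where i=b and j=i]
  by (simp add: met_Gam[OF assms] field_simps)

lemma dx_minv:
  assumes z: "z \<in> I \<times> U"
  shows "dx i (minv j k) z = - (\<Sum>m\<in>UNIV. Gam j i m z * minv m k z + minv j m z * Gam k i m z)"
proof -
  let ?G = "G (fst z) (snd z)"
  define C where "C = ((\<chi> m b. Gam m i b z) :: real^'n^'n)"
  have rdistrib: "(A + B) ** M = A ** M + B ** M" for A B M :: "real^'n^'n"
    by (simp add: vec_eq_iff matrix_matrix_mult_def sum.distrib distrib_right)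
  have tG: "transpose ?G = ?G" using z by (auto simp: vec_eq_iff transpose_def sym_G)
  have "(\<chi> a b. dx i (met a b) z) = ?G ** C + transpose (?G ** C)"
    using metric_compatible[OF z, where i=i]
    by (simp add: vec_eq_iff matrix_matrix_mult_def transpose_def C_def met_def[symmetric])
  moreover have "(\<chi> j k. dx i (minv j k) z) = - (matrix_inv ?G ** (\<chi> a b. dx i (met a b) z) ** matrix_inv ?G)"
    using matrix_inv_derivative[OF open_IU smooth_met[unfolded met_def] det_nz z, of "(0, axis i 1)"]
    unfolding minv_def met_def by simp
  ultimately have "(\<chi> j k. dx i (minv j k) z) = - (matrix_inv ?G ** (?G ** C) ** matrix_inv ?G + matrix_inv ?G ** transpose (?G ** C) ** matrix_inv ?G)"
    by (simp add: matrix_add_ldistrib rdistrib)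
  also have "matrix_inv ?G ** (?G ** C) ** matrix_inv ?G = C ** matrix_inv ?G"
    by (simp add: matrix_mul_assoc matrix_inv_inverse[OF det_nz[OF z]])
  also have "matrix_inv ?G ** transpose (?G ** C) ** matrix_inv ?G = matrix_inv ?G ** transpose C"
    by (simp add: matrix_transpose_mul tG matrix_mul_assoc[symmetric] matrix_inv_inverse[OF det_nz[OF z]])
  finally have "(\<chi> j k. dx i (minv j k) z) $ j $ k = (- (C ** matrix_inv ?G + matrix_inv ?G ** transpose C)) $ j $ k"
    by simp
  then show ?thesis
    by (simp add: matrix_matrix_mult_def C_def minv_def transpose_def sum.distrib)
qed

text \<open>
  \<open>\<Gamma>\<^sup>k\<^sub>k\<^sub>i\<close> is the logarithmic derivative of the volume density. This makes \<open>dens\<^sup>-\<^sup>1 \<partial>\<^sub>i (dens V\<^sup>i)\<close> the divergence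
  of \<open>V\<close>.
\<close>

lemma dx_dens:
  assumes z: "z \<in> I \<times> U"
  shows "dx i dens z = dens z * (\<Sum>k\<in>UNIV. Gam k k i z)"
proof -
  let ?d = "\<lambda>z. det (G (fst z) (snd z))"
  have det: "dx i ?d z = ?d z * (\<Sum>a\<in>UNIV. \<Sum>b\<in>UNIV. minv b a z * dx i (met a b) z)"
    using det_derivative[of "\<lambda>z. G (fst z) (snd z)" z "(0, axis i 1)", OF diff_rules(1)[OF z, unfolded met_def] det_nz[OF z]]
    by (simp add: minv_def met_def[abs_def])
  have "(dens has_derivative (\<lambda>h. dir_deriv h ?d z * inverse (2 * dens z))) (at z)"
    unfolding dens_def
    using has_derivative_real_sqrt[OF det_pos[OF z] has_derivative_dir_deriv[OF smooth_on_differentiable[OF smooth_on_det[OF open_IU smooth_met[unfolded met_def]] open_IU z]]]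
    by (simp add: field_simps)
  then have "dx i dens z = dx i ?d z * inverse (2 * dens z)" by (rule dir_deriv_eqI)
  also have "\<dots> = dens z * (1/2 * (\<Sum>a\<in>UNIV. \<Sum>b\<in>UNIV. minv b a z * dx i (met a b) z))"
  proof -
    have "dens z * dens z = ?d z" "dens z \<noteq> 0" using det_pos[OF z] by (simp_all add: dens_def)
    then show ?thesis unfolding det by (simp add: field_simps)
  qed
  also have "1/2 * (\<Sum>a\<in>UNIV. \<Sum>b\<in>UNIV. minv b a z * dx i (met a b) z) = (\<Sum>k\<in>UNIV. Gam k k i z)"
  proof -
    have "(\<Sum>k\<in>UNIV. \<Sum>l\<in>UNIV. minv k l z * dx k (met i l) z) = (\<Sum>k\<in>UNIV. \<Sum>l\<in>UNIV. minv k l z * dx l (met k i) z)"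
      by (subst sum.swap) (intro sum.cong refl arg_cong2[of _ _ _ _ "(*)"] minv_sym[OF z] d_met_sym[OF z])
    then show ?thesis
      using d_met_sym[OF z] minv_sym[OF z]
      by (simp add: Gam_eq[OF z] sum_divide_distrib[symmetric] distrib_left right_diff_distrib sum.distrib sum_subtractf)
  qed
  finally show ?thesis .
qed

lemma dt_Ric:
  assumes z: "z \<in> I \<times> U"
  shows "dt (Ric j k) z = (\<Sum>i\<in>UNIV. dx i (Tdot i j k) z - dx j (Tdot i i k) z
     + (\<Sum>m\<in>UNIV. Tdot i i m z * Gam m j k z + Gam i i m z * Tdot m j k z
         - (Tdot i j m z * Gam m i k z + Gam i j m z * Tdot m i k z)))"
proof -
  have comm: "dt (dx i (Gam a b c)) z = dx i (Tdot a b c) z" for i a b c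
    unfolding Tdot_def
    by (rule dir_deriv_commute[OF open_IU smooth_on_imp_Ck[OF smooth_Gam] z])
  have "dt (Ric j k) z = dt (\<lambda>z. \<Sum>i\<in>UNIV. dx i (Gam i j k) z - dx j (Gam i i k) z
     + (\<Sum>m\<in>UNIV. Gam i i m z * Gam m j k z - Gam i j m z * Gam m i k z)) z"
    by (rule dir_deriv_cong_open[OF open_IU z]) (rule Ric_eq)
  also have "\<dots> = (\<Sum>i\<in>UNIV. dt (dx i (Gam i j k)) z - dt (dx j (Gam i i k)) z
     + (\<Sum>m\<in>UNIV. (dt (Gam i i m) z * Gam m j k z + Gam i i m z * dt (Gam m j k) z)
         - (dt (Gam i j m) z * Gam m i k z + Gam i j m z * dt (Gam m i k) z)))"
    using z by (simp add: dir_deriv_sum dir_deriv_add dir_deriv_diff dir_deriv_mult diff_rules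
        differentiable_sum differentiable_add differentiable_diff differentiable_mult)
  finally show ?thesis by (simp only: comm Tdot_def[symmetric])
qed

text \<open>
  Palatini's formula, contracted with the metric.
\<close>

lemma divergence_Vel:
  assumes z: "z \<in> I \<times> U"
  shows "(\<Sum>i\<in>UNIV. dx i (\<lambda>z. dens z * Vel i z) z) = dens z * (\<Sum>j\<in>UNIV. \<Sum>k\<in>UNIV. minv j k z * dt (Ric j k) z)"
proof -
  have V: "dx i (Vel i) z = (\<Sum>j\<in>UNIV. \<Sum>k\<in>UNIV. dx i (minv j k) z * Tdot i j k z + minv j k z * dx i (Tdot i j k) z)
         - (\<Sum>j\<in>UNIV. dx i (minv i j) z * (\<Sum>k\<in>UNIV. Tdot k k j z) + minv i j z * (\<Sum>k\<in>UNIV. dx i (Tdot k k j) z))" for i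
    using z unfolding Vel_def
    by (simp add: dir_deriv_sum dir_deriv_add dir_deriv_diff dir_deriv_mult diff_rules
        differentiable_sum differentiable_add differentiable_diff differentiable_mult)
  have "dx i (\<lambda>z. dens z * Vel i z) z = dens z * ((\<Sum>l\<in>UNIV. Gam l l i z) * Vel i z + dx i (Vel i) z)" for i
    using z by (simp add: dir_deriv_mult diff_rules dx_dens[OF z] algebra_simps)
  then show ?thesis
    unfolding V dt_Ric[OF z]
    by (subst palatini_index_identity[where dq = "\<lambda>i j k. dx i (minv j k) z" and dT = "\<lambda>i l j k. dx i (Tdot l j k) z"])
      (use minv_sym[OF z] Gam_sym[OF z] Tdot_sym[OF z] dx_minv[OF z] in \<open>auto simp: sum_distrib_left Vel_def\<close>)
qed

lemma dt_minv:
  assumes z: "z \<in> I \<times> U" and flow: "\<And>j k. dt (met j k) z = -2 * Ric j k z"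
  shows "dt (minv j k) z = 2 * (\<Sum>a\<in>UNIV. \<Sum>b\<in>UNIV. minv j a z * Ric a b z * minv b k z)"
proof -
  let ?G = "G (fst z) (snd z)"
  have "(\<chi> j k. dt (minv j k) z) = - (matrix_inv ?G ** (\<chi> a b. dt (met a b) z) ** matrix_inv ?G)"
    using matrix_inv_derivative[OF open_IU smooth_met[unfolded met_def] det_nz z, of "(1, 0)"]
    unfolding minv_def met_def by simp
  then have "(\<chi> j k. dt (minv j k) z) $ j $ k = (- (matrix_inv ?G ** (\<chi> a b. dt (met a b) z) ** matrix_inv ?G)) $ j $ k"
    by simp
  also have "\<dots> = 2 * (\<Sum>b\<in>UNIV. \<Sum>a\<in>UNIV. minv j a z * Ric a b z * minv b k z)"
    by (simp add: flow matrix_matrix_mult_def minv_def sum_distrib_left sum_distrib_right sum_negf mult_ac)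
  finally show ?thesis by (subst sum.swap) simp
qed

text \<open>
  The flow equation enters through \<open>dt_minv\<close>: the derivative of the inverse metric is \<open>2 Ric\<^sup>j\<^sup>k\<close>, and its
  contraction with \<open>Ric\<^sub>j\<^sub>k\<close> is the term \<open>2 |Ric|\<^sup>2\<close>.
\<close>

lemma scalar_evolution:
  assumes z: "z \<in> I \<times> U" and flow: "\<And>j k. dt (met j k) z = -2 * Ric j k z"
  shows "dens z * dt Scal z = 2 * dens z * form_norm_sq (matrix_inv (G (fst z) (snd z))) (local_ricci (G (fst z)) (snd z))
     + (\<Sum>i\<in>UNIV. dx i (\<lambda>z. dens z * Vel i z) z)"
proof -
  have "dt Scal z = (\<Sum>j\<in>UNIV. \<Sum>k\<in>UNIV. dt (minv j k) z * Ric j k z + minv j k z * dt (Ric j k) z)"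
    using z unfolding Scal_eq
    by (simp add: dir_deriv_sum dir_deriv_mult diff_rules differentiable_sum differentiable_mult)
  moreover have "(\<Sum>j\<in>UNIV. \<Sum>k\<in>UNIV. dt (minv j k) z * Ric j k z)
      = 2 * form_norm_sq (matrix_inv (G (fst z) (snd z))) (local_ricci (G (fst z)) (snd z))"
    unfolding dt_minv[OF z flow] form_norm_sq_def minv_def[symmetric] Ric_def[symmetric]
    by (simp add: sum_distrib_left sum_distrib_right minv_sym[OF z] mult_ac)
  ultimately show ?thesis
    by (simp add: divergence_Vel[OF z] sum.distrib algebra_simps)
qed

end

section \<open>Behaviour under changes of coordinates\<close>

lemma dir_deriv_compose_vec:
  fixes f :: "real^'n \<Rightarrow> real" and \<phi> :: "'a::real_normed_vector \<Rightarrow> real^'n"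
  assumes f: "f differentiable at (\<phi> x)" and \<phi>: "\<phi> differentiable at x"
  shows "(\<lambda>y. f (\<phi> y)) differentiable at x"
    "dir_deriv v (\<lambda>y. f (\<phi> y)) x = (\<Sum>e\<in>UNIV. dir_deriv v (\<lambda>y. \<phi> y $ e) x * dir_deriv (axis e 1) f (\<phi> x))"
proof -
  have D: "((\<lambda>y. f (\<phi> y)) has_derivative (\<lambda>v. dir_deriv (dir_deriv v \<phi> x) f (\<phi> x))) (at x)"
    using diff_chain_at[OF has_derivative_dir_deriv[OF \<phi>] has_derivative_dir_deriv[OF f]] by (simp add: o_def)
  then show "(\<lambda>y. f (\<phi> y)) differentiable at x" by (auto simp: differentiable_def)
  have comp: "dir_deriv v (\<lambda>y. \<phi> y $ e) x = dir_deriv v \<phi> x $ e" for e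
    by (rule dir_deriv_eqI[OF bounded_linear.has_derivative[OF bounded_linear_vec_nth has_derivative_dir_deriv[OF \<phi>]]])
  have "dir_deriv v (\<lambda>y. f (\<phi> y)) x = dir_deriv (dir_deriv v \<phi> x) f (\<phi> x)" by (rule dir_deriv_eqI[OF D])
  also have "\<dots> = dir_deriv (\<Sum>e\<in>UNIV. dir_deriv v \<phi> x $ e *\<^sub>R axis e 1) f (\<phi> x)"
    by (simp add: basis_expansion scalar_mult_eq_scaleR[symmetric])
  also have "\<dots> = (\<Sum>e\<in>UNIV. dir_deriv v \<phi> x $ e * dir_deriv (axis e 1) f (\<phi> x))"
    by (simp add: linear_sum[OF dir_deriv_linear[OF f]] linear_cmul[OF dir_deriv_linear[OF f]])
  finally show "dir_deriv v (\<lambda>y. f (\<phi> y)) x = (\<Sum>e\<in>UNIV. dir_deriv v (\<lambda>y. \<phi> y $ e) x * dir_deriv (axis e 1) f (\<phi> x))"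
    by (simp add: comp)
qed

text \<open>
  Written as a trace, the squared norm is visibly invariant under congruence, because a trace does not change
  under conjugation.
\<close>

lemma form_norm_sq_trace:
  assumes "\<And>i j. Q $ i $ j = Q $ j $ i"
  shows "form_norm_sq Q R = trace (Q ** R ** Q ** transpose R)"
proof -
  have "trace (Q ** R ** Q ** transpose R) = (\<Sum>k\<in>UNIV. \<Sum>l\<in>UNIV. \<Sum>j\<in>UNIV. \<Sum>i\<in>UNIV. Q$k$i * R$i$j * Q$j$l * R$k$l)"
    by (simp add: trace_def matrix_matrix_mult_def transpose_def sum_distrib_right)
  also have "\<dots> = (\<Sum>(k,l,j,i)\<in>UNIV. Q$k$i * R$i$j * Q$j$l * R$k$l)" by (rule sum4_tuple)
  also have "\<dots> = (\<Sum>(i,j,k,l)\<in>UNIV. Q$i$k * Q$j$l * R$i$j * R$k$l)"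
    by (rule sum.reindex_bij_witness[of _ "\<lambda>(i,j,k,l). (k,l,j,i)" "\<lambda>(k,l,j,i). (i,j,k,l)"])
      (auto simp: assms[of _ "_::'a"] mult_ac)
  also have "\<dots> = form_norm_sq Q R" unfolding form_norm_sq_def by (rule sum4_tuple[symmetric])
  finally show ?thesis by simp
qed

lemma matrix_inv_congruence:
  fixes M H :: "real^'n^'n"
  assumes M: "det M \<noteq> 0" and H: "det H \<noteq> 0"
  shows "matrix_inv (transpose M ** H ** M) = matrix_inv M ** matrix_inv H ** transpose (matrix_inv M)"
proof -
  let ?G = "transpose M ** H ** M" and ?P = "matrix_inv M ** matrix_inv H ** transpose (matrix_inv M)"
  have G: "det ?G \<noteq> 0" using M H by (simp add: det_mul)
  have "?G ** ?P = transpose M ** (H ** ((M ** matrix_inv M) ** matrix_inv H)) ** transpose (matrix_inv M)"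
    by (simp add: matrix_mul_assoc)
  also have "\<dots> = transpose M ** transpose (matrix_inv M)"
    by (simp add: matrix_inv_inverse[OF M] matrix_inv_inverse[OF H])
  also have "\<dots> = transpose (matrix_inv M ** M)" by (simp add: matrix_transpose_mul)
  also have "\<dots> = mat 1" by (simp add: matrix_inv_inverse[OF M])
  finally have GP: "?G ** ?P = mat 1" .
  have "?P = (matrix_inv ?G ** ?G) ** ?P" by (simp add: matrix_inv_inverse[OF G])
  also have "\<dots> = matrix_inv ?G ** (?G ** ?P)" by (simp only: matrix_mul_assoc)
  finally show ?thesis by (simp add: GP)
qed

lemma transpose_inv_cancel:
  fixes M :: "real^'n^'n"
  assumes "det M \<noteq> 0"
  shows "transpose (matrix_inv M) ** transpose M = mat 1" "transpose M ** transpose (matrix_inv M) = mat 1"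
  by (simp_all add: matrix_transpose_mul[symmetric] matrix_inv_inverse[OF assms])

lemma trace_congruence:
  fixes M H R :: "real^'n^'n"
  assumes M: "det M \<noteq> 0" and H: "det H \<noteq> 0"
  shows "trace (matrix_inv (transpose M ** H ** M) ** (transpose M ** R ** M)) = trace (matrix_inv H ** R)"
proof -
  have "matrix_inv (transpose M ** H ** M) ** (transpose M ** R ** M)
     = matrix_inv M ** (matrix_inv H ** (transpose (matrix_inv M) ** transpose M) ** R ** M)"
    unfolding matrix_inv_congruence[OF M H] by (simp add: matrix_mul_assoc)
  also have "trace \<dots> = trace (matrix_inv H ** R ** M ** matrix_inv M)"
    by (subst trace_mul_sym) (simp add: transpose_inv_cancel[OF M])
  also have "\<dots> = trace (matrix_inv H ** R)"
    by (simp add: matrix_mul_assoc[symmetric] matrix_inv_inverse[OF M])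
  finally show ?thesis .
qed

lemma form_norm_sq_congruence:
  fixes M H R :: "real^'n^'n"
  assumes M: "det M \<noteq> 0" and H: "det H \<noteq> 0" and sym: "\<And>i j. matrix_inv H $ i $ j = matrix_inv H $ j $ i"
  shows "form_norm_sq (matrix_inv (transpose M ** H ** M)) (transpose M ** R ** M) = form_norm_sq (matrix_inv H) R"
proof -
  let ?Q = "matrix_inv H" and ?N = "matrix_inv M"
  let ?QG = "matrix_inv (transpose M ** H ** M)" and ?RG = "transpose M ** R ** M"
  have tQ: "transpose ?Q = ?Q" using sym by (simp add: vec_eq_iff transpose_def)
  have tQG: "transpose ?QG = ?QG" unfolding matrix_inv_congruence[OF M H]
    by (simp add: matrix_transpose_mul tQ matrix_mul_assoc)
  have symG: "?QG $ i $ j = ?QG $ j $ i" for i j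
  proof -
    have "?QG $ i $ j = transpose ?QG $ i $ j" by (simp only: tQG)
    then show ?thesis by (simp only: transpose_def vec_lambda_beta)
  qed
  have 1: "?QG ** ?RG = ?N ** (?Q ** R) ** M"
  proof -
    have "?QG ** ?RG = ?N ** (?Q ** (transpose ?N ** transpose M) ** R) ** M"
      unfolding matrix_inv_congruence[OF M H] by (simp add: matrix_mul_assoc)
    then show ?thesis by (simp add: transpose_inv_cancel[OF M])
  qed
  have 2: "?QG ** transpose ?RG = ?N ** (?Q ** transpose R) ** M"
  proof -
    have "?QG ** transpose ?RG = ?N ** (?Q ** (transpose ?N ** transpose M) ** transpose R) ** M"
      unfolding matrix_inv_congruence[OF M H] by (simp add: matrix_mul_assoc matrix_transpose_mul)
    then show ?thesis by (simp add: transpose_inv_cancel[OF M])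
  qed
  have "?QG ** ?RG ** ?QG ** transpose ?RG = (?QG ** ?RG) ** (?QG ** transpose ?RG)"
    by (simp add: matrix_mul_assoc)
  also have "\<dots> = ?N ** ((?Q ** R) ** (M ** ?N) ** (?Q ** transpose R) ** M)"
    unfolding 1 2 by (simp add: matrix_mul_assoc)
  also have "trace \<dots> = trace ((?Q ** R) ** (M ** ?N) ** (?Q ** transpose R) ** M ** ?N)"
    by (subst trace_mul_sym) simp
  also have "\<dots> = trace (?Q ** R ** ?Q ** transpose R)"
    by (simp add: matrix_mul_assoc[symmetric] matrix_inv_inverse[OF M])
  finally show ?thesis
    by (simp add: form_norm_sq_trace[OF sym] form_norm_sq_trace[OF symG])
qed

text \<open>
  The components of one family of metrics in two charts; \<open>\<phi>\<close> is the change of coordinates, defined on the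
  part \<open>U0\<close> of the first chart where the charts overlap.
\<close>

locale chart_change = G: metric_family I U G + H: metric_family I W H
  for I :: "real set" and U W :: "(real^'n::finite) set" and G H +
  fixes \<phi> :: "real^'n \<Rightarrow> real^'n" and U0 :: "(real^'n) set"
  assumes open_U0: "open U0" and U0_sub: "U0 \<subseteq> U" and smooth_\<phi>: "smooth_on U0 \<phi>"
    and \<phi>_W: "x \<in> U0 \<Longrightarrow> \<phi> x \<in> W"
    and G_pullback: "t \<in> I \<Longrightarrow> x \<in> U0 \<Longrightarrow> G t x =
      transpose (\<chi> a i. dir_deriv (axis i 1) (\<lambda>y. \<phi> y $ a) x) ** H t (\<phi> x) ** (\<chi> a i. dir_deriv (axis i 1) (\<lambda>y. \<phi> y $ a) x)"
begin

definition "jac a i x = dir_deriv (axis i 1) (\<lambda>y. \<phi> y $ a) x"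
definition "Jac x = (\<chi> a i. jac a i x)"
definition "hess a i j x = dir_deriv (axis i 1) (jac a j) x"

lemma smooth_jac: "smooth_on U0 (jac a i)"
  unfolding jac_def by (intro smooth_on_dir_deriv smooth_on_vec_nth open_U0 smooth_\<phi>)

lemma jac_diff: "x \<in> U0 \<Longrightarrow> jac a i differentiable at x"
  by (rule smooth_on_differentiable[OF smooth_jac open_U0])

lemma \<phi>_diff: "x \<in> U0 \<Longrightarrow> \<phi> differentiable at x"
  by (rule smooth_on_differentiable[OF smooth_\<phi> open_U0])

lemma hess_sym: "x \<in> U0 \<Longrightarrow> hess a i j x = hess a j i x"
  unfolding hess_def jac_def
  by (rule dir_deriv_commute[OF open_U0]) (simp add: smooth_on_imp_Ck smooth_on_vec_nth[OF open_U0 smooth_\<phi>])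

lemma in_IU: "t \<in> I \<Longrightarrow> x \<in> U0 \<Longrightarrow> (t, x) \<in> I \<times> U" and in_IW: "t \<in> I \<Longrightarrow> x \<in> U0 \<Longrightarrow> (t, \<phi> x) \<in> I \<times> W"
  using U0_sub \<phi>_W by auto

lemma G_Jac: "t \<in> I \<Longrightarrow> x \<in> U0 \<Longrightarrow> G t x = transpose (Jac x) ** H t (\<phi> x) ** Jac x"
  by (simp add: G_pullback Jac_def jac_def)

lemma det_Jac: 
  assumes "I \<noteq> {}" "x \<in> U0"
  shows "det (Jac x) \<noteq> 0"
proof -
  obtain t where "t \<in> I" using assms by auto
  then show ?thesis using G.det_nz[OF in_IU[OF \<open>t \<in> I\<close> assms(2)]] G_Jac[of t x] assms
    by (auto simp: det_mul)
qed

lemma met_pullback: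
  assumes "t \<in> I" "x \<in> U0"
  shows "G.met i j (t, x) = (\<Sum>a\<in>UNIV. \<Sum>b\<in>UNIV. jac a i x * jac b j x * H.met a b (t, \<phi> x))"
proof -
  have "G.met i j (t, x) = (\<Sum>b\<in>UNIV. \<Sum>a\<in>UNIV. jac a i x * H.met a b (t, \<phi> x) * jac b j x)"
    unfolding G.met_def H.met_def
    by (simp add: G_Jac assms matrix_matrix_mult_def transpose_def Jac_def sum_distrib_right)
  then show ?thesis by (subst sum.swap) (simp add: mult_ac)
qed

lemma dx_met_pullback:
  assumes t: "t \<in> I" and x: "x \<in> U0"
  shows "dx i (G.met j l) (t, x) =
      (\<Sum>a\<in>UNIV. \<Sum>b\<in>UNIV. hess a i j x * jac b l x * H.met a b (t, \<phi> x))
    + (\<Sum>a\<in>UNIV. \<Sum>b\<in>UNIV. jac a j x * hess b i l x * H.met a b (t, \<phi> x))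
    + (\<Sum>a\<in>UNIV. \<Sum>b\<in>UNIV. \<Sum>e\<in>UNIV. jac a j x * jac b l x * jac e i x * dx e (H.met a b) (t, \<phi> x))"
proof -
  note Hd = H.diff_rules(1)[OF in_IW[OF t x]]
  have Hd': "(\<lambda>y. H.met a b (t, y)) differentiable at (\<phi> x)" for a b
    by (rule dir_deriv_space_slice[OF Hd])
  note Hc = dir_deriv_compose_vec[OF Hd' \<phi>_diff[OF x]]
  have "dx i (G.met j l) (t, x) = dir_deriv (axis i 1) (\<lambda>y. G.met j l (t, y)) x"
    by (rule dir_deriv_space_slice(2)[symmetric, OF G.diff_rules(1)[OF in_IU[OF t x]]])
  also have "\<dots> = dir_deriv (axis i 1) (\<lambda>y. \<Sum>a\<in>UNIV. \<Sum>b\<in>UNIV. jac a j y * jac b l y * H.met a b (t, \<phi> y)) x"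
    by (rule dir_deriv_cong_open[OF open_U0 x]) (rule met_pullback[OF t])
  also have "\<dots> = (\<Sum>a\<in>UNIV. \<Sum>b\<in>UNIV. (hess a i j x * jac b l x + jac a j x * hess b i l x) * H.met a b (t, \<phi> x)
      + jac a j x * jac b l x * (\<Sum>e\<in>UNIV. jac e i x * dx e (H.met a b) (t, \<phi> x)))"
    by (simp add: dir_deriv_sum dir_deriv_mult jac_diff[OF x] Hc differentiable_sum differentiable_mult
        dir_deriv_space_slice(2)[OF Hd] hess_def jac_def[symmetric])
  also have "\<dots> = (\<Sum>a\<in>UNIV. \<Sum>b\<in>UNIV. hess a i j x * jac b l x * H.met a b (t, \<phi> x))
    + (\<Sum>a\<in>UNIV. \<Sum>b\<in>UNIV. jac a j x * hess b i l x * H.met a b (t, \<phi> x))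
    + (\<Sum>a\<in>UNIV. \<Sum>b\<in>UNIV. \<Sum>e\<in>UNIV. jac a j x * jac b l x * jac e i x * dx e (H.met a b) (t, \<phi> x))"
    by (simp add: sum.distrib distrib_right distrib_left sum_distrib_left mult_ac)
  finally show ?thesis .
qed

text \<open>
  Lower the upper index. Both sides then are combinations of first derivatives of the metric by \<open>met_Gam\<close>,
  and the derivatives of the pulled back metric are given by \<open>dx_met_pullback\<close>. In the combination
  \<open>\<partial>\<^sub>i g\<^sub>j\<^sub>l + \<partial>\<^sub>j g\<^sub>i\<^sub>l - \<partial>\<^sub>l g\<^sub>i\<^sub>j\<close> the terms with second derivatives of \<open>\<phi>\<close> cancel except for two equal ones. The index is
  raised again by cancelling the invertible matrices.
\<close>

lemma christoffel_transform:
  assumes t: "t \<in> I" and x: "x \<in> U0"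
  shows "(\<Sum>k\<in>UNIV. jac a k x * G.Gam k i j (t, x))
    = hess a i j x + (\<Sum>e\<in>UNIV. \<Sum>c\<in>UNIV. jac e i x * jac c j x * H.Gam a e c (t, \<phi> x))"
proof -
  let ?z = "(t, x)" and ?w = "(t, \<phi> x)"
  have z: "?z \<in> I \<times> U" and w: "?w \<in> I \<times> W" using in_IU in_IW t x by auto
  define X where "X a = (\<Sum>k\<in>UNIV. jac a k x * G.Gam k i j ?z)" for a
  define Y where "Y a = hess a i j x + (\<Sum>e\<in>UNIV. \<Sum>c\<in>UNIV. jac e i x * jac c j x * H.Gam a e c ?w)" for a
  let ?D = "\<lambda>i j l. \<Sum>a\<in>UNIV. \<Sum>b\<in>UNIV. \<Sum>e\<in>UNIV. jac a j x * jac b l x * jac e i x * dx e (H.met a b) ?w"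
  let ?B = "\<lambda>i j l. \<Sum>a\<in>UNIV. \<Sum>b\<in>UNIV. hess a i j x * jac b l x * H.met a b ?w"
  have lowered: "(\<Sum>b\<in>UNIV. \<Sum>a\<in>UNIV. jac b l x * H.met b a ?w * X a) = (\<Sum>b\<in>UNIV. \<Sum>a\<in>UNIV. jac b l x * H.met b a ?w * Y a)" for l
  proof -
    have "(\<Sum>b\<in>UNIV. \<Sum>a\<in>UNIV. jac b l x * H.met b a ?w * X a)
        = (\<Sum>b\<in>UNIV. \<Sum>a\<in>UNIV. \<Sum>k\<in>UNIV. jac b l x * jac a k x * H.met b a ?w * G.Gam k i j ?z)"
      by (simp add: X_def sum_distrib_left mult_ac)
    also have "\<dots> = (\<Sum>k\<in>UNIV. \<Sum>b\<in>UNIV. \<Sum>a\<in>UNIV. jac b l x * jac a k x * H.met b a ?w * G.Gam k i j ?z)"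
      unfolding sum3_tuple
      by (rule sum.reindex_bij_witness[of _ "\<lambda>(k,b,a). (b,a,k)" "\<lambda>(b,a,k). (k,b,a)"]) auto
    also have "\<dots> = (\<Sum>k\<in>UNIV. G.met l k ?z * G.Gam k i j ?z)"
      by (simp only: met_pullback[OF t x] sum_distrib_right)
    also have "\<dots> = 1/2 * (dx i (G.met j l) ?z + dx j (G.met i l) ?z - dx l (G.met i j) ?z)"
      by (rule G.met_Gam[OF z])
    also have "\<dots> = ?B i j l + 1/2 * (?D i j l + ?D j i l - ?D l i j)"
    proof -
      have Bs: "(\<Sum>a\<in>UNIV. \<Sum>b\<in>UNIV. jac a j x * hess b i l x * H.met a b ?w) = ?B i l j" for i j l
        by (subst sum.swap) (simp add: H.met_sym[OF w, of _ "_::'n"] mult_ac)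
      have Bh: "?B i j l = ?B j i l" for i j l using hess_sym[OF x, of _ i j] by simp
      show ?thesis unfolding dx_met_pullback[OF t x] Bs
        using Bh[of j i l] Bh[of l i j] Bh[of l j i] by (simp add: field_simps)
    qed
    also have "1/2 * (?D i j l + ?D j i l - ?D l i j)
       = (\<Sum>b\<in>UNIV. \<Sum>e\<in>UNIV. \<Sum>c\<in>UNIV. jac b l x * jac e i x * jac c j x *
           (1/2 * (dx e (H.met c b) ?w + dx c (H.met e b) ?w - dx b (H.met e c) ?w)))"
    proof -
      have 1: "?D i j l = (\<Sum>b\<in>UNIV. \<Sum>e\<in>UNIV. \<Sum>c\<in>UNIV. jac b l x * jac e i x * jac c j x * dx e (H.met c b) ?w)"
        unfolding sum3_tuple
        by (rule sum.reindex_bij_witness[of _ "\<lambda>(b,e,c). (c,b,e)" "\<lambda>(a,b,e). (b,e,a)"]) auto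
      have 2: "?D j i l = (\<Sum>b\<in>UNIV. \<Sum>e\<in>UNIV. \<Sum>c\<in>UNIV. jac b l x * jac e i x * jac c j x * dx c (H.met e b) ?w)"
        unfolding sum3_tuple
        by (rule sum.reindex_bij_witness[of _ "\<lambda>(b,e,c). (e,b,c)" "\<lambda>(a,b,e). (b,a,e)"]) auto
      have 3: "?D l i j = (\<Sum>b\<in>UNIV. \<Sum>e\<in>UNIV. \<Sum>c\<in>UNIV. jac b l x * jac e i x * jac c j x * dx b (H.met e c) ?w)"
        unfolding sum3_tuple
        by (rule sum.reindex_bij_witness[of _ "\<lambda>(b,e,c). (e,c,b)" "\<lambda>(a,b,e). (e,a,b)"]) auto
      show ?thesis unfolding 1 2 3
        by (simp add: sum.distrib sum_subtractf distrib_left right_diff_distrib sum_divide_distrib add_divide_distrib diff_divide_distrib)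
    qed
    also have "\<dots> = (\<Sum>b\<in>UNIV. \<Sum>e\<in>UNIV. \<Sum>c\<in>UNIV. \<Sum>a\<in>UNIV. jac b l x * H.met b a ?w * (jac e i x * jac c j x * H.Gam a e c ?w))"
      by (simp only: H.met_Gam[OF w, symmetric] sum_distrib_left) (simp add: mult_ac)
    also have "\<dots> = (\<Sum>b\<in>UNIV. \<Sum>a\<in>UNIV. \<Sum>e\<in>UNIV. \<Sum>c\<in>UNIV. jac b l x * H.met b a ?w * (jac e i x * jac c j x * H.Gam a e c ?w))"
      unfolding sum4_tuple
      by (rule sum.reindex_bij_witness[of _ "\<lambda>(b,a,e,c). (b,e,c,a)" "\<lambda>(b,e,c,a). (b,a,e,c)"]) auto
    also have "?B i j l = (\<Sum>b\<in>UNIV. \<Sum>a\<in>UNIV. jac b l x * H.met b a ?w * hess a i j x)"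
      by (subst sum.swap) (simp add: H.met_sym[OF w, of _ "_::'n"] mult_ac)
    finally show ?thesis
      by (simp add: Y_def distrib_left sum.distrib sum_distrib_left)
  qed
  have "(transpose (Jac x) ** H t (\<phi> x)) *v (\<chi> a. X a) = (transpose (Jac x) ** H t (\<phi> x)) *v (\<chi> a. Y a)"
  proof -
    have "((transpose (Jac x) ** H t (\<phi> x)) *v (\<chi> a. Z a)) $ l = (\<Sum>b\<in>UNIV. \<Sum>a\<in>UNIV. jac b l x * H.met b a ?w * Z a)" for Z l
      by (subst sum.swap)
        (simp add: matrix_vector_mult_def matrix_matrix_mult_def transpose_def Jac_def H.met_def sum_distrib_right)
    then show ?thesis using lowered by (simp add: vec_eq_iff)
  qed
  moreover have "det (transpose (Jac x) ** H t (\<phi> x)) \<noteq> 0"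
    using det_Jac[of x] t x H.det_nz[OF w] by (auto simp: det_mul)
  ultimately have "(\<chi> a. X a) = (\<chi> a. Y a)"
    using matrix_inv_inverse(2) by (metis matrix_vector_mul_assoc matrix_vector_mul_lid)
  then have "X a = Y a" by (simp add: vec_eq_iff)
  then show ?thesis by (simp add: X_def Y_def)
qed

text \<open>
  The second derivatives of \<open>\<phi>\<close> in \<open>christoffel_transform\<close> do not depend on time, so differentiation in time
  removes them.
\<close>

lemma Tdot_transform:
  assumes t: "t \<in> I" and x: "x \<in> U0"
  shows "(\<Sum>k\<in>UNIV. jac a k x * G.Tdot k i j (t, x))
    = (\<Sum>e\<in>UNIV. \<Sum>c\<in>UNIV. jac e i x * jac c j x * H.Tdot a e c (t, \<phi> x))"
proof -
  have z: "(t, x) \<in> I \<times> U" and w: "(t, \<phi> x) \<in> I \<times> W" using in_IU in_IW t x by auto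
  have L: "((\<lambda>\<tau>. \<Sum>k\<in>UNIV. jac a k x * G.Gam k i j (\<tau>, x)) has_real_derivative
      (\<Sum>k\<in>UNIV. jac a k x * G.Tdot k i j (t, x))) (at t)"
    unfolding G.Tdot_def
    by (intro DERIV_sum DERIV_cmult has_real_derivative_time_slice G.diff_rules(3) z)
  have "((\<lambda>\<tau>. hess a i j x + (\<Sum>e\<in>UNIV. \<Sum>c\<in>UNIV. jac e i x * jac c j x * H.Gam a e c (\<tau>, \<phi> x))) has_real_derivative
      0 + (\<Sum>e\<in>UNIV. \<Sum>c\<in>UNIV. jac e i x * jac c j x * H.Tdot a e c (t, \<phi> x))) (at t)"
    unfolding H.Tdot_def
    by (intro DERIV_add DERIV_const DERIV_sum DERIV_cmult has_real_derivative_time_slice H.diff_rules(3) w)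
  then have "((\<lambda>\<tau>. \<Sum>k\<in>UNIV. jac a k x * G.Gam k i j (\<tau>, x)) has_real_derivative
      0 + (\<Sum>e\<in>UNIV. \<Sum>c\<in>UNIV. jac e i x * jac c j x * H.Tdot a e c (t, \<phi> x))) (at t)"
    by (rule has_field_derivative_transform_within_open[OF _ G.open_I t]) (simp add: christoffel_transform x)
  from DERIV_unique[OF L this] show ?thesis by simp
qed

lemma minv_transform:
  assumes t: "t \<in> I" and x: "x \<in> U0"
  shows "(\<Sum>i\<in>UNIV. \<Sum>j\<in>UNIV. jac a i x * jac b j x * G.minv i j (t, x)) = H.minv a b (t, \<phi> x)"
proof -
  have M: "det (Jac x) \<noteq> 0" and w: "(t, \<phi> x) \<in> I \<times> W" using det_Jac in_IW t x by auto
  have H: "det (H t (\<phi> x)) \<noteq> 0" using H.det_nz[OF w] by simp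
  have "Jac x ** matrix_inv (G t x) ** transpose (Jac x)
    = (Jac x ** matrix_inv (Jac x)) ** matrix_inv (H t (\<phi> x)) ** (transpose (matrix_inv (Jac x)) ** transpose (Jac x))"
    unfolding G_Jac[OF t x] matrix_inv_congruence[OF M H] by (simp add: matrix_mul_assoc)
  also have "\<dots> = matrix_inv (H t (\<phi> x))"
    by (simp add: matrix_inv_inverse[OF M] transpose_inv_cancel[OF M])
  finally have "(Jac x ** matrix_inv (G t x) ** transpose (Jac x)) $ a $ b = matrix_inv (H t (\<phi> x)) $ a $ b" by simp
  moreover have "(Jac x ** matrix_inv (G t x) ** transpose (Jac x)) $ a $ b
     = (\<Sum>i\<in>UNIV. \<Sum>j\<in>UNIV. jac a i x * jac b j x * G.minv i j (t, x))"
    by (subst sum.swap) (simp add: matrix_matrix_mult_def transpose_def Jac_def G.minv_def sum_distrib_left sum_distrib_right mult_ac)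
  ultimately show ?thesis by (simp add: H.minv_def)
qed

lemma Tdot_trace_transform:
  assumes t: "t \<in> I" and x: "x \<in> U0"
  shows "(\<Sum>k\<in>UNIV. G.Tdot k k j (t, x)) = (\<Sum>c\<in>UNIV. jac c j x * (\<Sum>a\<in>UNIV. H.Tdot a a c (t, \<phi> x)))"
proof -
  have M: "det (Jac x) \<noteq> 0" using det_Jac t x by auto
  define N where "N k a = matrix_inv (Jac x) $ k $ a" for k a
  have NM: "(\<Sum>a\<in>UNIV. N k a * jac a m x) = (if k = m then 1 else 0)" for k m
    using matrix_inv_inverse(2)[OF M, THEN arg_cong[of _ _ "\<lambda>A. A $ k $ m"]]
    by (simp add: matrix_matrix_mult_def N_def Jac_def mat_def)
  have MN: "(\<Sum>k\<in>UNIV. jac e k x * N k a) = (if e = a then 1 else 0)" for e a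
    using matrix_inv_inverse(1)[OF M, THEN arg_cong[of _ _ "\<lambda>A. A $ e $ a"]]
    by (simp add: matrix_matrix_mult_def N_def Jac_def mat_def)
  have "(\<Sum>k\<in>UNIV. G.Tdot k k j (t, x)) = (\<Sum>k\<in>UNIV. \<Sum>m\<in>UNIV. (if k = m then 1 else 0) * G.Tdot m k j (t, x))"
    by (simp add: if_distrib[of "\<lambda>x. x * _"] cong: if_cong)
  also have "\<dots> = (\<Sum>k\<in>UNIV. \<Sum>m\<in>UNIV. \<Sum>a\<in>UNIV. N k a * (jac a m x * G.Tdot m k j (t, x)))"
    by (simp only: NM[symmetric] sum_distrib_right mult.assoc)
  also have "\<dots> = (\<Sum>k\<in>UNIV. \<Sum>a\<in>UNIV. \<Sum>m\<in>UNIV. N k a * (jac a m x * G.Tdot m k j (t, x)))"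
    by (intro sum.cong refl sum.swap)
  also have "\<dots> = (\<Sum>k\<in>UNIV. \<Sum>a\<in>UNIV. \<Sum>e\<in>UNIV. \<Sum>c\<in>UNIV. N k a * (jac e k x * jac c j x * H.Tdot a e c (t, \<phi> x)))"
    by (simp only: sum_distrib_left[symmetric] Tdot_transform[OF t x])
  also have "\<dots> = (\<Sum>c\<in>UNIV. \<Sum>a\<in>UNIV. \<Sum>e\<in>UNIV. \<Sum>k\<in>UNIV. (jac e k x * N k a) * (jac c j x * H.Tdot a e c (t, \<phi> x)))"
    unfolding sum4_tuple
    by (rule sum.reindex_bij_witness[of _ "\<lambda>(c,a,e,k). (k,a,e,c)" "\<lambda>(k,a,e,c). (c,a,e,k)"]) auto
  also have "\<dots> = (\<Sum>c\<in>UNIV. \<Sum>a\<in>UNIV. \<Sum>e\<in>UNIV. (if e = a then 1 else 0) * (jac c j x * H.Tdot a e c (t, \<phi> x)))"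
    by (simp only: sum_distrib_right[symmetric] MN)
  also have "\<dots> = (\<Sum>c\<in>UNIV. \<Sum>a\<in>UNIV. jac c j x * H.Tdot a a c (t, \<phi> x))"
    by (simp add: if_distrib[of "\<lambda>x. x * _"] cong: if_cong)
  finally show ?thesis by (simp add: sum_distrib_left)
qed

lemma Vel_transform:
  assumes t: "t \<in> I" and x: "x \<in> U0"
  shows "(\<Sum>k\<in>UNIV. jac a k x * G.Vel k (t, x)) = H.Vel a (t, \<phi> x)"
proof -
  let ?z = "(t, x)" and ?w = "(t, \<phi> x)"
  have "(\<Sum>k\<in>UNIV. jac a k x * (\<Sum>i\<in>UNIV. \<Sum>j\<in>UNIV. G.minv i j ?z * G.Tdot k i j ?z))
    = (\<Sum>i\<in>UNIV. \<Sum>j\<in>UNIV. \<Sum>k\<in>UNIV. G.minv i j ?z * (jac a k x * G.Tdot k i j ?z))"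
    unfolding sum_distrib_left sum3_tuple
    by (rule sum.reindex_bij_witness[of _ "\<lambda>(i,j,k). (k,i,j)" "\<lambda>(k,i,j). (i,j,k)"]) auto
  also have "\<dots> = (\<Sum>i\<in>UNIV. \<Sum>j\<in>UNIV. \<Sum>e\<in>UNIV. \<Sum>c\<in>UNIV. G.minv i j ?z * (jac e i x * jac c j x * H.Tdot a e c ?w))"
    by (simp only: sum_distrib_left[symmetric] Tdot_transform[OF t x])
  also have "\<dots> = (\<Sum>e\<in>UNIV. \<Sum>c\<in>UNIV. \<Sum>i\<in>UNIV. \<Sum>j\<in>UNIV. (jac e i x * jac c j x * G.minv i j ?z) * H.Tdot a e c ?w)"
    unfolding sum4_tuple
    by (rule sum.reindex_bij_witness[of _ "\<lambda>(e,c,i,j). (i,j,e,c)" "\<lambda>(i,j,e,c). (e,c,i,j)"]) auto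
  also have "\<dots> = (\<Sum>e\<in>UNIV. \<Sum>c\<in>UNIV. H.minv e c ?w * H.Tdot a e c ?w)"
    by (simp only: sum_distrib_right[symmetric] minv_transform[OF t x])
  finally have 1: "(\<Sum>k\<in>UNIV. jac a k x * (\<Sum>i\<in>UNIV. \<Sum>j\<in>UNIV. G.minv i j ?z * G.Tdot k i j ?z))
     = (\<Sum>e\<in>UNIV. \<Sum>c\<in>UNIV. H.minv e c ?w * H.Tdot a e c ?w)" .
  define tr where "tr c = (\<Sum>a\<in>UNIV. H.Tdot a a c ?w)" for c
  have "(\<Sum>k\<in>UNIV. jac a k x * (\<Sum>j\<in>UNIV. G.minv k j ?z * (\<Sum>i\<in>UNIV. G.Tdot i i j ?z)))
    = (\<Sum>k\<in>UNIV. \<Sum>j\<in>UNIV. \<Sum>c\<in>UNIV. (jac a k x * jac c j x * G.minv k j ?z) * tr c)"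
    by (simp add: Tdot_trace_transform[OF t x] tr_def[symmetric] sum_distrib_left mult_ac)
  also have "\<dots> = (\<Sum>c\<in>UNIV. \<Sum>k\<in>UNIV. \<Sum>j\<in>UNIV. (jac a k x * jac c j x * G.minv k j ?z) * tr c)"
    unfolding sum3_tuple
    by (rule sum.reindex_bij_witness[of _ "\<lambda>(c,k,j). (k,j,c)" "\<lambda>(k,j,c). (c,k,j)"]) auto
  also have "\<dots> = (\<Sum>c\<in>UNIV. H.minv a c ?w * tr c)"
    by (simp only: sum_distrib_right[symmetric] minv_transform[OF t x])
  finally have 2: "(\<Sum>k\<in>UNIV. jac a k x * (\<Sum>j\<in>UNIV. G.minv k j ?z * (\<Sum>i\<in>UNIV. G.Tdot i i j ?z)))
    = (\<Sum>c\<in>UNIV. H.minv a c ?w * tr c)" .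
  show ?thesis
    unfolding G.Vel_def H.Vel_def right_diff_distrib sum_subtractf 1 2 tr_def by simp
qed

lemma dens_transform:
  assumes t: "t \<in> I" and x: "x \<in> U0"
  shows "G.dens (t, x) = \<bar>det (Jac x)\<bar> * H.dens (t, \<phi> x)"
proof -
  have "det (G t x) = (det (Jac x))\<^sup>2 * det (H t (\<phi> x))"
    by (simp add: G_Jac[OF t x] det_mul power2_eq_square)
  then show ?thesis by (simp add: G.dens_def H.dens_def real_sqrt_mult)
qed

text \<open>
  Along a Ricci flow the Ricci tensor is a multiple of the time derivative of the metric and inherits the
  transformation rule of the metric.
\<close>

lemma ricci_transform:
  assumes flowG: "\<And>t x j k. t \<in> I \<Longrightarrow> x \<in> U \<Longrightarrow> dt (G.met j k) (t, x) = -2 * G.Ric j k (t, x)"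
    and flowH: "\<And>t x j k. t \<in> I \<Longrightarrow> x \<in> W \<Longrightarrow> dt (H.met j k) (t, x) = -2 * H.Ric j k (t, x)"
    and t: "t \<in> I" and x: "x \<in> U0"
  shows "local_ricci (G t) x = transpose (Jac x) ** local_ricci (H t) (\<phi> x) ** Jac x"
proof -
  have z: "(t, x) \<in> I \<times> U" and w: "(t, \<phi> x) \<in> I \<times> W" using in_IU in_IW t x by auto
  have "G.Ric i j (t, x) = (\<Sum>a\<in>UNIV. \<Sum>b\<in>UNIV. jac a i x * jac b j x * H.Ric a b (t, \<phi> x))" for i j
  proof -
    have "((\<lambda>\<tau>. \<Sum>a\<in>UNIV. \<Sum>b\<in>UNIV. jac a i x * jac b j x * H.met a b (\<tau>, \<phi> x)) has_real_derivative
       (\<Sum>a\<in>UNIV. \<Sum>b\<in>UNIV. jac a i x * jac b j x * (dt (H.met a b) (t, \<phi> x)))) (at t)"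
      by (intro DERIV_sum DERIV_cmult has_real_derivative_time_slice H.diff_rules(1) w)
    then have "((\<lambda>\<tau>. G.met i j (\<tau>, x)) has_real_derivative
       (\<Sum>a\<in>UNIV. \<Sum>b\<in>UNIV. jac a i x * jac b j x * (dt (H.met a b) (t, \<phi> x)))) (at t)"
      by (rule has_field_derivative_transform_within_open[OF _ G.open_I t]) (simp add: met_pullback x)
    from DERIV_unique[OF this has_real_derivative_time_slice[OF G.diff_rules(1)[OF z]]]
    have "-2 * (\<Sum>a\<in>UNIV. \<Sum>b\<in>UNIV. jac a i x * jac b j x * H.Ric a b (t, \<phi> x)) = -2 * G.Ric i j (t, x)"
      using flowG[OF t] flowH[OF t] z w by (simp add: sum_distrib_left sum_negf mult_ac)
    then show ?thesis by simp
  qed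
  moreover have "(transpose (Jac x) ** local_ricci (H t) (\<phi> x) ** Jac x) $ i $ j
     = (\<Sum>a\<in>UNIV. \<Sum>b\<in>UNIV. jac a i x * jac b j x * H.Ric a b (t, \<phi> x))" for i j
    by (subst sum.swap) (simp add: matrix_matrix_mult_def transpose_def Jac_def H.Ric_def sum_distrib_left sum_distrib_right mult_ac)
  ultimately show ?thesis by (simp add: vec_eq_iff G.Ric_def)
qed

lemma
  assumes flowG: "\<And>t x j k. t \<in> I \<Longrightarrow> x \<in> U \<Longrightarrow> dt (G.met j k) (t, x) = -2 * G.Ric j k (t, x)"
    and flowH: "\<And>t x j k. t \<in> I \<Longrightarrow> x \<in> W \<Longrightarrow> dt (H.met j k) (t, x) = -2 * H.Ric j k (t, x)"
    and t: "t \<in> I" and x: "x \<in> U0"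
  shows Scal_invariant: "local_scalar (G t) x = local_scalar (H t) (\<phi> x)"
    and ricci_norm_invariant: "form_norm_sq (matrix_inv (G t x)) (local_ricci (G t) x)
      = form_norm_sq (matrix_inv (H t (\<phi> x))) (local_ricci (H t) (\<phi> x))"
proof -
  have z: "(t, x) \<in> I \<times> U" and w: "(t, \<phi> x) \<in> I \<times> W" using in_IU in_IW t x by auto
  have M: "det (Jac x) \<noteq> 0" using det_Jac t x by auto
  have H: "det (H t (\<phi> x)) \<noteq> 0" using H.det_nz[OF w] by simp
  have R: "local_ricci (G t) x = transpose (Jac x) ** local_ricci (H t) (\<phi> x) ** Jac x"
    by (rule ricci_transform[OF _ _ t x]) (fact flowG flowH)+
  have sc: "local_scalar K y = trace (matrix_inv (K y) ** transpose (local_ricci K y))" for K :: "real^'n \<Rightarrow> real^'n^'n" and y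
    by (simp add: local_scalar_def trace_def matrix_matrix_mult_def transpose_def)
  show "local_scalar (G t) x = local_scalar (H t) (\<phi> x)"
    using trace_congruence[OF M H, of "transpose (local_ricci (H t) (\<phi> x))"]
    by (simp only: sc R G_Jac[OF t x] matrix_transpose_mul transpose_transpose matrix_mul_assoc)
  have "matrix_inv (H t (\<phi> x)) $ i $ j = matrix_inv (H t (\<phi> x)) $ j $ i" for i j
    using H.minv_sym[OF w] by (simp add: H.minv_def)
  from form_norm_sq_congruence[OF M H this]
  show "form_norm_sq (matrix_inv (G t x)) (local_ricci (G t) x)
      = form_norm_sq (matrix_inv (H t (\<phi> x))) (local_ricci (H t) (\<phi> x))"
    unfolding R G_Jac[OF t x] .
qed

end

section \<open>Divergences of compact support in Euclidean space\<close>

text \<open>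
  The difference quotients \<open>(F (x + h v) - F x) / h\<close> have integral zero because Lebesgue measure is invariant
  under translations. By the mean value theorem they are bounded by a constant and, for \<open>0 < h \<le> 1\<close>, they
  vanish off one compact set; so the limit \<open>h \<rightarrow> 0\<close> may be taken under the integral.
\<close>

lemma integral_dir_deriv_zero:
  fixes F :: "'a::euclidean_space \<Rightarrow> real"
  assumes diff: "\<And>x. F differentiable at x" and cont: "continuous_on UNIV (dir_deriv v F)"
    and K: "compact K" "\<And>x. x \<notin> K \<Longrightarrow> F x = 0"
  shows "integrable lborel (dir_deriv v F)" "integral\<^sup>L lborel (dir_deriv v F) = 0"
proof -
  let ?D = "dir_deriv v F"
  have contF: "continuous_on UNIV F"
    using diff by (simp add: differentiable_imp_continuous_on differentiable_on_def)
  have D0: "?D x = 0" if "x \<notin> K" for x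
  proof -
    have "?D x = dir_deriv v (\<lambda>_. 0 :: real) x"
      by (rule dir_deriv_cong_open[of "- K"]) (use K that compact_imp_closed in auto)
    then show ?thesis by simp
  qed
  have intF: "integrable lborel F" and intD: "integrable lborel ?D"
  proof -
    have "(\<lambda>x. indicator K x *\<^sub>R F x) = F" "(\<lambda>x. indicator K x *\<^sub>R ?D x) = ?D"
      using K(2) D0 by (auto simp: fun_eq_iff indicator_def)
    then show "integrable lborel F" "integrable lborel ?D"
      using borel_integrable_compact[OF K(1) continuous_on_subset[OF contF]]
        borel_integrable_compact[OF K(1) continuous_on_subset[OF cont]] by auto
  qed
  show "integrable lborel ?D" by (rule intD)
  have "compact (?D ` K)" using K(1) cont continuous_on_subset compact_continuous_image by blast
  then obtain C where "C > 0" and C: "\<And>x. x \<in> K \<Longrightarrow> \<bar>?D x\<bar> \<le> C"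
    unfolding compact_eq_bounded_closed bounded_pos by auto
  then have C': "\<bar>?D x\<bar> \<le> C" for x using D0[of x] by (cases "x \<in> K") auto
  \<comment> \<open>Contains every \<open>x\<close> for which the segment from \<open>x\<close> to \<open>x + h v\<close> with \<open>0 < h \<le> 1\<close> meets \<open>K\<close>.\<close>
  define K' where "K' = (\<lambda>(x, s). x - s *\<^sub>R v) ` (K \<times> {0..1})"
  have "compact K'" unfolding K'_def
    by (intro compact_continuous_image compact_Times K(1)) (auto intro!: continuous_intros simp: split_def)
  define h :: "nat \<Rightarrow> real" where "h n = inverse (real (Suc n))" for n
  have h: "h n > 0" "h n \<le> 1" for n by (auto simp: h_def inverse_le_1_iff)
  have bound: "\<bar>(F (x + h n *\<^sub>R v) - F x) / h n\<bar> \<le> C * indicator K' x" for x n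
  proof -
    have "\<exists>z. 0 < z \<and> z < h n \<and> F (x + h n *\<^sub>R v) - F (x + 0 *\<^sub>R v) = (h n - 0) * ?D (x + z *\<^sub>R v)"
      by (rule MVT2[OF h(1)]) (intro has_real_derivative_along_line diff)
    then obtain z where z: "0 < z" "z < h n" "(F (x + h n *\<^sub>R v) - F x) / h n = ?D (x + z *\<^sub>R v)"
      using h(1)[of n] by auto
    show ?thesis
    proof (cases "x + z *\<^sub>R v \<in> K")
      case True
      then have "x \<in> K'"
        unfolding K'_def using z h(2)[of n] by (intro image_eqI[of _ _ "(x + z *\<^sub>R v, z)"]) auto
      then show ?thesis using z(3) C' by simp
    next
      case False
      then have "(F (x + h n *\<^sub>R v) - F x) / h n = 0" unfolding z(3) by (rule D0)
      then show ?thesis using \<open>C > 0\<close> by (simp only:) simp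
    qed
  qed
  have "(\<lambda>n. integral\<^sup>L lborel (\<lambda>x. (F (x + h n *\<^sub>R v) - F x) / h n)) \<longlonglongrightarrow> integral\<^sup>L lborel ?D"
  proof (rule integral_dominated_convergence[where w = "\<lambda>x. C * indicator K' x"])
    show "?D \<in> borel_measurable lborel" using cont by (simp add: borel_measurable_continuous_onI)
    show "(\<lambda>x. (F (x + h n *\<^sub>R v) - F x) / h n) \<in> borel_measurable lborel" for n
    proof -
      have [measurable]: "F \<in> borel_measurable borel" using contF by (simp add: borel_measurable_continuous_onI)
      show ?thesis by measurable
    qed
    have "emeasure lborel K' < \<infinity>" using \<open>compact K'\<close> emeasure_compact_finite by blast
    moreover have "K' \<in> sets lborel" using \<open>compact K'\<close> by (simp add: borel_compact)
    ultimately show "integrable lborel (\<lambda>x. C * indicator K' x)"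
      by (intro integrable_mult_right) (simp add: integrable_indicator_iff)
    show "AE x in lborel. (\<lambda>n. (F (x + h n *\<^sub>R v) - F x) / h n) \<longlonglongrightarrow> ?D x"
    proof (rule AE_I2)
      fix x
      have "((\<lambda>s. F (x + s *\<^sub>R v)) has_real_derivative ?D x) (at 0)"
        using has_real_derivative_along_line[of F x 0 v] diff by simp
      then have "(\<lambda>t. (F (x + t *\<^sub>R v) - F x) / t) \<midarrow>0\<rightarrow> ?D x"
        by (simp add: has_field_derivative_iff)
      moreover have "filterlim h (at 0) sequentially"
        unfolding filterlim_at using h(1) LIMSEQ_inverse_real_of_nat
        by (auto simp: h_def[abs_def] less_imp_neq[symmetric])
      ultimately show "(\<lambda>n. (F (x + h n *\<^sub>R v) - F x) / h n) \<longlonglongrightarrow> ?D x"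
        by (rule filterlim_compose)
    qed
    show "AE x in lborel. norm ((F (x + h n *\<^sub>R v) - F x) / h n) \<le> C * indicator K' x" for n
      using bound by simp
  qed
  moreover have "integral\<^sup>L lborel (\<lambda>x. (F (x + h n *\<^sub>R v) - F x) / h n) = 0" for n
  proof -
    have [measurable]: "F \<in> borel_measurable borel" using contF by (simp add: borel_measurable_continuous_onI)
    have eq: "integral\<^sup>L lborel F = integral\<^sup>L lborel (\<lambda>x. F (h n *\<^sub>R v + x))"
      by (subst lborel_distr_plus[of "h n *\<^sub>R v", symmetric], subst integral_distr) auto
    have "integrable lborel (\<lambda>x. F (h n *\<^sub>R v + x))"
      using intF by (subst (asm) lborel_distr_plus[of "h n *\<^sub>R v", symmetric], subst (asm) integrable_distr_eq) auto
    with eq intF show ?thesis by (simp add: add.commute)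
  qed
  ultimately have "(\<lambda>n. 0) \<longlonglongrightarrow> integral\<^sup>L lborel ?D" by (simp only:)
  then show "integral\<^sup>L lborel ?D = 0" by (simp add: LIMSEQ_const_iff)
qed

lemma integral_dir_deriv_compact_support:
  fixes F :: "'a::euclidean_space \<Rightarrow> real"
  assumes "open U" and F: "Ck_on 1 U F" and K: "compact K" "K \<subseteq> U" "\<And>x. x \<in> U - K \<Longrightarrow> F x = 0"
  shows "integrable lborel (\<lambda>x. indicator U x * dir_deriv v F x)"
    "(\<integral>x. indicator U x * dir_deriv v F x \<partial>lborel) = 0"
proof -
  define E where "E x = (if x \<in> U then F x else 0)" for x
  have "Ck_on 1 (U \<union> - K) E"
  proof (rule Ck_on_Un_open[OF \<open>open U\<close>])
    show "open (- K)" using K(1) by (simp add: compact_imp_closed open_Compl)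
    show "Ck_on 1 U E" using F by (rule Ck_on_cong[THEN iffD1, rotated]) (simp add: E_def)
    show "Ck_on 1 (- K) E"
      by (rule Ck_on_cong[THEN iffD1, OF _ Ck_on_const[OF \<open>open (- K)\<close>]]) (use K in \<open>auto simp: E_def\<close>)
  qed
  moreover have "U \<union> - K = UNIV" using K by auto
  ultimately have "Ck_on (Suc 0) UNIV E" by simp
  then have E: "E differentiable at x" "continuous_on UNIV (dir_deriv v E)" for x
    by (simp_all add: Ck_on_Suc_open)
  have E0: "E x = 0" if "x \<notin> K" for x using that K by (auto simp: E_def)
  have "dir_deriv v E x = indicator U x * dir_deriv v F x" for x
  proof (cases "x \<in> U")
    case True
    then have "dir_deriv v E x = dir_deriv v F x"
      by (intro dir_deriv_cong_open[OF \<open>open U\<close>]) (auto simp: E_def)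
    with True show ?thesis by simp
  next
    case False
    have "dir_deriv v E x = dir_deriv v (\<lambda>_. 0 :: real) x"
      by (rule dir_deriv_cong_open[of "- K"]) (use False K E0 compact_imp_closed[OF K(1)] in auto)
    with False show ?thesis by simp
  qed
  then have "dir_deriv v E = (\<lambda>x. indicator U x * dir_deriv v F x)" by (simp add: fun_eq_iff)
  with integral_dir_deriv_zero[OF E K(1) E0]
  show "integrable lborel (\<lambda>x. indicator U x * dir_deriv v F x)"
    "(\<integral>x. indicator U x * dir_deriv v F x \<partial>lborel) = 0" by simp_all
qed

section \<open>Change of variables for Lebesgue integrals\<close>

text \<open>
  The change of variables formula \<open>has_absolute_integral_change_of_variables\<close> is stated for vectors with a
  well-ordered index type. This type is a well-ordered copy of an arbitrary finite type \<open>'n\<close>; the formula is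
  transported along a bijection between the two.
\<close>

typedef (overloaded) ('n::finite) ord_index = "{..<CARD('n)}"
  by (rule exI[of _ 0]) simp

instantiation ord_index :: (finite) linorder
begin
definition "x \<le> y \<longleftrightarrow> Rep_ord_index x \<le> Rep_ord_index y"
definition "x < y \<longleftrightarrow> Rep_ord_index x < Rep_ord_index y"
instance
  by standard (auto simp: less_eq_ord_index_def less_ord_index_def Rep_ord_index_inject)
end

instance ord_index :: (finite) finite
proof
  have "(UNIV :: 'a ord_index set) = Abs_ord_index ` {..<CARD('a)}"
    by (metis type_definition.Abs_image type_definition_ord_index)
  then show "finite (UNIV :: 'a ord_index set)" by (metis finite_imageI finite_lessThan)
qed

instance ord_index :: (finite) wellorder
proof
  fix P :: "'a ord_index \<Rightarrow> bool" and a
  assume step: "\<And>x. (\<And>y. y < x \<Longrightarrow> P y) \<Longrightarrow> P x"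
  show "P a"
  proof (induction a rule: measure_induct_rule[of Rep_ord_index])
    case (less x)
    then show ?case using step by (simp add: less_ord_index_def)
  qed
qed

lemma card_ord_index: "CARD(('n::finite) ord_index) = CARD('n)"
  using type_definition.card[OF type_definition_ord_index] by simp

lemma ord_index_bij: obtains \<sigma> :: "('n::finite) ord_index \<Rightarrow> 'n" where "bij \<sigma>"
  using finite_same_card_bij[of "UNIV :: 'n ord_index set" "UNIV :: 'n set"] card_ord_index by auto

lemma det_reindex:
  fixes M :: "real^'n^'n" and \<sigma> :: "'m::finite \<Rightarrow> 'n"
  assumes "bij \<sigma>"
  shows "det (\<chi> i j. M $ \<sigma> i $ \<sigma> j :: real^'m^'m) = det M"
proof -
  have inj: "inj_on \<sigma> UNIV" and im: "\<sigma> ` UNIV = UNIV" using assms by (auto simp: bij_def)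
  let ?c = "map_permutation UNIV \<sigma>"
  have permutes_iff: "p permutes UNIV \<longleftrightarrow> bij p" for p :: "'c \<Rightarrow> 'c"
    using permutes_bij[of p UNIV] bij_imp_permutes[of p UNIV] by auto
  have c: "?c p = \<sigma> \<circ> p \<circ> inv \<sigma>" for p
    by (simp add: map_permutation_def im fun_eq_iff restrict_id_def)
  have "det M = (\<Sum>q | q permutes UNIV. of_int (sign q) * (\<Prod>i\<in>UNIV. M $ i $ q i))"
    by (simp add: det_def)
  also have "\<dots> = (\<Sum>p | p permutes UNIV. of_int (sign (?c p)) * (\<Prod>i\<in>UNIV. M $ i $ ?c p i))"
  proof (rule sum.reindex_bij_betw[symmetric])
    show "bij_betw ?c {p. p permutes UNIV} {q. q permutes UNIV}"
    proof (rule bij_betwI[where g = "\<lambda>q. inv \<sigma> \<circ> q \<circ> \<sigma>"])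
      show "?c \<in> {p. p permutes UNIV} \<rightarrow> {q. q permutes UNIV}"
        using assms by (auto simp: c permutes_iff intro!: bij_comp bij_imp_bij_inv)
      show "(\<lambda>q. inv \<sigma> \<circ> q \<circ> \<sigma>) \<in> {q. q permutes UNIV} \<rightarrow> {p. p permutes UNIV}"
        using assms by (auto simp: permutes_iff intro!: bij_comp bij_imp_bij_inv)
    qed (use assms in \<open>auto simp: c fun_eq_iff bij_is_inj bij_is_surj surj_f_inv_f\<close>)
  qed
  also have "\<dots> = (\<Sum>p | p permutes UNIV. of_int (sign p) * (\<Prod>i\<in>UNIV. M $ \<sigma> i $ \<sigma> (p i)))"
  proof (intro sum.cong refl arg_cong2[of _ _ _ _ "(*)"])
    fix p :: "'m \<Rightarrow> 'm" assume "p \<in> {p. p permutes UNIV}"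
    then show "of_int (sign (?c p)) = of_int (sign p)" using sign_map_permutation[OF inj] by simp
    have "(\<Prod>i\<in>UNIV. M $ \<sigma> i $ ?c p (\<sigma> i)) = (\<Prod>i\<in>UNIV. M $ i $ ?c p i)"
      by (rule prod.reindex_bij_betw[OF assms])
    then show "(\<Prod>i\<in>UNIV. M $ i $ ?c p i) = (\<Prod>i\<in>UNIV. M $ \<sigma> i $ \<sigma> (p i))"
      using inj by (simp add: c)
  qed
  finally show ?thesis by (simp add: det_def)
qed

text \<open>
  Nonnegative measurable functions that are not integrable have integral \<open>\<infinity>\<close>, so the formula for absolutely
  integrable functions extends to arbitrary nonnegative ones, with equality in \<open>[0, \<infinity>]\<close>.
\<close>

lemma nn_integral_eq_of_integrable_iff:
  assumes meas: "f \<in> borel_measurable M" "g \<in> borel_measurable N"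
    and nonneg: "\<And>x. f x \<ge> (0::real)" "\<And>x. g x \<ge> (0::real)"
    and iff: "integrable M f \<longleftrightarrow> integrable N g" and eq: "integrable M f \<Longrightarrow> integral\<^sup>L M f = integral\<^sup>L N g"
  shows "(\<integral>\<^sup>+x. ennreal (f x) \<partial>M) = (\<integral>\<^sup>+x. ennreal (g x) \<partial>N)"
proof (cases "integrable M f")
  case True
  then show ?thesis
    using nn_integral_eq_integral[of M f] nn_integral_eq_integral[of N g] iff eq nonneg by simp
next
  case False
  have "(\<integral>\<^sup>+x. ennreal (f x) \<partial>M) = \<infinity>"
    using False integrableI_nonneg[OF meas(1)] nonneg by (metis AE_I2 infinity_ennreal_def top.not_eq_extremum)
  moreover have "(\<integral>\<^sup>+x. ennreal (g x) \<partial>N) = \<infinity>"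
    using False iff integrableI_nonneg[OF meas(2)] nonneg by (metis AE_I2 infinity_ennreal_def top.not_eq_extremum)
  ultimately show ?thesis by simp
qed

lemma absolutely_integrable_lborel_iff:
  fixes u :: "'a::euclidean_space \<Rightarrow> real"
  assumes "(\<lambda>x. indicator S x * u x) \<in> borel_measurable borel"
  shows "u absolutely_integrable_on S \<longleftrightarrow> integrable lborel (\<lambda>x. indicator S x * u x)"
    "integrable lborel (\<lambda>x. indicator S x * u x) \<Longrightarrow> integral S u = (\<integral>x. indicator S x * u x \<partial>lborel)"
proof -
  have m: "(\<lambda>x. indicator S x * u x) \<in> borel_measurable lborel" using assms by simp
  show 1: "u absolutely_integrable_on S \<longleftrightarrow> integrable lborel (\<lambda>x. indicator S x * u x)"
    by (simp add: set_integrable_def integrable_completion[OF m])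
  assume "integrable lborel (\<lambda>x. indicator S x * u x)"
  with 1 have "u absolutely_integrable_on S" by simp
  then have "integral S u = (LINT x:S|lebesgue. u x)" by (simp add: set_lebesgue_integral_eq_integral(2))
  also have "\<dots> = (\<integral>x. indicator S x * u x \<partial>lborel)"
    by (simp add: set_lebesgue_integral_def integral_completion[OF m])
  finally show "integral S u = (\<integral>x. indicator S x * u x \<partial>lborel)" .
qed

lemma nn_integral_change_of_variables_wellorder:
  fixes g :: "real^'m::{finite,wellorder} \<Rightarrow> real^'m::_" and u v :: "real^'m::_ \<Rightarrow> real"
  assumes S: "S \<in> sets borel"
    and deriv: "\<And>x. x \<in> S \<Longrightarrow> (g has_derivative g' x) (at x within S)" and inj: "inj_on g S"
    and u: "(\<lambda>x. indicator S x * u x) \<in> borel_measurable borel"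
    and v: "(\<lambda>y. indicator (g ` S) y * v y) \<in> borel_measurable borel"
    and uv: "\<And>x. x \<in> S \<Longrightarrow> u x = \<bar>det (matrix (g' x))\<bar> * v (g x)" and v_nonneg: "\<And>y. y \<in> g ` S \<Longrightarrow> v y \<ge> 0"
  shows "(\<integral>\<^sup>+x. ennreal (indicator S x * u x) \<partial>lborel) = (\<integral>\<^sup>+y. ennreal (indicator (g ` S) y * v y) \<partial>lborel)"
proof -
  \<comment> \<open>The formula is stated for vector-valued integrands, hence the detour through \<open>\<real>\<^sup>1\<close>.\<close>
  let ?w = "\<lambda>x. \<bar>det (matrix (g' x))\<bar> *\<^sub>R (vec (v (g x)) :: real^1)"
  have cov: "?w absolutely_integrable_on S \<and> integral S ?w = b \<longleftrightarrow>
      (\<lambda>y. vec (v y) :: real^1) absolutely_integrable_on (g ` S) \<and> integral (g ` S) (\<lambda>y. vec (v y)) = b" for b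
    using has_absolute_integral_change_of_variables[OF _ deriv inj, of "\<lambda>y. vec (v y) :: real^1" b] S by simp
  have vec: "(\<lambda>y. vec (f y) :: real^1) absolutely_integrable_on A \<longleftrightarrow> f absolutely_integrable_on A"
    "f absolutely_integrable_on A \<Longrightarrow> integral A (\<lambda>y. vec (f y) :: real^1) = vec (integral A f)"
    for f :: "real^'m::_ \<Rightarrow> real" and A
  proof -
    show 1: "(\<lambda>y. vec (f y) :: real^1) absolutely_integrable_on A \<longleftrightarrow> f absolutely_integrable_on A"
      by (subst absolutely_integrable_componentwise_iff) (simp add: Basis_vec_def inner_axis)
    assume "f absolutely_integrable_on A"
    then have "(\<lambda>y. vec (f y) :: real^1) integrable_on A"
      using 1 set_lebesgue_integral_eq_integral(1) by blast
    then have "integral A (\<lambda>y. vec (f y) :: real^1) $ i = integral A f" for i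
      using integral_component_eq_cart[of "\<lambda>y. vec (f y) :: real^1" A i] by simp
    then show "integral A (\<lambda>y. vec (f y) :: real^1) = vec (integral A f)" by (simp add: vec_eq_iff)
  qed
  have w: "?w absolutely_integrable_on S \<longleftrightarrow> (\<lambda>x. vec (u x) :: real^1) absolutely_integrable_on S"
    "integral S ?w = integral S (\<lambda>x. vec (u x))"
  proof -
    have eq: "?w x = vec (u x)" if "x \<in> S" for x using uv[OF that] by (simp add: vec_eq_iff)
    show "?w absolutely_integrable_on S \<longleftrightarrow> (\<lambda>x. vec (u x) :: real^1) absolutely_integrable_on S"
      by (rule set_integrable_cong[OF refl refl]) (rule eq)
    show "integral S ?w = integral S (\<lambda>x. vec (u x))" by (rule integral_cong) (rule eq)
  qed
  show ?thesis
  proof (rule nn_integral_eq_of_integrable_iff)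
    show "integrable lborel (\<lambda>x. indicator S x * u x) \<longleftrightarrow> integrable lborel (\<lambda>y. indicator (g ` S) y * v y)"
      using cov[of "integral S ?w"] cov[of "integral (g ` S) (\<lambda>y. vec (v y))"]
      unfolding w vec absolutely_integrable_lborel_iff(1)[OF u, symmetric] absolutely_integrable_lborel_iff(1)[OF v, symmetric]
      by blast
    assume int: "integrable lborel (\<lambda>x. indicator S x * u x)"
    then have "u absolutely_integrable_on S" using absolutely_integrable_lborel_iff(1)[OF u] by simp
    with cov[of "integral S ?w"] have "v absolutely_integrable_on (g ` S)" "integral S u = integral (g ` S) v"
      unfolding w vec(1) by (auto simp: vec(2) vec_eq_iff)
    then show "(\<integral>x. indicator S x * u x \<partial>lborel) = (\<integral>y. indicator (g ` S) y * v y \<partial>lborel)"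
      using absolutely_integrable_lborel_iff[OF v] absolutely_integrable_lborel_iff(2)[OF u int] by simp
  qed (use u v uv v_nonneg in \<open>auto simp: indicator_def\<close>)
qed

definition reindex_vec :: "('m \<Rightarrow> 'n) \<Rightarrow> real^'n \<Rightarrow> real^'m" where
  "reindex_vec \<sigma> x = (\<chi> j. x $ \<sigma> j)"

lemma linear_reindex_vec: "linear (reindex_vec \<sigma> :: real^'n::finite \<Rightarrow> real^'m::finite)"
  by (auto simp: reindex_vec_def linear_iff vec_eq_iff)

lemma reindex_vec_measurable [measurable]:
  "(reindex_vec \<sigma> :: real^'n::finite \<Rightarrow> real^'m::finite) \<in> borel_measurable borel"
  by (intro borel_measurable_continuous_onI linear_continuous_on linear_conv_bounded_linear[THEN iffD1] linear_reindex_vec)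

text \<open>
  Renaming coordinates permutes the edges of boxes.
\<close>

lemma lborel_distr_reindex_vec:
  fixes \<sigma> :: "'m::finite \<Rightarrow> 'n::finite"
  assumes "bij \<sigma>"
  shows "distr lborel borel (reindex_vec \<sigma> :: real^'n \<Rightarrow> real^'m) = lborel"
proof (rule lborel_eqI[symmetric])
  fix l u :: "real^'m" assume lu: "\<And>b. b \<in> Basis \<Longrightarrow> l \<bullet> b \<le> u \<bullet> b"
  let ?\<tau> = "inv \<sigma>"
  have lu': "l $ j \<le> u $ j" for j using lu[of "axis j 1"] by (simp add: inner_axis axis_in_Basis_iff)
  have eq: "reindex_vec \<sigma> -` box l u = box (reindex_vec ?\<tau> l) (reindex_vec ?\<tau> u)"
    using assms unfolding reindex_vec_def
    by (auto simp: mem_box_cart) (metis bij_inv_eq_iff)+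
  have "emeasure (distr lborel borel (reindex_vec \<sigma> :: real^'n \<Rightarrow> real^'m)) (box l u)
     = emeasure lborel (box (reindex_vec ?\<tau> l :: real^'n) (reindex_vec ?\<tau> u))"
    by (subst emeasure_distr) (auto simp: eq)
  also have "\<dots> = (\<Prod>b\<in>Basis. (reindex_vec ?\<tau> u - reindex_vec ?\<tau> l :: real^'n) \<bullet> b)"
    using lu' by (intro emeasure_lborel_box) (auto simp: Basis_vec_def inner_axis reindex_vec_def)
  also have "(\<Prod>b\<in>Basis. (reindex_vec ?\<tau> u - reindex_vec ?\<tau> l :: real^'n) \<bullet> b) = (\<Prod>i\<in>UNIV. u $ ?\<tau> i - l $ ?\<tau> i)"
    by (subst prod.reindex_bij_betw[symmetric, of "\<lambda>i. axis i 1" UNIV])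
      (auto simp: inner_axis reindex_vec_def Basis_vec_def bij_betw_def inj_on_def axis_eq_axis)
  also have "\<dots> = (\<Prod>j\<in>UNIV. u $ j - l $ j)"
    by (rule prod.reindex_bij_betw) (simp add: assms bij_imp_bij_inv)
  also have "\<dots> = (\<Prod>b\<in>Basis. (u - l) \<bullet> b)"
    by (subst prod.reindex_bij_betw[symmetric, of "\<lambda>i. axis i 1" UNIV Basis])
      (auto simp: inner_axis Basis_vec_def bij_betw_def inj_on_def axis_eq_axis)
  finally show "emeasure (distr lborel borel (reindex_vec \<sigma> :: real^'n \<Rightarrow> real^'m)) (box l u) = (\<Prod>b\<in>Basis. (u - l) \<bullet> b)" .
qed simp

lemma nn_integral_change_of_variables:
  fixes g :: "real^'n::finite \<Rightarrow> real^'n" and u v :: "real^'n \<Rightarrow> real"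
  assumes S: "S \<in> sets borel"
    and deriv: "\<And>x. x \<in> S \<Longrightarrow> (g has_derivative g' x) (at x within S)" and inj: "inj_on g S"
    and u: "(\<lambda>x. indicator S x * u x) \<in> borel_measurable borel"
    and v: "(\<lambda>y. indicator (g ` S) y * v y) \<in> borel_measurable borel"
    and uv: "\<And>x. x \<in> S \<Longrightarrow> u x = \<bar>det (matrix (g' x))\<bar> * v (g x)" and v_nonneg: "\<And>y. y \<in> g ` S \<Longrightarrow> v y \<ge> 0"
  shows "(\<integral>\<^sup>+x. ennreal (indicator S x * u x) \<partial>lborel) = (\<integral>\<^sup>+y. ennreal (indicator (g ` S) y * v y) \<partial>lborel)"
proof -
  obtain \<sigma> :: "'n ord_index \<Rightarrow> 'n" where \<sigma>: "bij \<sigma>" using ord_index_bij .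
  define P where "P = (reindex_vec \<sigma> :: real^'n \<Rightarrow> real^('n ord_index))"
  define Q where "Q = (reindex_vec (inv \<sigma>) :: real^('n ord_index) \<Rightarrow> real^'n)"
  have PQ [simp]: "P (Q y) = y" and QP [simp]: "Q (P x) = x" for x y
    using \<sigma> by (auto simp: P_def Q_def reindex_vec_def vec_eq_iff bij_is_inj bij_is_surj surj_f_inv_f)
  have linP: "linear P" and linQ: "linear Q" by (simp_all add: P_def Q_def linear_reindex_vec)
  have [measurable]: "P \<in> borel_measurable borel" "Q \<in> borel_measurable borel" by (simp_all add: P_def Q_def)
  have dQ: "distr lborel borel Q = lborel"
    unfolding Q_def by (rule lborel_distr_reindex_vec) (simp add: \<sigma> bij_imp_bij_inv)
  have PS: "P ` A = Q -` A" for A by (auto simp: image_iff) (metis PQ)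
  have ind: "indicator (P ` A) y = (indicator A (Q y) :: real)" for A y
    by (simp add: PS indicator_def)
  let ?g = "P \<circ> g \<circ> Q"
  have img: "?g ` (P ` S) = P ` (g ` S)" by (auto simp: image_comp)
  have "(\<integral>\<^sup>+y. ennreal (indicator (P ` S) y * u (Q y)) \<partial>lborel) = (\<integral>\<^sup>+y. ennreal (indicator (?g ` (P ` S)) y * v (Q y)) \<partial>lborel)"
  proof (rule nn_integral_change_of_variables_wellorder[where g' = "\<lambda>y. P \<circ> g' (Q y) \<circ> Q"])
    show "P ` S \<in> sets borel" unfolding PS using measurable_sets_borel[OF \<open>Q \<in> borel_measurable borel\<close> S] by simp
    show "(?g has_derivative P \<circ> g' (Q y) \<circ> Q) (at y within P ` S)" if "y \<in> P ` S" for y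
    proof -
      have "(Q has_derivative Q) (at y within P ` S)" "\<And>z X. (P has_derivative P) (at z within X)"
        by (simp_all add: linear_imp_has_derivative linP linQ)
      moreover have "Q ` (P ` S) = S" by (force simp: image_iff)
      moreover have "(g has_derivative g' (Q y)) (at (Q y) within S)" using that by (intro deriv) auto
      ultimately show ?thesis
        by (metis diff_chain_within)
    qed
    show "inj_on ?g (P ` S)" using inj by (auto simp: inj_on_def) (metis QP)
    show "(\<lambda>y. indicator (P ` S) y * u (Q y)) \<in> borel_measurable borel"
      unfolding ind using measurable_compose[OF \<open>Q \<in> borel_measurable borel\<close> u] by simp
    show "(\<lambda>y. indicator (?g ` (P ` S)) y * v (Q y)) \<in> borel_measurable borel"
      unfolding img ind using measurable_compose[OF \<open>Q \<in> borel_measurable borel\<close> v] by simp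
    show "u (Q y) = \<bar>det (matrix (P \<circ> g' (Q y) \<circ> Q))\<bar> * v (Q (?g y))" if "y \<in> P ` S" for y
    proof -
      have "Q (axis j 1) = axis (\<sigma> j) 1" for j
        using \<sigma> by (auto simp: Q_def reindex_vec_def axis_def vec_eq_iff bij_is_inj bij_is_surj surj_f_inv_f)
      then have "matrix (P \<circ> g' (Q y) \<circ> Q) = (\<chi> i j. matrix (g' (Q y)) $ \<sigma> i $ \<sigma> j)"
        by (simp add: matrix_def P_def reindex_vec_def)
      then show ?thesis using uv[of "Q y"] that det_reindex[OF \<sigma>] by auto
    qed
    show "v (Q y) \<ge> 0" if "y \<in> ?g ` (P ` S)" for y using that v_nonneg by auto
  qed
  then have "(\<integral>\<^sup>+y. ennreal (indicator S (Q y) * u (Q y)) \<partial>lborel) = (\<integral>\<^sup>+y. ennreal (indicator (g ` S) (Q y) * v (Q y)) \<partial>lborel)"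
    unfolding img ind .
  then have "(\<integral>\<^sup>+x. ennreal (indicator S x * u x) \<partial>distr lborel borel Q) = (\<integral>\<^sup>+y. ennreal (indicator (g ` S) y * v y) \<partial>distr lborel borel Q)"
    using u v by (subst (1 2) nn_integral_distr) auto
  then show ?thesis unfolding dQ .
qed

section \<open>The volume measure of a closed manifold\<close>

lemma smooth_atlas_chart:
  assumes "smooth_atlas A" "c \<in> A"
  shows "open (chart_dom c)" "open (chart_img c)" "continuous_on (chart_dom c) (coords c)"
    "continuous_on (chart_img c) (chart_inv c)"
    "p \<in> chart_dom c \<Longrightarrow> chart_inv c (coords c p) = p"
    "x \<in> chart_img c \<Longrightarrow> coords c (chart_inv c x) = x"
    "x \<in> chart_img c \<Longrightarrow> chart_inv c x \<in> chart_dom c"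
    "inj_on (coords c) (chart_dom c)"
proof -
  have h: "open (chart_dom c)" "open (chart_img c)" "homeomorphism (chart_dom c) (chart_img c) (coords c) (chart_inv c)"
    using assms by (auto simp: smooth_atlas_def is_chart_def)
  show "open (chart_dom c)" "open (chart_img c)" by fact+
  show "continuous_on (chart_dom c) (coords c)" "continuous_on (chart_img c) (chart_inv c)"
    using h(3) by (auto simp: homeomorphism_def)
  show 1: "chart_inv c (coords c p) = p" if "p \<in> chart_dom c" for p
    using h(3) that by (auto simp: homeomorphism_def)
  show "coords c (chart_inv c x) = x" if "x \<in> chart_img c"
    using h(3) that by (auto simp: homeomorphism_def)
  show "chart_inv c x \<in> chart_dom c" if "x \<in> chart_img c"
    using 1 that by auto
  show "inj_on (coords c) (chart_dom c)" using 1 by (metis inj_onI)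
qed

lemma smooth_atlas_cover: "smooth_atlas A \<Longrightarrow> \<exists>c\<in>A. p \<in> chart_dom c"
  by (auto simp: smooth_atlas_def)

lemma coords_image_iff:
  assumes "smooth_atlas A" "c \<in> A"
  shows "x \<in> coords c ` (chart_dom c \<inter> B) \<longleftrightarrow> x \<in> chart_img c \<and> chart_inv c x \<in> B"
proof
  assume "x \<in> chart_img c \<and> chart_inv c x \<in> B"
  then show "x \<in> coords c ` (chart_dom c \<inter> B)"
    using smooth_atlas_chart(6,7)[OF assms, of x] by (intro image_eqI[of _ _ "chart_inv c x"]) auto
qed (use smooth_atlas_chart(5)[OF assms] in auto)

lemma open_coords_image:
  assumes "smooth_atlas A" "c \<in> A" "open B"
  shows "open (coords c ` (chart_dom c \<inter> B))"
proof -
  note ch = smooth_atlas_chart[OF assms(1,2)]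
  have "coords c ` (chart_dom c \<inter> B) = chart_img c \<inter> chart_inv c -` B"
    by (rule set_eqI) (simp only: Int_iff vimage_eq coords_image_iff[OF assms(1,2)])
  then show ?thesis
    using continuous_open_preimage[OF ch(4) ch(2) assms(3)] by simp
qed

lemma transition_smooth:
  assumes "smooth_atlas A" "c \<in> A" "d \<in> A"
  shows "smooth_on (coords c ` (chart_dom c \<inter> chart_dom d)) (coords d \<circ> chart_inv c)"
    "open (coords c ` (chart_dom c \<inter> chart_dom d))"
    "p \<in> chart_dom c \<inter> chart_dom d \<Longrightarrow> (coords d \<circ> chart_inv c) differentiable at (coords c p)"
    "p \<in> chart_dom c \<inter> chart_dom d \<Longrightarrow>
      ((coords d \<circ> chart_inv c) has_derivative transition_deriv c d p) (at (coords c p))"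
proof -
  show 1: "smooth_on (coords c ` (chart_dom c \<inter> chart_dom d)) (coords d \<circ> chart_inv c)"
    using assms by (auto simp: smooth_atlas_def)
  show 2: "open (coords c ` (chart_dom c \<inter> chart_dom d))"
    by (rule open_coords_image[OF assms(1,2)]) (rule smooth_atlas_chart(1)[OF assms(1,3)])
  show 3: "p \<in> chart_dom c \<inter> chart_dom d \<Longrightarrow> (coords d \<circ> chart_inv c) differentiable at (coords c p)"
    using smooth_on_differentiable[OF 1 2] by blast
  show "p \<in> chart_dom c \<inter> chart_dom d \<Longrightarrow>
      ((coords d \<circ> chart_inv c) has_derivative transition_deriv c d p) (at (coords c p))"
    using 3 by (simp add: transition_deriv_def frechet_derivative_works[symmetric])
qed

lemma continuous_on_charts:
  fixes f :: "'m::{t2_space, second_countable_topology} \<Rightarrow> 'b::topological_space" and A :: "('m, 'n::finite) chart set"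
  assumes "smooth_atlas A" and f: "\<And>c. c \<in> A \<Longrightarrow> continuous_on (chart_img c) (\<lambda>x. f (chart_inv c x))"
  shows "continuous_on UNIV f"
proof -
  have "continuous_on (chart_dom c) f" if "c \<in> A" for c
  proof -
    note ch = smooth_atlas_chart[OF assms(1) that]
    have "continuous_on (chart_dom c) (\<lambda>p. f (chart_inv c (coords c p)))"
      by (rule continuous_on_compose2[OF f[OF that] ch(3)]) auto
    then show ?thesis using ch(5) by (simp cong: continuous_on_cong)
  qed
  then have "continuous_on (\<Union>c\<in>A. chart_dom c) f"
    using smooth_atlas_chart(1)[OF assms(1)] by (intro continuous_on_open_UN) auto
  then show ?thesis using assms(1) by (simp add: smooth_atlas_def)
qed

lemma closed_manifold_finite_cover:
  assumes "closed_manifold A"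
  obtains C where "finite C" "C \<subseteq> A" "(\<Union>c\<in>C. chart_dom c) = UNIV"
proof -
  have A: "smooth_atlas A" and K: "compact (UNIV :: 'a set)" using assms by (auto simp: closed_manifold_def)
  have "\<exists>C\<subseteq>A. finite C \<and> UNIV \<subseteq> (\<Union>c\<in>C. chart_dom c)"
    using compactE_image[OF K, of A chart_dom] smooth_atlas_chart(1)[OF A] A
    by (metis smooth_atlas_def subset_UNIV top.extremum_unique)
  then show ?thesis using that by blast
qed

text \<open>
  A positive density in every chart, with the transformation rule of densities. For \<open>w c = sqrt (det g\<^sub>i\<^sub>j)\<close> the
  measure \<open>vol\<close> constructed here is the Riemannian volume.
\<close>

locale volume_family =
  fixes A :: "('m::{t2_space, second_countable_topology}, 'n::finite) chart set"
    and w :: "('m, 'n) chart \<Rightarrow> real^'n \<Rightarrow> real"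
  assumes closed: "closed_manifold A"
    and w_cont: "c \<in> A \<Longrightarrow> continuous_on (chart_img c) (w c)"
    and w_pos: "c \<in> A \<Longrightarrow> x \<in> chart_img c \<Longrightarrow> w c x > 0"
    and w_trans: "c \<in> A \<Longrightarrow> d \<in> A \<Longrightarrow> p \<in> chart_dom c \<inter> chart_dom d \<Longrightarrow>
      w c (coords c p) = \<bar>det (matrix (transition_deriv c d p))\<bar> * w d (coords d p)"
begin

lemma atlas: "smooth_atlas A" using closed by (simp add: closed_manifold_def)

lemmas chart = smooth_atlas_chart[OF atlas]

text \<open>
  Outside of the chart image \<open>chart_inv c\<close> is not controlled; a constant value there gives a Borel function.
\<close>

definition "inv_ext c x = (if x \<in> chart_img c then chart_inv c x else undefined)"

lemma inv_ext_measurable [measurable]: "c \<in> A \<Longrightarrow> inv_ext c \<in> borel_measurable borel"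
  unfolding inv_ext_def
  by (subst measurable_If_restrict_space_iff)
    (simp_all add: borel_measurable_continuous_on_restrict[OF chart(4)] chart(2) borel_open)

lemma w_measurable [measurable]: "c \<in> A \<Longrightarrow> (\<lambda>x. indicator (chart_img c) x * w c x) \<in> borel_measurable borel"
  using borel_measurable_continuous_on_indicator[OF _ w_cont, of c] chart(2)[of c] by simp

definition "chart_measure c =
  distr (density lborel (\<lambda>x. ennreal (indicator (chart_img c) x * w c x))) borel (inv_ext c)"

lemma sets_chart_measure [simp, measurable_cong]: "sets (chart_measure c) = sets borel"
  by (simp add: chart_measure_def)

lemma coords_image_borel:
  assumes "c \<in> A" "B \<in> sets borel"
  shows "coords c ` (B \<inter> chart_dom c) \<in> sets borel"
proof -
  have "coords c ` (B \<inter> chart_dom c) = inv_ext c -` B \<inter> chart_img c"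
    by (rule set_eqI)
      (simp add: Int_commute[of B] coords_image_iff[OF atlas assms(1)] inv_ext_def conj_commute del: image_iff)
  moreover have "inv_ext c -` B \<in> sets borel"
    using measurable_sets_borel[OF inv_ext_measurable[OF assms(1)] assms(2)] by simp
  ultimately show ?thesis using chart(2)[OF assms(1)] by (simp add: borel_open)
qed

lemma emeasure_chart_measure:
  assumes c: "c \<in> A" and B: "B \<in> sets borel"
  shows "emeasure (chart_measure c) B = (\<integral>\<^sup>+x. ennreal (indicator (coords c ` (B \<inter> chart_dom c)) x * w c x) \<partial>lborel)"
proof -
  note [measurable] = inv_ext_measurable[OF c] w_measurable[OF c] B
  have V: "inv_ext c -` B \<in> sets borel"
    using measurable_sets_borel[OF inv_ext_measurable[OF c] B] by simp
  have "emeasure (chart_measure c) B = (\<integral>\<^sup>+x. ennreal (indicator (chart_img c) x * w c x) * indicator (inv_ext c -` B) x \<partial>lborel)"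
    unfolding chart_measure_def by (subst emeasure_distr, simp, simp) (subst emeasure_density, use V in auto)
  also have "\<dots> = (\<integral>\<^sup>+x. ennreal (indicator (coords c ` (B \<inter> chart_dom c)) x * w c x) \<partial>lborel)"
  proof (intro nn_integral_cong)
    fix x
    have "x \<in> coords c ` (B \<inter> chart_dom c) \<longleftrightarrow> x \<in> chart_img c \<and> inv_ext c x \<in> B"
      using coords_image_iff[OF atlas c, of x B] by (auto simp: inv_ext_def Int_commute)
    then show "ennreal (indicator (chart_img c) x * w c x) * indicator (inv_ext c -` B) x
      = ennreal (indicator (coords c ` (B \<inter> chart_dom c)) x * w c x)"
      by (auto simp: indicator_def)
  qed
  finally show ?thesis .
qed

lemma chart_measure_agree:
  assumes c: "c \<in> A" and d: "d \<in> A" and B: "B \<in> sets borel" "B \<subseteq> chart_dom c \<inter> chart_dom d"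
  shows "emeasure (chart_measure c) B = emeasure (chart_measure d) B"
proof -
  let ?\<phi> = "coords d \<circ> chart_inv c" and ?S = "coords c ` B"
  have Bc: "B \<inter> chart_dom c = B" and Bd: "B \<inter> chart_dom d = B" using B(2) by auto
  have img: "?\<phi> ` ?S = coords d ` B"
    using chart(5)[OF c] B(2) by (force simp: image_iff)
  have S: "?S \<in> sets borel" "coords d ` B \<in> sets borel"
    using coords_image_borel[OF c B(1)] coords_image_borel[OF d B(1)] by (simp_all add: Bc Bd)
  have ind: "(\<lambda>x. indicator (coords e ` B) x * w e x) \<in> borel_measurable borel"
    if "e \<in> A" "coords e ` B \<in> sets borel" "B \<subseteq> chart_dom e" for e
  proof -
    have "(\<lambda>x. indicator (coords e ` B) x * (indicator (chart_img e) x * w e x)) \<in> borel_measurable borel"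
      using that(2) w_measurable[OF that(1)] by simp
    moreover have "indicator (coords e ` B) x * (indicator (chart_img e) x * w e x) = indicator (coords e ` B) x * w e x" for x
      using that(3) by (auto simp: indicator_def)
    ultimately show ?thesis by simp
  qed
  have "(\<integral>\<^sup>+x. ennreal (indicator ?S x * w c x) \<partial>lborel) = (\<integral>\<^sup>+y. ennreal (indicator (?\<phi> ` ?S) y * w d y) \<partial>lborel)"
  proof (rule nn_integral_change_of_variables[where g' = "\<lambda>x. transition_deriv c d (chart_inv c x)"])
    show "?S \<in> sets borel" by fact
    show "(?\<phi> has_derivative transition_deriv c d (chart_inv c x)) (at x within ?S)" if "x \<in> ?S" for x
    proof -
      from that obtain p where p: "p \<in> B" "x = coords c p" by blast
      then have p': "p \<in> chart_dom c \<inter> chart_dom d" and inv: "chart_inv c x = p"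
        using B(2) chart(5)[OF c] by auto
      show ?thesis unfolding inv unfolding p(2)
        by (rule has_derivative_at_withinI) (rule transition_smooth(4)[OF atlas c d p'])
    qed
    show "inj_on ?\<phi> ?S"
    proof (rule inj_onI)
      fix x y assume "x \<in> ?S" "y \<in> ?S" and eq: "?\<phi> x = ?\<phi> y"
      then obtain p q where pq: "p \<in> B" "x = coords c p" "q \<in> B" "y = coords c q" by blast
      then have "chart_inv c (coords c p) = p" "chart_inv c (coords c q) = q"
        using B(2) chart(5)[OF c] by blast+
      then have "coords d p = coords d q" using eq pq by simp
      then have "p = q" using pq B(2) by (intro inj_onD[OF chart(8)[OF d]]) auto
      then show "x = y" using pq by simp
    qed
    show "(\<lambda>x. indicator ?S x * w c x) \<in> borel_measurable borel" using ind[OF c S(1)] B(2) by simp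
    show "(\<lambda>y. indicator (?\<phi> ` ?S) y * w d y) \<in> borel_measurable borel"
      unfolding img using ind[OF d S(2)] B(2) by simp
    show "w c x = \<bar>det (matrix (transition_deriv c d (chart_inv c x)))\<bar> * w d (?\<phi> x)" if "x \<in> ?S" for x
    proof -
      from that obtain p where p: "p \<in> B" "x = coords c p" by blast
      then have p': "p \<in> chart_dom c \<inter> chart_dom d" and inv: "chart_inv c (coords c p) = p"
        using B(2) chart(5)[OF c] by auto
      show ?thesis using w_trans[OF c d p'] unfolding p(2) comp_def inv .
    qed
    show "w d y \<ge> 0" if "y \<in> ?\<phi> ` ?S" for y
      using that w_pos[OF d] B(2) unfolding img by (auto intro!: less_imp_le)
  qed
  then show ?thesis
    unfolding emeasure_chart_measure[OF c B(1)] emeasure_chart_measure[OF d B(1)] Bc Bd img .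
qed

definition is_volume :: "'m measure \<Rightarrow> bool" where
  "is_volume \<mu> \<longleftrightarrow> sets \<mu> = sets borel \<and>
     (\<forall>c\<in>A. \<forall>B\<in>sets borel. B \<subseteq> chart_dom c \<longrightarrow> emeasure \<mu> B = (\<integral>\<^sup>+x\<in>coords c ` B. ennreal (w c x) \<partial>lborel))"

lemma is_volume_iff:
  "is_volume \<mu> \<longleftrightarrow> sets \<mu> = sets borel \<and>
     (\<forall>c\<in>A. \<forall>B\<in>sets borel. B \<subseteq> chart_dom c \<longrightarrow> emeasure \<mu> B = emeasure (chart_measure c) B)"
proof -
  have "(\<integral>\<^sup>+x\<in>coords c ` B. ennreal (w c x) \<partial>lborel) = emeasure (chart_measure c) B"
    if "c \<in> A" "B \<in> sets borel" "B \<subseteq> chart_dom c" for c B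
  proof -
    have "B \<inter> chart_dom c = B" using that by auto
    then show ?thesis
      by (simp add: emeasure_chart_measure[OF that(1,2)]) (intro nn_integral_cong, auto simp: indicator_def)
  qed
  then show ?thesis unfolding is_volume_def by auto
qed

text \<open>
  Borel pieces that each lie in one chart: both the construction of the volume measure and its uniqueness are
  reduced to charts by cutting a Borel set along these pieces.
\<close>

lemma disjoint_cover:
  "\<exists>(m::nat) (c :: nat \<Rightarrow> ('m, 'n) chart) D. (\<forall>k<m. c k \<in> A) \<and> (\<forall>k<m. D k \<subseteq> chart_dom (c k)) \<and>
    (\<forall>k. D k \<in> sets borel) \<and> disjoint_family D \<and> (\<Union>k<m. D k) = UNIV"
proof -
  obtain C where C: "finite C" "C \<subseteq> A" "(\<Union>c\<in>C. chart_dom c) = UNIV"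
    using closed_manifold_finite_cover[OF closed] .
  obtain c m where c: "C = c ` {i::nat. i < m}" using C(1) finite_imp_nat_seg_image_inj_on by blast
  define E where "E k = (if k < m then chart_dom (c k) else {})" for k
  define D where "D = disjointed E"
  show ?thesis
  proof (intro exI conjI allI impI)
    have cA: "c k \<in> A" if "k < m" for k using that C(2) c by auto
    then show "\<And>k. k < m \<Longrightarrow> c k \<in> A" .
    show "D k \<subseteq> chart_dom (c k)" if "k < m" for k
      using disjointed_subset[of E k] that by (auto simp: D_def E_def)
    have "E k \<in> sets borel" for k using chart(1) cA by (auto simp: E_def)
    then show "D k \<in> sets borel" for k unfolding D_def disjointed_def by auto
    show "disjoint_family D" by (simp add: D_def disjoint_family_disjointed)
    have "(\<Union>k. D k) = (\<Union>k. E k)" by (simp add: D_def UN_disjointed_eq)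
    also have "\<dots> = UNIV" using C(3) c by (auto simp: E_def)
    finally have "(\<Union>k. D k) = UNIV" .
    moreover have "D k = {}" if "\<not> k < m" for k
      using disjointed_subset[of E k] that by (auto simp: D_def E_def)
    ultimately have "p \<in> (\<Union>k<m. D k)" for p
      by (metis UNIV_I UN_E UN_I empty_iff lessThan_iff)
    then show "(\<Union>k<m. D k) = UNIV" by blast
  qed
qed

lemma ex_is_volume: "\<exists>\<mu>. is_volume \<mu>"
proof -
  obtain m :: nat and c D where cD: "\<And>k. k < m \<Longrightarrow> c k \<in> A" "\<And>k. k < m \<Longrightarrow> D k \<subseteq> chart_dom (c k)"
    "\<And>k. D k \<in> sets borel" "disjoint_family D" "(\<Union>k<m. D k) = (UNIV :: 'm set)"
    using disjoint_cover by auto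
  define e where "e B = (\<Sum>k<m. emeasure (chart_measure (c k)) (B \<inter> D k))" for B
  define \<mu> where "\<mu> = measure_of UNIV (sets borel) e"
  have sets: "sets \<mu> = sets borel" 
    using sets.sigma_sets_eq[of "borel :: 'm measure"] by (simp add: \<mu>_def)
  have em: "emeasure \<mu> B = e B" if B: "B \<in> sets borel" for B
  proof (rule emeasure_measure_of[OF \<mu>_def])
    show "positive (sets \<mu>) e" by (simp add: positive_def e_def)
    show "countably_additive (sets \<mu>) e"
    proof (rule countably_additiveI)
      fix F :: "nat \<Rightarrow> 'm set" assume F: "range F \<subseteq> sets \<mu>" "disjoint_family F" "\<Union> (range F) \<in> sets \<mu>"
      have "(\<Sum>i. e (F i)) = (\<Sum>k<m. \<Sum>i. emeasure (chart_measure (c k)) (F i \<inter> D k))"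
        unfolding e_def by (intro suminf_sum summableI)
      also have "\<dots> = (\<Sum>k<m. emeasure (chart_measure (c k)) (\<Union>i. F i \<inter> D k))"
        using F cD(3) unfolding sets
        by (intro sum.cong refl suminf_emeasure) (auto simp: disjoint_family_on_def)
      also have "\<dots> = e (\<Union> (range F))" by (simp add: e_def)
      finally show "(\<Sum>i. e (F i)) = e (\<Union> (range F))" .
    qed
  qed (use B sets in \<open>auto simp: sets_borel_eq_count_space\<close>)
  have "emeasure \<mu> B = emeasure (chart_measure d) B" if "d \<in> A" "B \<in> sets borel" "B \<subseteq> chart_dom d" for d B
  proof -
    have "emeasure \<mu> B = (\<Sum>k<m. emeasure (chart_measure d) (B \<inter> D k))"
      unfolding em[OF that(2)] e_def using that cD(1,2,3)
      by (intro sum.cong refl chart_measure_agree) (auto dest!: cD(2))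
    also have "\<dots> = emeasure (chart_measure d) (\<Union>k<m. B \<inter> D k)"
      using that cD(3) by (intro sum_emeasure disjoint_family_on_bisimulation[OF cD(4)[THEN disjoint_family_on_mono[rotated]]]) auto
    also have "(\<Union>k<m. B \<inter> D k) = B" using cD(5) by auto
    finally show ?thesis .
  qed
  then show ?thesis using sets unfolding is_volume_iff by blast
qed

lemma is_volume_unique:
  assumes \<mu>: "is_volume \<mu>" and \<nu>: "is_volume \<nu>"
  shows "\<mu> = \<nu>"
proof (rule measure_eqI)
  show "sets \<mu> = sets \<nu>" using \<mu> \<nu> by (simp add: is_volume_def)
  fix B assume "B \<in> sets \<mu>"
  then have B: "B \<in> sets borel" using \<mu> by (simp add: is_volume_def)
  obtain m :: nat and c D where cD: "\<And>k. k < m \<Longrightarrow> c k \<in> A" "\<And>k. k < m \<Longrightarrow> D k \<subseteq> chart_dom (c k)"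
    "\<And>k. D k \<in> sets borel" "disjoint_family D" "(\<Union>k<m. D k) = (UNIV :: 'm set)"
    using disjoint_cover by auto
  have *: "emeasure \<rho> B = (\<Sum>k<m. emeasure (chart_measure (c k)) (B \<inter> D k))" if \<rho>: "is_volume \<rho>" for \<rho>
  proof -
    have "emeasure \<rho> B = emeasure \<rho> (\<Union>k<m. B \<inter> D k)" using cD(5) by (simp add: Int_UN_distrib[symmetric])
    also have "\<dots> = (\<Sum>k<m. emeasure \<rho> (B \<inter> D k))"
      using \<rho> B cD(3,4) by (intro sum_emeasure[symmetric]) (auto simp: disjoint_family_on_def is_volume_def)
    also have "\<dots> = (\<Sum>k<m. emeasure (chart_measure (c k)) (B \<inter> D k))"
    proof (intro sum.cong refl)
      fix k assume "k \<in> {..<m}"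
      then have "c k \<in> A" "B \<inter> D k \<subseteq> chart_dom (c k)" "B \<inter> D k \<in> sets borel"
        using cD(1,2,3) B by auto
      then show "emeasure \<rho> (B \<inter> D k) = emeasure (chart_measure (c k)) (B \<inter> D k)"
        using \<rho> by (simp add: is_volume_iff)
    qed
    finally show ?thesis .
  qed
  show "emeasure \<mu> B = emeasure \<nu> B" using *[OF \<mu>] *[OF \<nu>] by simp
qed

definition "vol = (THE \<mu>. is_volume \<mu>)"

lemma is_volume_vol: "is_volume vol"
  unfolding vol_def using ex_is_volume is_volume_unique by (metis theI)

lemma sets_vol [simp, measurable_cong]: "sets vol = sets borel"
  using is_volume_vol by (simp add: is_volume_def)

text \<open>
  Restricted to the domain of a chart, the volume is the measure given by the density of that chart; this
  yields the formula for integrals of functions that vanish outside the chart.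
\<close>

lemma density_vol_chart:
  assumes c: "c \<in> A"
  shows "density vol (indicator (chart_dom c)) = chart_measure c"
proof (rule measure_eqI)
  show "sets (density vol (indicator (chart_dom c))) = sets (chart_measure c)" by simp
  fix B assume "B \<in> sets (density vol (indicator (chart_dom c)))"
  then have B: "B \<in> sets borel" by simp
  have dom: "chart_dom c \<in> sets borel" using chart(1)[OF c] by simp
  have "emeasure (density vol (indicator (chart_dom c))) B = (\<integral>\<^sup>+p. indicator (chart_dom c) p * indicator B p \<partial>vol)"
    using B dom by (intro emeasure_density) auto
  also have "\<dots> = (\<integral>\<^sup>+p. indicator (B \<inter> chart_dom c) p \<partial>vol)"
    by (intro nn_integral_cong) (auto simp: indicator_def)
  also have "\<dots> = emeasure vol (B \<inter> chart_dom c)" using B dom by simp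
  also have "\<dots> = emeasure (chart_measure c) (B \<inter> chart_dom c)"
    using is_volume_vol c B dom by (auto simp: is_volume_iff)
  also have "\<dots> = emeasure (chart_measure c) B"
    using B dom by (simp add: emeasure_chart_measure[OF c] Int_assoc)
  finally show "emeasure (density vol (indicator (chart_dom c))) B = emeasure (chart_measure c) B" .
qed

lemma integral_vol_chart:
  fixes f :: "'m \<Rightarrow> real"
  assumes c: "c \<in> A" and f: "f \<in> borel_measurable borel" and supp: "\<And>p. p \<notin> chart_dom c \<Longrightarrow> f p = 0"
  shows "integrable vol f \<longleftrightarrow> integrable lborel (\<lambda>x. indicator (chart_img c) x * (w c x * f (chart_inv c x)))"
    and "integral\<^sup>L vol f = (\<integral>x. indicator (chart_img c) x * (w c x * f (chart_inv c x)) \<partial>lborel)"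
proof -
  note [measurable] = inv_ext_measurable[OF c] w_measurable[OF c] f
  have dom: "chart_dom c \<in> sets borel" using chart(1)[OF c] by simp
  have fe: "(\<lambda>p. indicator (chart_dom c) p * f p) = f" using supp by (auto simp: fun_eq_iff indicator_def)
  have nn: "0 \<le> indicator (chart_img c) x * w c x" for x using w_pos[OF c] by (auto simp: indicator_def less_imp_le)
  have fx: "indicator (chart_img c) x * w c x * f (inv_ext c x) = indicator (chart_img c) x * (w c x * f (chart_inv c x))" for x
    by (simp add: inv_ext_def indicator_def)
  have ie: "density vol (indicator (chart_dom c)) = density vol (\<lambda>p. ennreal (indicator (chart_dom c) p))"
    by (simp add: ennreal_indicator)
  have 1: "integrable vol f \<longleftrightarrow> integrable (chart_measure c) f" "integral\<^sup>L vol f = integral\<^sup>L (chart_measure c) f"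
    unfolding density_vol_chart[OF c, symmetric] ie using dom
    by (simp_all add: integrable_density integral_density fe)
  show "integrable vol f \<longleftrightarrow> integrable lborel (\<lambda>x. indicator (chart_img c) x * (w c x * f (chart_inv c x)))"
    unfolding 1 chart_measure_def
    by (subst integrable_distr_eq, simp, simp) (subst integrable_density, use nn in \<open>auto simp: fx\<close>)
  show "integral\<^sup>L vol f = (\<integral>x. indicator (chart_img c) x * (w c x * f (chart_inv c x)) \<partial>lborel)"
    unfolding 1 chart_measure_def
    by (subst integral_distr, simp, simp) (subst integral_density, use nn in \<open>auto simp: fx\<close>)
qed

end

section \<open>The divergence theorem on a closed manifold\<close>

lemma Ck1_iff:
  assumes "open S"
  shows "Ck_on (Suc 0) S f \<longleftrightarrow> (\<forall>x\<in>S. f differentiable at x) \<and> (\<forall>v. continuous_on S (dir_deriv v f))"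
  using Ck_on_Suc_open[OF assms, of 0 f] by simp

lemma Ck1_compose:
  fixes f :: "real^'n \<Rightarrow> real" and \<phi> :: "'a::euclidean_space \<Rightarrow> real^'n"
  assumes S: "open S" and W: "open W" and f: "Ck_on 1 W f" and \<phi>: "Ck_on 1 S \<phi>" and sub: "\<And>x. x \<in> S \<Longrightarrow> \<phi> x \<in> W"
  shows "Ck_on 1 S (\<lambda>x. f (\<phi> x))"
proof -
  have fd: "f differentiable at (\<phi> x)" and \<phi>d: "\<phi> differentiable at x" if "x \<in> S" for x
    using f \<phi> sub that by (auto simp: Ck1_iff[OF S] Ck1_iff[OF W])
  have "continuous_on S (\<lambda>x. \<Sum>e\<in>UNIV. dir_deriv v (\<lambda>y. \<phi> y $ e) x * dir_deriv (axis e 1) f (\<phi> x))" for v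
  proof (intro continuous_on_sum continuous_on_mult)
    fix e
    show "continuous_on S (dir_deriv v (\<lambda>y. \<phi> y $ e))"
      using Ck_on_bounded_linear[OF S bounded_linear_vec_nth \<phi>, of e] by (simp add: Ck1_iff[OF S])
    show "continuous_on S (\<lambda>x. dir_deriv (axis e 1) f (\<phi> x))"
      by (rule continuous_on_compose2[of W]) (use f \<phi> sub in \<open>auto simp: Ck1_iff[OF W] intro: Ck_on_imp_continuous_on\<close>)
  qed
  then have "continuous_on S (dir_deriv v (\<lambda>x. f (\<phi> x)))" for v
    by (rule continuous_on_cong[THEN iffD1, OF refl, rotated]) (simp add: dir_deriv_compose_vec(2)[OF fd \<phi>d])
  then show ?thesis
    using dir_deriv_compose_vec(1)[OF fd \<phi>d] by (simp add: Ck1_iff[OF S])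
qed

lemma Ck1_space_slice:
  fixes h :: "'a::euclidean_space \<times> 'b::euclidean_space \<Rightarrow> real"
  assumes "open I" "open U" and h: "smooth_on (I \<times> U) h" and t: "t \<in> I"
  shows "Ck_on 1 U (\<lambda>x. h (t, x))"
proof -
  have o: "open (I \<times> U)" using assms(1,2) by (rule open_Times)
  have "h differentiable at (t, x)" if "x \<in> U" for x
    using smooth_on_differentiable[OF h o] t that by auto
  note sl = dir_deriv_space_slice[OF this]
  have cont: "continuous_on (I \<times> U) (dir_deriv (0, v) h)" for v
    by (rule Ck_on_imp_continuous_on[OF smooth_on_imp_Ck[OF smooth_on_dir_deriv[OF h o], of 0]])
  have "continuous_on U (\<lambda>x. dir_deriv (0, v) h (t, x))" for v
    by (rule continuous_on_compose2[OF cont]) (use t in \<open>auto intro!: continuous_intros\<close>)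
  then have "continuous_on U (dir_deriv v (\<lambda>x. h (t, x)))" for v
    by (rule continuous_on_cong[THEN iffD1, OF refl, rotated]) (simp add: sl(2))
  then show ?thesis
    unfolding One_nat_def Ck1_iff[OF \<open>open U\<close>] using sl(1) by blast
qed

text \<open>
  The square of the positive part of a quadratic polynomial is of class \<open>C\<^sup>1\<close>, positive on the ball and zero
  outside of it. One derivative is what integration by parts requires of a partition of unity.
\<close>

definition bump :: "real^'n \<Rightarrow> real \<Rightarrow> real^'n \<Rightarrow> real" where
  "bump a r x = (max 0 (r\<^sup>2 - (x - a) \<bullet> (x - a)))\<^sup>2"

lemma max_square_derivative: "((\<lambda>s. (max 0 s)\<^sup>2) has_real_derivative 2 * max 0 s) (at s)" for s :: real
proof -
  consider "s < 0" | "s > 0" | "s = 0" by linarith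
  then show ?thesis
  proof cases
    case 1
    have "((\<lambda>s. 0::real) has_real_derivative 0) (at s)" by simp
    then have "((\<lambda>s. (max 0 s)\<^sup>2) has_real_derivative 0) (at s)"
      by (rule has_field_derivative_transform_within_open[of _ _ _ "{..<0}"]) (use 1 in auto)
    with 1 show ?thesis by simp
  next
    case 2
    have "((\<lambda>s::real. s\<^sup>2) has_real_derivative 2 * s) (at s)" by (auto intro!: derivative_eq_intros)
    then have "((\<lambda>s. (max 0 s)\<^sup>2) has_real_derivative 2 * s) (at s)"
      by (rule has_field_derivative_transform_within_open[of _ _ _ "{0<..}"]) (use 2 in auto)
    with 2 show ?thesis by simp
  next
    case 3
    have "((\<lambda>h. (max 0 h)\<^sup>2 / h) \<longlongrightarrow> 0) (at (0::real))"
    proof (rule Lim_null_comparison[of _ abs])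
      have "norm ((max 0 h)\<^sup>2 / h) \<le> \<bar>h\<bar>" for h :: real
        by (cases "h > 0") (auto simp: power2_eq_square max_def)
      then show "\<forall>\<^sub>F h in at 0. norm ((max 0 h)\<^sup>2 / h) \<le> \<bar>h\<bar>" by simp
      show "(abs \<longlongrightarrow> 0) (at (0::real))" using tendsto_rabs_zero[OF tendsto_ident_at] by simp
    qed
    then show ?thesis using 3 by (simp add: has_field_derivative_iff)
  qed
qed

lemma Ck1_bump: "Ck_on 1 UNIV (bump a r)"
proof -
  have D: "(bump a r has_derivative (\<lambda>v. - (4 * max 0 (r\<^sup>2 - (x - a) \<bullet> (x - a)) * ((x - a) \<bullet> v)))) (at x)" for x
  proof -
    let ?u = "\<lambda>x. r\<^sup>2 - (x - a) \<bullet> (x - a)"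
    have "(?u has_derivative (\<lambda>v. - (2 * ((x - a) \<bullet> v)))) (at x)"
      by (auto intro!: derivative_eq_intros simp: inner_commute)
    from diff_chain_at[OF this max_square_derivative[of "?u x", unfolded has_field_derivative_def]]
    show ?thesis by (simp add: bump_def[abs_def] o_def mult.assoc)
  qed
  have "continuous_on UNIV (dir_deriv v (bump a r))" for v
    unfolding dir_deriv_eqI[OF D] by (auto intro!: continuous_intros)
  then show ?thesis using D by (auto simp: Ck1_iff differentiable_def)
qed

definition C1_function :: "('m, 'n::finite) chart set \<Rightarrow> ('m \<Rightarrow> real) \<Rightarrow> bool" where
  "C1_function A f \<longleftrightarrow> (\<forall>c\<in>A. Ck_on 1 (chart_img c) (\<lambda>x. f (chart_inv c x)))"

text \<open>
  A bump in one chart, extended by zero, is of class \<open>C\<^sup>1\<close> in every other chart \<open>d\<close>: the image of \<open>d\<close> is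
  covered by two open sets, the overlap with the first chart, where the function is a composition with the
  transition map, and the complement of the support. The complement is open because the support is compact
  and the manifold is a Hausdorff space.
\<close>

lemma ex_bump_function:
  fixes A :: "('m::{t2_space, second_countable_topology}, 'n::finite) chart set"
  assumes A: "smooth_atlas A"
  shows "\<exists>c\<in>A. \<exists>\<psi> K N. C1_function A \<psi> \<and> (\<forall>q. \<psi> q \<ge> 0) \<and> compact K \<and> K \<subseteq> chart_img c \<and>
    (\<forall>q. q \<notin> chart_inv c ` K \<longrightarrow> \<psi> q = 0) \<and> open N \<and> p \<in> N \<and> (\<forall>q\<in>N. \<psi> q > 0)"
proof -
  obtain c where c: "c \<in> A" "p \<in> chart_dom c" using smooth_atlas_cover[OF A] by blast
  note ch = smooth_atlas_chart[OF A c(1)]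
  let ?a = "coords c p"
  obtain r where r: "r > 0" "cball ?a r \<subseteq> chart_img c"
    using ch(2) c(2) open_contains_cball by blast
  define K where "K = cball ?a r"
  define \<psi> where "\<psi> q = (if q \<in> chart_dom c then bump ?a r (coords c q) else 0)" for q
  have K: "compact K" "K \<subseteq> chart_img c" using r by (simp_all add: K_def)
  have bump0: "bump ?a r x = 0" if "x \<notin> K" for x
  proof -
    have "r < norm (x - ?a)" using that by (simp add: K_def dist_norm norm_minus_commute)
    then have "r\<^sup>2 \<le> (x - ?a) \<bullet> (x - ?a)"
      using r(1) by (simp add: power2_norm_eq_inner[symmetric] power_mono)
    then show ?thesis by (simp add: bump_def)
  qed
  have bump_pos: "bump ?a r x > 0" if "x \<in> ball ?a r" for x
  proof -
    have "norm (x - ?a) < r" using that by (simp add: dist_norm norm_minus_commute)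
    then have "(norm (x - ?a))\<^sup>2 < r\<^sup>2" by (intro power_strict_mono) auto
    then show ?thesis by (simp add: bump_def power2_norm_eq_inner)
  qed
  have cK: "compact (chart_inv c ` K)"
    using K continuous_on_subset[OF ch(4)] by (intro compact_continuous_image) auto
  have supp: "\<psi> q = 0" if "q \<notin> chart_inv c ` K" for q
  proof (cases "q \<in> chart_dom c")
    case True
    then have "coords c q \<notin> K" using that ch(5) by (metis image_eqI)
    then show ?thesis by (simp add: \<psi>_def bump0)
  qed (simp add: \<psi>_def)
  have "C1_function A \<psi>"
    unfolding C1_function_def
  proof
    fix d assume d: "d \<in> A"
    note dh = smooth_atlas_chart[OF A d]
    note tr = transition_smooth[OF A d c(1)]
    let ?S = "coords d ` (chart_dom d \<inter> chart_dom c)" and ?T = "coords d ` (chart_dom d \<inter> - (chart_inv c ` K))"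
    have T: "open ?T" using cK by (intro open_coords_image[OF A d] open_Compl compact_imp_closed)
    have 1: "Ck_on 1 ?S (\<lambda>x. \<psi> (chart_inv d x))"
    proof (rule Ck_on_cong[THEN iffD1])
      show "Ck_on 1 ?S (\<lambda>x. bump ?a r ((coords c \<circ> chart_inv d) x))"
        by (rule Ck1_compose[OF tr(2) open_UNIV Ck1_bump smooth_on_imp_Ck[OF tr(1)]]) simp
      show "bump ?a r ((coords c \<circ> chart_inv d) x) = \<psi> (chart_inv d x)" if "x \<in> ?S" for x
        using that coords_image_iff[OF A d] by (simp add: \<psi>_def)
    qed
    have 2: "Ck_on 1 ?T (\<lambda>x. \<psi> (chart_inv d x))"
    proof (rule Ck_on_cong[THEN iffD1, OF _ Ck_on_const[OF T]])
      show "0 = \<psi> (chart_inv d x)" if "x \<in> ?T" for x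
        using that coords_image_iff[OF A d] supp by simp
    qed
    have "?S \<union> ?T = chart_img d" using K(2) ch(7) by (auto simp: subset_iff)
    with Ck_on_Un_open[OF tr(2) T 1 2] show "Ck_on 1 (chart_img d) (\<lambda>x. \<psi> (chart_inv d x))" by simp
  qed
  moreover have "open (chart_dom c \<inter> coords c -` ball ?a r)"
    using continuous_open_preimage[OF ch(3) ch(1) open_ball] .
  moreover have "p \<in> chart_dom c \<inter> coords c -` ball ?a r" using c(2) r(1) by simp
  moreover have "\<forall>q\<in>chart_dom c \<inter> coords c -` ball ?a r. \<psi> q > 0" using bump_pos by (simp add: \<psi>_def)
  moreover have "\<forall>q. \<psi> q \<ge> 0" by (simp add: \<psi>_def bump_def)
  ultimately show ?thesis using c(1) K supp by blast
qed

lemma partition_of_unity: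
  fixes A :: "('m::{t2_space, second_countable_topology}, 'n::finite) chart set"
  assumes "closed_manifold A"
  shows "\<exists>(P :: 'm set) \<phi> c K. finite P \<and> (\<forall>p\<in>P. c p \<in> A \<and> C1_function A (\<phi> p) \<and> compact (K p) \<and> K p \<subseteq> chart_img (c p) \<and>
      (\<forall>q. q \<notin> chart_inv (c p) ` K p \<longrightarrow> \<phi> p q = 0)) \<and> (\<forall>q. (\<Sum>p\<in>P. \<phi> p q) = (1::real))"
proof -
  have A: "smooth_atlas A" and cpt: "compact (UNIV :: 'm set)" using assms by (auto simp: closed_manifold_def)
  obtain c \<psi> K N where b: "\<And>p::'m. c p \<in> A" "\<And>p. C1_function A (\<psi> p)" "\<And>p q. \<psi> p q \<ge> 0" "\<And>p. compact (K p)"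
    "\<And>p. K p \<subseteq> chart_img (c p)" "\<And>p q. q \<notin> chart_inv (c p) ` K p \<Longrightarrow> \<psi> p q = 0" "\<And>p. open (N p)" "\<And>p. p \<in> N p"
    "\<And>p q. q \<in> N p \<Longrightarrow> \<psi> p q > 0"
    using ex_bump_function[OF A] by metis
  have cover: "UNIV \<subseteq> (\<Union>p\<in>UNIV. N p)" using b(8) by blast
  obtain P where P: "finite P" "UNIV \<subseteq> (\<Union>p\<in>P. N p)"
    by (rule compactE_image[OF cpt b(7) cover])
  define \<Psi> where "\<Psi> q = (\<Sum>p\<in>P. \<psi> p q)" for q
  have pos: "\<Psi> q > 0" for q
  proof -
    obtain p where p: "p \<in> P" "q \<in> N p" using P(2) by blast
    then have "0 < \<psi> p q" using b(9) by blast
    also have "\<dots> \<le> \<Psi> q" unfolding \<Psi>_def using p P(1) b(3) by (intro member_le_sum) auto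
    finally show ?thesis .
  qed
  define \<phi> where "\<phi> p q = \<psi> p q * inverse (\<Psi> q)" for p q
  have "C1_function A (\<phi> p)" for p
    unfolding C1_function_def \<phi>_def
  proof
    fix d assume d: "d \<in> A"
    have o: "open (chart_img d)" by (rule smooth_atlas_chart(2)[OF A d])
    have "Ck_on 1 (chart_img d) (\<lambda>x. \<psi> p (chart_inv d x))" for p
      using b(2) d by (auto simp: C1_function_def)
    then show "Ck_on 1 (chart_img d) (\<lambda>x. \<psi> p (chart_inv d x) * inverse (\<Psi> (chart_inv d x)))"
      unfolding \<Psi>_def[of "chart_inv d _"] using pos[unfolded \<Psi>_def] less_irrefl
      by (intro Ck_on_mult Ck_on_inverse Ck_on_sum o) (auto, metis less_irrefl)
  qed
  moreover have "(\<Sum>p\<in>P. \<phi> p q) = 1" for q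
    using pos[of q] by (simp add: \<phi>_def sum_distrib_right[symmetric] \<Psi>_def[symmetric])
  moreover have "\<phi> p q = 0" if "q \<notin> chart_inv (c p) ` K p" for p q using b(6)[OF that] by (simp add: \<phi>_def)
  ultimately show ?thesis
    using P(1) b(1,4,5) by (intro exI[of _ P] exI[of _ \<phi>] exI[of _ c] exI[of _ K] conjI ballI allI impI) auto
qed

context volume_family
begin

text \<open>
  The directional derivative \<open>V f\<close>. It does not depend on the chart when \<open>V\<close> transforms like a vector field,
  and so connects the integrations by parts that are carried out in different charts.
\<close>

definition "along V f c x = (\<Sum>i\<in>UNIV. V c i x * dir_deriv (axis i 1) (\<lambda>y. f (chart_inv c y)) x)"

lemma along_chart_independent:
  assumes c: "c \<in> A" and d: "d \<in> A" and p: "p \<in> chart_dom c \<inter> chart_dom d" and f: "C1_function A f"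
    and V: "\<And>a. (\<Sum>i\<in>UNIV. dir_deriv (axis i 1) (\<lambda>y. (coords d \<circ> chart_inv c) y $ a) (coords c p) * V c i (coords c p)) = V d a (coords d p)"
  shows "along V f c (coords c p) = along V f d (coords d p)"
proof -
  let ?\<phi> = "coords d \<circ> chart_inv c" and ?x = "coords c p"
  note tr = transition_smooth[OF atlas c d]
  have \<phi>x: "?\<phi> ?x = coords d p" using p chart(5)[OF c] by simp
  have fd: "(\<lambda>y. f (chart_inv d y)) differentiable at (?\<phi> ?x)"
    using f d p chart(2)[OF d] unfolding \<phi>x by (auto simp: C1_function_def Ck1_iff)
  have "dir_deriv (axis i 1) (\<lambda>y. f (chart_inv c y)) ?x
     = (\<Sum>a\<in>UNIV. dir_deriv (axis i 1) (\<lambda>y. ?\<phi> y $ a) ?x * dir_deriv (axis a 1) (\<lambda>y. f (chart_inv d y)) (coords d p))" for i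
  proof -
    have "dir_deriv (axis i 1) (\<lambda>y. f (chart_inv c y)) ?x = dir_deriv (axis i 1) (\<lambda>y. f (chart_inv d (?\<phi> y))) ?x"
    proof (rule dir_deriv_cong_open[OF tr(2)])
      show "?x \<in> coords c ` (chart_dom c \<inter> chart_dom d)" using p by blast
      show "f (chart_inv c y) = f (chart_inv d (?\<phi> y))" if "y \<in> coords c ` (chart_dom c \<inter> chart_dom d)" for y
        using that chart(5)[OF d] coords_image_iff[OF atlas c] by simp
    qed
    also have "\<dots> = (\<Sum>a\<in>UNIV. dir_deriv (axis i 1) (\<lambda>y. ?\<phi> y $ a) ?x * dir_deriv (axis a 1) (\<lambda>y. f (chart_inv d y)) (?\<phi> ?x))"
      by (rule dir_deriv_compose_vec(2)[OF fd tr(3)[OF p]])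
    finally show ?thesis unfolding \<phi>x .
  qed
  then have "along V f c ?x = (\<Sum>i\<in>UNIV. \<Sum>a\<in>UNIV. (dir_deriv (axis i 1) (\<lambda>y. ?\<phi> y $ a) ?x * V c i ?x) * dir_deriv (axis a 1) (\<lambda>y. f (chart_inv d y)) (coords d p))"
    unfolding along_def by (simp add: sum_distrib_left mult_ac)
  also have "\<dots> = (\<Sum>a\<in>UNIV. (\<Sum>i\<in>UNIV. dir_deriv (axis i 1) (\<lambda>y. ?\<phi> y $ a) ?x * V c i ?x) * dir_deriv (axis a 1) (\<lambda>y. f (chart_inv d y)) (coords d p))"
    unfolding sum_distrib_right by (rule sum.swap)
  finally show ?thesis unfolding V along_def .
qed

lemma integrable_vol_compact_support:
  fixes f :: "'m \<Rightarrow> real"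
  assumes f: "continuous_on UNIV f" and c: "c \<in> A" and K: "compact K" "K \<subseteq> chart_img c" "\<And>p. p \<notin> chart_inv c ` K \<Longrightarrow> f p = 0"
  shows "integrable vol f" "integral\<^sup>L vol f = (\<integral>x. indicator (chart_img c) x * (w c x * f (chart_inv c x)) \<partial>lborel)"
proof -
  have meas: "f \<in> borel_measurable borel" using f by (rule borel_measurable_continuous_onI)
  have out: "f p = 0" if "p \<notin> chart_dom c" for p
    using that K(2) chart(7)[OF c] by (intro K(3)) auto
  have "continuous_on K (\<lambda>x. w c x * f (chart_inv c x))"
    by (intro continuous_on_mult continuous_on_subset[OF w_cont[OF c] K(2)]
        continuous_on_compose2[OF f continuous_on_subset[OF chart(4)[OF c] K(2)]]) auto
  from borel_integrable_compact[OF K(1) this]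
  have "integrable lborel (\<lambda>x. indicator K x * (w c x * f (chart_inv c x)))" by simp
  also have "(\<lambda>x. indicator K x * (w c x * f (chart_inv c x))) = (\<lambda>x. indicator (chart_img c) x * (w c x * f (chart_inv c x)))"
  proof
    fix x
    have "f (chart_inv c x) = 0" if "x \<in> chart_img c" "x \<notin> K"
    proof (rule K(3), rule notI)
      assume "chart_inv c x \<in> chart_inv c ` K"
      then obtain y where "y \<in> K" "chart_inv c x = chart_inv c y" by blast
      then show False using that chart(6)[OF c] K(2) by (metis subsetD)
    qed
    then show "indicator K x * (w c x * f (chart_inv c x)) = indicator (chart_img c) x * (w c x * f (chart_inv c x))"
      using K(2) by (auto simp: indicator_def)
  qed
  finally show "integrable vol f" using integral_vol_chart(1)[OF c meas out] by simp
  show "integral\<^sup>L vol f = (\<integral>x. indicator (chart_img c) x * (w c x * f (chart_inv c x)) \<partial>lborel)"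
    by (rule integral_vol_chart(2)[OF c meas out])
qed

lemma C1_function_continuous: "C1_function A f \<Longrightarrow> continuous_on UNIV f"
  by (rule continuous_on_charts[OF atlas]) (auto simp: C1_function_def intro: Ck_on_imp_continuous_on)

lemma integrable_vol_continuous:
  fixes f :: "'m \<Rightarrow> real"
  assumes f: "continuous_on UNIV f"
  shows "integrable vol f"
proof -
  obtain P :: "'m set" and \<phi> c K where P: "finite P" "\<And>p. p \<in> P \<Longrightarrow> c p \<in> A \<and> C1_function A (\<phi> p) \<and> compact (K p) \<and> K p \<subseteq> chart_img (c p) \<and>
      (\<forall>q. q \<notin> chart_inv (c p) ` K p \<longrightarrow> \<phi> p q = 0)" and one: "\<And>q. (\<Sum>p\<in>P. \<phi> p q) = 1"
    using partition_of_unity[OF closed] by metis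
  have "integrable vol (\<lambda>q. \<Sum>p\<in>P. \<phi> p q * f q)"
  proof (rule Bochner_Integration.integrable_sum)
    fix p assume "p \<in> P"
    then show "integrable vol (\<lambda>q. \<phi> p q * f q)"
      using P(2)[of p] f C1_function_continuous
      by (intro integrable_vol_compact_support(1)[of _ "c p" "K p"] continuous_on_mult) auto
  qed
  then show ?thesis by (simp add: sum_distrib_right[symmetric] one)
qed

text \<open>
  Let \<open>\<phi>\<^sub>p\<close> be a partition of unity with supports in charts. In the chart of \<open>\<phi>\<^sub>p\<close> the vector field \<open>\<phi>\<^sub>p V\<close> has
  compact support, and \<open>div (\<phi>\<^sub>p V) = \<phi>\<^sub>p div V + V \<phi>\<^sub>p\<close> gives \<open>\<integral> \<phi>\<^sub>p div V = - \<integral> V \<phi>\<^sub>p\<close>. Since \<open>V \<phi>\<^sub>p\<close> does not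
  depend on the chart, these equations may be added up, and \<open>\<Sum>\<^sub>p V \<phi>\<^sub>p = V 1 = 0\<close>.
\<close>

theorem divergence_theorem:
  assumes w1: "\<And>c. c \<in> A \<Longrightarrow> Ck_on 1 (chart_img c) (w c)"
    and V1: "\<And>c i. c \<in> A \<Longrightarrow> Ck_on 1 (chart_img c) (V c i)"
    and V: "\<And>c d p a. c \<in> A \<Longrightarrow> d \<in> A \<Longrightarrow> p \<in> chart_dom c \<inter> chart_dom d \<Longrightarrow>
      (\<Sum>i\<in>UNIV. dir_deriv (axis i 1) (\<lambda>y. (coords d \<circ> chart_inv c) y $ a) (coords c p) * V c i (coords c p)) = V d a (coords d p)"
    and f: "\<And>c x. c \<in> A \<Longrightarrow> x \<in> chart_img c \<Longrightarrow>
      w c x * f (chart_inv c x) = (\<Sum>i\<in>UNIV. dir_deriv (axis i 1) (\<lambda>y. w c y * V c i y) x)"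
  shows "continuous_on UNIV f" "integral\<^sup>L vol f = 0"
proof -
  have wV1: "Ck_on 1 (chart_img c) (\<lambda>y. w c y * V c i y)" if "c \<in> A" for c i
    using that by (intro Ck_on_mult w1 V1 chart(2))
  show contf: "continuous_on UNIV f"
  proof (rule continuous_on_charts[OF atlas])
    fix c assume c: "c \<in> A"
    have "continuous_on (chart_img c) (\<lambda>x. (\<Sum>i\<in>UNIV. dir_deriv (axis i 1) (\<lambda>y. w c y * V c i y) x) / w c x)"
      using w_pos[OF c] wV1[OF c]
      by (intro continuous_on_divide continuous_on_sum w_cont[OF c]) (force simp: Ck1_iff[OF chart(2)[OF c]])+
    then show "continuous_on (chart_img c) (\<lambda>x. f (chart_inv c x))"
      by (rule continuous_on_cong[THEN iffD1, OF refl, rotated])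
        (use w_pos[OF c] f[OF c] in \<open>simp add: field_simps less_imp_neq[symmetric]\<close>)
  qed
  obtain P :: "'m set" and \<phi> c K where P: "finite P" "\<And>p. p \<in> P \<Longrightarrow> c p \<in> A \<and> C1_function A (\<phi> p) \<and> compact (K p) \<and> K p \<subseteq> chart_img (c p) \<and>
      (\<forall>q. q \<notin> chart_inv (c p) ` K p \<longrightarrow> \<phi> p q = 0)" and one: "\<And>q. (\<Sum>p\<in>P. \<phi> p q) = 1"
    using partition_of_unity[OF closed] by metis
  define chart_at where "chart_at q = (SOME c. c \<in> A \<and> q \<in> chart_dom c)" for q
  have at: "chart_at q \<in> A" "q \<in> chart_dom (chart_at q)" for q
    using someI_ex[of "\<lambda>c. c \<in> A \<and> q \<in> chart_dom c"] smooth_atlas_cover[OF atlas] unfolding chart_at_def by blast+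
  \<comment> \<open>The derivative of \<open>\<phi> p\<close> along \<open>V\<close> as a function on the manifold, computed at \<open>q\<close> in some chart around \<open>q\<close>.\<close>
  define X where "X p q = along V (\<phi> p) (chart_at q) (coords (chart_at q) q)" for p q
  have X_chart: "X p (chart_inv d x) = along V (\<phi> p) d x" if "p \<in> P" "d \<in> A" "x \<in> chart_img d" for p d x
  proof -
    have "chart_inv d x \<in> chart_dom d" "coords d (chart_inv d x) = x" using chart that by auto
    moreover have "along V (\<phi> p) (chart_at (chart_inv d x)) (coords (chart_at (chart_inv d x)) (chart_inv d x))
       = along V (\<phi> p) d (coords d (chart_inv d x))"
      using P(2)[OF that(1)] at calculation that(2) by (intro along_chart_independent V) auto
    ultimately show ?thesis by (simp add: X_def)
  qed
  have contX: "continuous_on UNIV (X p)" if "p \<in> P" for p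
  proof (rule continuous_on_charts[OF atlas])
    fix d assume d: "d \<in> A"
    have "continuous_on (chart_img d) (along V (\<phi> p) d)"
      unfolding along_def using P(2)[OF that] d
      by (intro continuous_on_sum continuous_on_mult Ck_on_imp_continuous_on[OF V1[OF d]])
        (auto simp: C1_function_def Ck1_iff[OF chart(2)[OF d]])
    then show "continuous_on (chart_img d) (\<lambda>x. X p (chart_inv d x))"
      by (rule continuous_on_cong[THEN iffD1, OF refl, rotated]) (simp add: X_chart that d)
  qed
  have parts: "integral\<^sup>L vol (\<lambda>q. \<phi> p q * f q) = - integral\<^sup>L vol (X p)" if p: "p \<in> P" for p
  proof -
    let ?c = "c p"
    have c: "?c \<in> A" and C1: "C1_function A (\<phi> p)" and K: "compact (K p)" "K p \<subseteq> chart_img ?c"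
      and supp: "\<And>q. q \<notin> chart_inv ?c ` K p \<Longrightarrow> \<phi> p q = 0" using P(2)[OF p] by auto
    note o = chart(2)[OF c]
    let ?\<phi> = "\<lambda>x. \<phi> p (chart_inv ?c x)"
    have \<phi>1: "Ck_on 1 (chart_img ?c) ?\<phi>" using C1 c by (auto simp: C1_function_def)
    have supp': "?\<phi> x = 0" if "x \<in> chart_img ?c - K p" for x
    proof (rule supp, rule notI)
      assume "chart_inv ?c x \<in> chart_inv ?c ` K p"
      then obtain y where "y \<in> K p" "chart_inv ?c x = chart_inv ?c y" by blast
      then show False using that chart(6)[OF c] K(2) by (metis DiffD1 DiffD2 subsetD)
    qed
    have 1: "integral\<^sup>L vol (\<lambda>q. \<phi> p q * f q) = (\<integral>x. indicator (chart_img ?c) x * (w ?c x * (?\<phi> x * f (chart_inv ?c x))) \<partial>lborel)"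
      using C1_function_continuous[OF C1] contf supp
      by (intro integrable_vol_compact_support(2)[OF _ c K] continuous_on_mult) auto
    have supX: "X p q = 0" if "q \<notin> chart_inv ?c ` K p" for q
    proof -
      let ?d = "chart_at q"
      have "open (coords ?d ` (chart_dom ?d \<inter> - (chart_inv ?c ` K p)))"
        using K continuous_on_subset[OF chart(4)[OF c]]
        by (intro open_coords_image[OF atlas at(1)] open_Compl compact_imp_closed compact_continuous_image) auto
      then have "dir_deriv (axis i 1) (\<lambda>y. \<phi> p (chart_inv ?d y)) (coords ?d q) = dir_deriv (axis i 1) (\<lambda>y. 0 :: real) (coords ?d q)" for i
      proof (rule dir_deriv_cong_open)
        show "coords ?d q \<in> coords ?d ` (chart_dom ?d \<inter> - (chart_inv ?c ` K p))" using that at(2) by blast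
        show "\<phi> p (chart_inv ?d y) = 0" if "y \<in> coords ?d ` (chart_dom ?d \<inter> - (chart_inv ?c ` K p))" for y
          using that supp unfolding coords_image_iff[OF atlas at(1)] by blast
      qed
      then show ?thesis by (simp add: X_def along_def)
    qed
    have 2: "integral\<^sup>L vol (X p) = (\<integral>x. indicator (chart_img ?c) x * (w ?c x * X p (chart_inv ?c x)) \<partial>lborel)"
      by (rule integrable_vol_compact_support(2)[OF contX[OF p] c K supX])
    have F: "Ck_on 1 (chart_img ?c) (\<lambda>y. ?\<phi> y * (w ?c y * V ?c i y))" for i
      by (intro Ck_on_mult[OF o] \<phi>1 wV1[OF c])
    have F0: "?\<phi> x * (w ?c x * V ?c i x) = 0" if "x \<in> chart_img ?c - K p" for x i using supp'[OF that] by simp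
    have I: "integrable lborel (\<lambda>x. indicator (chart_img ?c) x * dir_deriv (axis i 1) (\<lambda>y. ?\<phi> y * (w ?c y * V ?c i y)) x)"
      "(\<integral>x. indicator (chart_img ?c) x * dir_deriv (axis i 1) (\<lambda>y. ?\<phi> y * (w ?c y * V ?c i y)) x \<partial>lborel) = 0" for i
      by (rule integral_dir_deriv_compact_support[OF o F K], erule F0)+
    have sum: "(\<Sum>i\<in>UNIV. indicator (chart_img ?c) x * dir_deriv (axis i 1) (\<lambda>y. ?\<phi> y * (w ?c y * V ?c i y)) x)
      = indicator (chart_img ?c) x * (w ?c x * (?\<phi> x * f (chart_inv ?c x))) + indicator (chart_img ?c) x * (w ?c x * X p (chart_inv ?c x))" for x
    proof (cases "x \<in> chart_img ?c")
      case True
      have "dir_deriv (axis i 1) (\<lambda>y. ?\<phi> y * (w ?c y * V ?c i y)) x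
        = dir_deriv (axis i 1) ?\<phi> x * (w ?c x * V ?c i x) + ?\<phi> x * dir_deriv (axis i 1) (\<lambda>y. w ?c y * V ?c i y) x" for i
        using \<phi>1 wV1[OF c] True by (intro dir_deriv_mult) (auto simp: Ck1_iff[OF o])
      then have "(\<Sum>i\<in>UNIV. dir_deriv (axis i 1) (\<lambda>y. ?\<phi> y * (w ?c y * V ?c i y)) x)
        = w ?c x * along V (\<phi> p) ?c x + ?\<phi> x * (w ?c x * f (chart_inv ?c x))"
        unfolding f[OF c True] by (simp add: sum.distrib along_def sum_distrib_left mult_ac)
      then show ?thesis using True by (simp add: X_chart[OF p c True] mult_ac)
    qed simp
    have "0 = (\<Sum>i\<in>UNIV. \<integral>x. indicator (chart_img ?c) x * dir_deriv (axis i 1) (\<lambda>y. ?\<phi> y * (w ?c y * V ?c i y)) x \<partial>lborel)"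
      by (simp add: I(2))
    also have "\<dots> = (\<integral>x. (\<Sum>i\<in>UNIV. indicator (chart_img ?c) x * dir_deriv (axis i 1) (\<lambda>y. ?\<phi> y * (w ?c y * V ?c i y)) x) \<partial>lborel)"
      by (rule Bochner_Integration.integral_sum[symmetric]) (rule I(1))
    also have "\<dots> = (\<integral>x. indicator (chart_img ?c) x * (w ?c x * (?\<phi> x * f (chart_inv ?c x))) \<partial>lborel)
       + (\<integral>x. indicator (chart_img ?c) x * (w ?c x * X p (chart_inv ?c x)) \<partial>lborel)"
      unfolding sum
    proof (rule Bochner_Integration.integral_add)
      have meas: "(\<lambda>q. \<phi> p q * f q) \<in> borel_measurable borel" "X p \<in> borel_measurable borel"
        using C1_function_continuous[OF C1] contf contX[OF p]
        by (auto intro!: borel_measurable_continuous_onI continuous_on_mult)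
      have dom: "q \<notin> chart_inv ?c ` K p" if "q \<notin> chart_dom ?c" for q
        using that K(2) chart(7)[OF c] by auto
      have "integrable vol (\<lambda>q. \<phi> p q * f q)"
        using C1_function_continuous[OF C1] contf supp
        by (intro integrable_vol_compact_support(1)[OF _ c K] continuous_on_mult) auto
      then show "integrable lborel (\<lambda>x. indicator (chart_img ?c) x * (w ?c x * (?\<phi> x * f (chart_inv ?c x))))"
        using integral_vol_chart(1)[OF c meas(1)] dom supp by simp
      have "integrable vol (X p)" by (rule integrable_vol_compact_support(1)[OF contX[OF p] c K supX])
      then show "integrable lborel (\<lambda>x. indicator (chart_img ?c) x * (w ?c x * X p (chart_inv ?c x)))"
        using integral_vol_chart(1)[OF c meas(2)] dom supX by simp
    qed
    finally show ?thesis unfolding 1 2 by simp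
  qed
  have X0: "(\<Sum>p\<in>P. X p q) = 0" for q
  proof -
    let ?d = "chart_at q" and ?x = "coords (chart_at q) q"
    have o: "open (chart_img ?d)" by (rule chart(2)[OF at(1)])
    have diff: "(\<lambda>y. \<phi> p (chart_inv ?d y)) differentiable at ?x" if "p \<in> P" for p
    proof -
      have "Ck_on 1 (chart_img ?d) (\<lambda>y. \<phi> p (chart_inv ?d y))" "?x \<in> chart_img ?d"
        using P(2)[OF that] at by (auto simp: C1_function_def)
      then show ?thesis unfolding One_nat_def Ck1_iff[OF o] by blast
    qed
    have "(\<Sum>p\<in>P. dir_deriv (axis i 1) (\<lambda>y. \<phi> p (chart_inv ?d y)) ?x) = 0" for i
      using dir_deriv_sum[of P "\<lambda>p y. \<phi> p (chart_inv ?d y)" ?x "axis i 1", OF diff] by (simp add: one)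
    then have "(\<Sum>i\<in>UNIV. V ?d i ?x * (\<Sum>p\<in>P. dir_deriv (axis i 1) (\<lambda>y. \<phi> p (chart_inv ?d y)) ?x)) = 0" by simp
    then show ?thesis unfolding X_def along_def sum_distrib_left by (subst sum.swap)
  qed
  have "integral\<^sup>L vol f = integral\<^sup>L vol (\<lambda>q. \<Sum>p\<in>P. \<phi> p q * f q)"
    by (simp add: sum_distrib_right[symmetric] one)
  also have "\<dots> = (\<Sum>p\<in>P. integral\<^sup>L vol (\<lambda>q. \<phi> p q * f q))"
    using P(2) C1_function_continuous contf
    by (intro Bochner_Integration.integral_sum integrable_vol_continuous continuous_on_mult) auto
  also have "\<dots> = - (\<Sum>p\<in>P. integral\<^sup>L vol (X p))" by (simp add: parts sum_negf)
  also have "(\<Sum>p\<in>P. integral\<^sup>L vol (X p)) = integral\<^sup>L vol (\<lambda>q. \<Sum>p\<in>P. X p q)"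
    by (rule Bochner_Integration.integral_sum[symmetric]) (rule integrable_vol_continuous[OF contX])
  also have "\<dots> = 0" by (simp add: X0)
  finally show "integral\<^sup>L vol f = 0" by simp
qed

text \<open>
  Otherwise \<open>f\<close> would be positive on a nonempty open set, but nonempty open sets have positive volume because
  the densities are positive.
\<close>

lemma continuous_nonneg_integral_zero:
  fixes f :: "'m \<Rightarrow> real"
  assumes f: "continuous_on UNIV f" and nonneg: "\<And>p. f p \<ge> 0" and zero: "integral\<^sup>L vol f \<le> 0"
  shows "f p = 0"
proof (rule ccontr)
  assume "f p \<noteq> 0"
  obtain c where c: "c \<in> A" "p \<in> chart_dom c" using smooth_atlas_cover[OF atlas] by blast
  let ?B = "chart_dom c \<inter> f -` {0<..}"
  have B: "open ?B"
    using continuous_open_preimage[OF continuous_on_subset[OF f] chart(1)[OF c(1)], of "{0<..}"] by simp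
  have "integral\<^sup>L vol f = 0" using zero nonneg by (meson Bochner_Integration.integral_nonneg order_antisym)
  then have "AE q in vol. f q = 0"
    using integral_nonneg_eq_0_iff_AE[OF integrable_vol_continuous[OF f]] nonneg by simp
  then have "emeasure vol {q \<in> space vol. f q \<noteq> 0} = 0"
    using f borel_measurable_continuous_onI[OF f] by (subst (asm) AE_iff_measurable[OF _ refl]) auto
  then have "emeasure vol ?B = 0"
    using emeasure_mono[of ?B "{q \<in> space vol. f q \<noteq> 0}" vol] borel_measurable_continuous_onI[OF f] sets_eq_imp_space_eq[OF sets_vol]
    by (auto simp: subset_iff)
  moreover have "emeasure vol ?B = emeasure (chart_measure c) ?B"
    using is_volume_vol c(1) borel_open[OF B] by (auto simp: is_volume_iff)
  ultimately have "(\<integral>\<^sup>+x. ennreal (indicator (coords c ` ?B) x * w c x) \<partial>lborel) = 0"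
    using emeasure_chart_measure[OF c(1) borel_open[OF B]] by (simp add: Int_ac)
  moreover have o: "open (coords c ` ?B)"
    using open_coords_image[OF atlas c(1) B] by (simp add: Int_ac)
  have meas: "(\<lambda>x. ennreal (indicator (coords c ` ?B) x * w c x)) \<in> borel_measurable lborel"
  proof -
    have "(\<lambda>x. indicator (coords c ` ?B) x *\<^sub>R w c x) \<in> borel_measurable borel"
      by (intro borel_measurable_continuous_on_indicator continuous_on_subset[OF w_cont[OF c(1)]] borel_open o) auto
    then show ?thesis by simp
  qed
  ultimately have "AE x in lborel. ennreal (indicator (coords c ` ?B) x * w c x) = 0"
    using nn_integral_0_iff_AE[OF meas] by simp
  then have "AE x in lborel. x \<notin> coords c ` ?B"
  proof (rule AE_mp, intro AE_I2 impI notI)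
    fix x assume "ennreal (indicator (coords c ` ?B) x * w c x) = 0" "x \<in> coords c ` ?B"
    then show False using w_pos[OF c(1), of x] by (auto simp: ennreal_eq_0_iff)
  qed
  then have "emeasure lborel (coords c ` ?B) = 0"
    using AE_iff_measurable[of "coords c ` ?B" lborel "\<lambda>x. x \<notin> coords c ` ?B"] borel_open[OF o] by auto
  then have "negligible (coords c ` ?B)"
    using o by (simp add: negligible_iff_emeasure0 borel_open)
  moreover have "coords c ` ?B \<noteq> {}" using c(2) \<open>f p \<noteq> 0\<close> nonneg[of p] by (auto simp: less_le)
  ultimately show False using open_not_negligible[OF o] by blast
qed

end

section \<open>Riemannian metrics in coordinates\<close>

lemma transition_deriv_linear:
  assumes "smooth_atlas A" "c \<in> A" "d \<in> A" "p \<in> chart_dom c \<inter> chart_dom d"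
  shows "linear (transition_deriv c d p)"
  using transition_smooth(4)[OF assms] by (rule has_derivative_linear)

lemma transition_deriv_compose:
  assumes A: "smooth_atlas A" and c: "c \<in> A" and d: "d \<in> A" and e: "e \<in> A"
    and p: "p \<in> chart_dom c" "p \<in> chart_dom d" "p \<in> chart_dom e"
  shows "transition_deriv c e p v = transition_deriv d e p (transition_deriv c d p v)"
proof -
  let ?S = "coords c ` (chart_dom c \<inter> (chart_dom d \<inter> chart_dom e))"
  have S: "open ?S"
    using smooth_atlas_chart(1)[OF A d] smooth_atlas_chart(1)[OF A e]
    by (intro open_coords_image[OF A c] open_Int)
  have pS: "coords c p \<in> ?S" using p by blast
  have cp: "(coords d \<circ> chart_inv c) (coords c p) = coords d p" using smooth_atlas_chart(5)[OF A c] p by simp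
  have "((coords e \<circ> chart_inv d) has_derivative transition_deriv d e p) (at ((coords d \<circ> chart_inv c) (coords c p)))"
    unfolding cp by (rule transition_smooth(4)[OF A d e]) (use p in simp)
  with transition_smooth(4)[OF A c d IntI[OF p(1,2)]]
  have "((coords e \<circ> chart_inv d) \<circ> (coords d \<circ> chart_inv c) has_derivative
      transition_deriv d e p \<circ> transition_deriv c d p) (at (coords c p))" by (rule diff_chain_at)
  then have "((coords e \<circ> chart_inv c) has_derivative transition_deriv d e p \<circ> transition_deriv c d p) (at (coords c p))"
  proof (rule has_derivative_transform_within_open[OF _ S pS])
    fix x assume "x \<in> ?S"
    then have "chart_inv c x \<in> chart_dom d" unfolding coords_image_iff[OF A c] by simp
    then show "((coords e \<circ> chart_inv d) \<circ> (coords d \<circ> chart_inv c)) x = (coords e \<circ> chart_inv c) x"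
      using smooth_atlas_chart(5)[OF A d] by simp
  qed
  moreover have "((coords e \<circ> chart_inv c) has_derivative transition_deriv c e p) (at (coords c p))"
    by (rule transition_smooth(4)[OF A c e]) (use p in simp)
  ultimately have "transition_deriv c e p = transition_deriv d e p \<circ> transition_deriv c d p"
    by (rule has_derivative_unique[rotated])
  then show ?thesis by simp
qed

lemma transition_deriv_self:
  assumes A: "smooth_atlas A" and c: "c \<in> A" and p: "p \<in> chart_dom c"
  shows "transition_deriv c c p v = v"
proof -
  have "((coords c \<circ> chart_inv c) has_derivative (\<lambda>v. v)) (at (coords c p))"
  proof (rule has_derivative_transform_within_open[OF has_derivative_ident smooth_atlas_chart(2)[OF A c]])
    show "coords c p \<in> chart_img c" using p by simp
    show "x = (coords c \<circ> chart_inv c) x" if "x \<in> chart_img c" for x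
      using smooth_atlas_chart(6)[OF A c that] by simp
  qed
  then have "(\<lambda>v. v) = transition_deriv c c p" unfolding transition_deriv_def by (rule frechet_derivative_at)
  then show ?thesis by metis
qed

text \<open>
  The tangent vector at \<open>p\<close> with coordinate vector \<open>v\<close> in the chart \<open>c\<close>; it is linear in \<open>v\<close>, in contrast to
  \<^const>\<open>coord_vec\<close>, which only covers the standard basis.
\<close>

definition tangent_of :: "('m, 'n::finite) chart set \<Rightarrow> ('m, 'n) chart \<Rightarrow> 'm \<Rightarrow> real^'n \<Rightarrow> ('m, 'n) tangent_vec" where
  "tangent_of A c p v = (\<lambda>d. if d \<in> A \<and> p \<in> chart_dom d then transition_deriv c d p v else 0)"

lemma coord_vec_eq: "coord_vec A c p i = tangent_of A c p (axis i 1)"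
  by (simp add: coord_vec_def tangent_of_def)

lemma
  assumes A: "smooth_atlas A" and c: "c \<in> A" and p: "p \<in> chart_dom c"
  shows tangent_of_in: "tangent_of A c p v \<in> tangent_space A p"
    and tangent_of_apply: "tangent_of A c p v c = v"
    and tangent_of_combination: "tangent_of A c p (a *\<^sub>R v + b *\<^sub>R u) = (\<lambda>d. a *\<^sub>R tangent_of A c p v d + b *\<^sub>R tangent_of A c p u d)"
    and tangent_of_change: "d \<in> A \<Longrightarrow> p \<in> chart_dom d \<Longrightarrow> tangent_of A c p v = tangent_of A d p (transition_deriv c d p v)"
proof -
  show "tangent_of A c p v \<in> tangent_space A p"
    unfolding tangent_space_def mem_Collect_eq
  proof (intro conjI ballI allI impI)
    fix d e assume "d \<in> A" "e \<in> A" "p \<in> chart_dom d \<inter> chart_dom e"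
    then show "tangent_of A c p v e = transition_deriv d e p (tangent_of A c p v d)"
      using transition_deriv_compose[OF A c, of d e p v] p by (simp add: tangent_of_def)
  qed (auto simp: tangent_of_def)
  show "tangent_of A c p v c = v" using c p by (simp add: tangent_of_def transition_deriv_self[OF A c])
  show "tangent_of A c p (a *\<^sub>R v + b *\<^sub>R u) = (\<lambda>d. a *\<^sub>R tangent_of A c p v d + b *\<^sub>R tangent_of A c p u d)"
    using transition_deriv_linear[OF A c] p
    by (auto simp: tangent_of_def fun_eq_iff linear_add linear_cmul)
  show "tangent_of A c p v = tangent_of A d p (transition_deriv c d p v)" if "d \<in> A" "p \<in> chart_dom d"
  proof
    fix e
    show "tangent_of A c p v e = tangent_of A d p (transition_deriv c d p v) e"
      using transition_deriv_compose[OF A c that(1), of e p v] p that by (simp add: tangent_of_def)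
  qed
qed

lemma metric_in_chart:
  assumes A: "smooth_atlas A" and c: "c \<in> A" and p: "p \<in> chart_dom c" and g: "riemannian_metric A g"
  shows "g p (tangent_of A c p v) (tangent_of A c p u) = v \<bullet> (components A g c (coords c p) *v u)"
proof -
  let ?b = "\<lambda>v u. g p (tangent_of A c p v) (tangent_of A c p u)"
  note T = tangent_of_in[OF A c p] and lin = tangent_of_combination[OF A c p]
  have sym: "?b v u = ?b u v" for v u using g T by (simp add: riemannian_metric_def)
  have bil: "?b (a *\<^sub>R v + a' *\<^sub>R v') u = a * ?b v u + a' * ?b v' u" for a a' v v' u
    using g T unfolding riemannian_metric_def lin by blast
  have l: "linear (\<lambda>v. ?b v u)" for u
    using bil[of 1 _ 1] bil[of _ _ 0 0] by (intro linearI) simp_all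
  have r: "linear (\<lambda>u. ?b v u)" for v using l[of v] by (simp add: sym[of v])
  have exp: "v = (\<Sum>i\<in>UNIV. v $ i *\<^sub>R axis i 1)" for v :: "real^'b"
    by (simp add: basis_expansion scalar_mult_eq_scaleR[symmetric])
  have comp: "components A g c (coords c p) $ i $ j = ?b (axis i 1) (axis j 1)" for i j
    using smooth_atlas_chart(5)[OF A c p] by (simp add: components_def Let_def coord_vec_eq)
  have "?b v u = (\<Sum>i\<in>UNIV. v $ i * ?b (axis i 1) u)"
    by (subst exp[of v]) (simp add: linear_sum[OF l] linear_cmul[OF l])
  also have "\<dots> = (\<Sum>i\<in>UNIV. v $ i * (\<Sum>j\<in>UNIV. u $ j * ?b (axis i 1) (axis j 1)))"
    by (subst exp[of u]) (simp add: linear_sum[OF r] linear_cmul[OF r])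
  also have "\<dots> = v \<bullet> (components A g c (coords c p) *v u)"
    by (simp add: inner_matrix_vector comp sum_distrib_left mult_ac)
  finally show ?thesis .
qed

lemma metric_components:
  assumes A: "smooth_atlas A" and c: "c \<in> A" and x: "x \<in> chart_img c" and g: "riemannian_metric A g"
  shows components_sym: "components A g c x $ i $ j = components A g c x $ j $ i"
    and components_pos: "v \<noteq> 0 \<Longrightarrow> v \<bullet> (components A g c x *v v) > 0"
proof -
  obtain p where p: "p \<in> chart_dom c" "x = coords c p" using x by auto
  note b = metric_in_chart[OF A c p(1) g] and T = tangent_of_in[OF A c p(1)]
  have e: "axis i 1 \<bullet> (M *v axis j 1) = M $ i $ j" for M :: "real^'b^'b" and i j
    by (simp add: inner_axis' matrix_vector_mul_component matrix_vector_mult_basis column_def)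
  show "components A g c x $ i $ j = components A g c x $ j $ i"
    using b[of "axis i 1" "axis j 1"] b[of "axis j 1" "axis i 1"] g T
    unfolding p(2) e by (simp add: riemannian_metric_def)
  assume "v \<noteq> 0"
  then have "tangent_of A c p v \<noteq> (\<lambda>_. 0)" using tangent_of_apply[OF A c p(1), of v] by auto
  then show "v \<bullet> (components A g c x *v v) > 0"
    using b[of v v] g T unfolding p(2) riemannian_metric_def by metis
qed

text \<open>
  A tangent vector has coordinates \<open>v\<close> in the chart \<open>c\<close> and \<open>M v\<close> in the chart \<open>d\<close>, where \<open>M\<close> is the Jacobian
  matrix; so this is the bilinearity of \<open>g p\<close>.
\<close>

lemma components_change:
  assumes A: "smooth_atlas A" and c: "c \<in> A" and d: "d \<in> A" and p: "p \<in> chart_dom c \<inter> chart_dom d"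
    and g: "riemannian_metric A g"
  shows "components A g c (coords c p) =
    transpose (matrix (transition_deriv c d p)) ** components A g d (coords d p) ** matrix (transition_deriv c d p)"
    (is "?L = transpose ?M ** ?R ** ?M")
proof -
  have pc: "p \<in> chart_dom c" and pd: "p \<in> chart_dom d" using p by auto
  have e: "axis i 1 \<bullet> (M *v axis j 1) = M $ i $ j" for M :: "real^'b^'b" and i j
    by (simp add: inner_axis' matrix_vector_mul_component matrix_vector_mult_basis column_def)
  have adj: "(M *v a) \<bullet> b = a \<bullet> (transpose M *v b)" for M :: "real^'b^'b" and a b
    using dot_lmul_matrix[of a "transpose M" b] by (simp only: vector_transpose_matrix)
  have T: "transition_deriv c d p v = ?M *v v" for v
    by (simp add: matrix_works transition_deriv_linear[OF A c d p])
  have tangent: "tangent_of A c p v = tangent_of A d p (?M *v v)" for v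
    using tangent_of_change[OF A c pc d pd, of v] unfolding T[of v] .
  have "?L $ i $ j = (transpose ?M ** ?R ** ?M) $ i $ j" for i j
  proof -
    have "?L $ i $ j = axis i 1 \<bullet> (?L *v axis j 1)" by (simp only: e)
    also have "\<dots> = g p (tangent_of A c p (axis i 1)) (tangent_of A c p (axis j 1))"
      by (rule metric_in_chart[OF A c pc g, symmetric])
    also have "\<dots> = g p (tangent_of A d p (?M *v axis i 1)) (tangent_of A d p (?M *v axis j 1))"
      by (simp only: tangent[of "axis i 1"] tangent[of "axis j 1"])
    also have "\<dots> = (?M *v axis i 1) \<bullet> (?R *v (?M *v axis j 1))"
      by (rule metric_in_chart[OF A d pd g])
    also have "\<dots> = axis i 1 \<bullet> ((transpose ?M ** ?R ** ?M) *v axis j 1)"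
      by (simp only: adj matrix_vector_mul_assoc matrix_mul_assoc)
    also have "\<dots> = (transpose ?M ** ?R ** ?M) $ i $ j" by (simp only: e)
    finally show ?thesis .
  qed
  then show ?thesis by (simp add: vec_eq_iff)
qed

section \<open>Ricci flows\<close>

lemma ricci_flow_metric_family:
  assumes A: "smooth_atlas A" and c: "c \<in> A" and flow: "ricci_flow A J g"
  shows "metric_family (interior J) (chart_img c) (\<lambda>t. components A (g t) c)"
proof
  show "open (interior J)" by simp
  show "open (chart_img c)" by (rule smooth_atlas_chart(2)[OF A c])
  show "smooth_on (interior J \<times> chart_img c) (\<lambda>(t, x). components A (g t) c x)"
  proof (rule smooth_on_subset_open)
    show "smooth_on (J \<times> chart_img c) (\<lambda>(t, x). components A (g t) c x)"
      using flow c by (simp add: ricci_flow_def)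
    show "open (interior J \<times> chart_img c)"
      by (rule open_Times[OF open_interior smooth_atlas_chart(2)[OF A c]])
    show "interior J \<times> chart_img c \<subseteq> J \<times> chart_img c"
      by (rule Sigma_mono[OF interior_subset]) simp
  qed
  have g: "riemannian_metric A (g t)" if "t \<in> interior J" for t
    using subsetD[OF interior_subset that] flow by (simp add: ricci_flow_def)
  fix t x assume t: "t \<in> interior J" and x: "x \<in> chart_img c"
  show "components A (g t) c x $ i $ j = components A (g t) c x $ j $ i" for i j
    by (rule components_sym[OF A c x g[OF t]])
  show "v \<noteq> 0 \<Longrightarrow> v \<bullet> (components A (g t) c x *v v) > 0" for v
    by (rule components_pos[OF A c x g[OF t]])
qed

lemma jacobian_transition:
  assumes A: "smooth_atlas A" and c: "c \<in> A" and d: "d \<in> A" and p: "p \<in> chart_dom c \<inter> chart_dom d"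
  shows "dir_deriv (axis i 1) (\<lambda>y. (coords d \<circ> chart_inv c) y $ a) (coords c p) = matrix (transition_deriv c d p) $ a $ i"
proof -
  have "((\<lambda>y. (coords d \<circ> chart_inv c) y $ a) has_derivative (\<lambda>v. transition_deriv c d p v $ a)) (at (coords c p))"
    by (rule bounded_linear.has_derivative[OF bounded_linear_vec_nth transition_smooth(4)[OF A c d p]])
  then show ?thesis by (simp add: dir_deriv_eqI matrix_def)
qed

lemma ricci_flow_chart_change:
  assumes A: "smooth_atlas A" and c: "c \<in> A" and d: "d \<in> A" and flow: "ricci_flow A J g"
  shows "chart_change (interior J) (chart_img c) (chart_img d) (\<lambda>t. components A (g t) c) (\<lambda>t. components A (g t) d)
    (coords d \<circ> chart_inv c) (coords c ` (chart_dom c \<inter> chart_dom d))"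
proof (intro chart_change.intro chart_change_axioms.intro)
  let ?S = "coords c ` (chart_dom c \<inter> chart_dom d)"
  show "metric_family (interior J) (chart_img c) (\<lambda>t. components A (g t) c)"
    "metric_family (interior J) (chart_img d) (\<lambda>t. components A (g t) d)"
    by (rule ricci_flow_metric_family[OF A c flow] ricci_flow_metric_family[OF A d flow])+
  show "open ?S" "smooth_on ?S (coords d \<circ> chart_inv c)" by (rule transition_smooth[OF A c d])+
  show "?S \<subseteq> chart_img c" by blast
  show "(coords d \<circ> chart_inv c) x \<in> chart_img d" if "x \<in> ?S" for x
    using that unfolding coords_image_iff[OF A c] by simp
  show "components A (g t) c x =
      transpose (\<chi> a i. dir_deriv (axis i 1) (\<lambda>y. (coords d \<circ> chart_inv c) y $ a) x) **
      components A (g t) d ((coords d \<circ> chart_inv c) x) **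
      (\<chi> a i. dir_deriv (axis i 1) (\<lambda>y. (coords d \<circ> chart_inv c) y $ a) x)"
    if t: "t \<in> interior J" and x: "x \<in> ?S" for t x
  proof -
    obtain p where p: "p \<in> chart_dom c \<inter> chart_dom d" "x = coords c p" using x by blast
    have g: "riemannian_metric A (g t)" using subsetD[OF interior_subset t] flow by (simp add: ricci_flow_def)
    have "chart_inv c (coords c p) = p" using p(1) smooth_atlas_chart(5)[OF A c] by simp
    then show ?thesis
      using components_change[OF A c d p(1) g] unfolding p(2) jacobian_transition[OF A c d p(1)]
      by (simp add: vec_lambda_eta)
  qed
qed

lemma ricci_flow_components:
  assumes A: "smooth_atlas A" and c: "c \<in> A" and flow: "ricci_flow A J g" and t: "t \<in> interior J" and x: "x \<in> chart_img c"
  shows "dt (metric_family.met (\<lambda>t. components A (g t) c) j k) (t, x) = -2 * metric_family.Ric (\<lambda>t. components A (g t) c) j k (t, x)"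
proof -
  interpret M: metric_family "interior J" "chart_img c" "\<lambda>t. components A (g t) c"
    by (rule ricci_flow_metric_family[OF A c flow])
  have "((\<lambda>\<tau>. components A (g \<tau>) c x) has_vector_derivative (-2) *\<^sub>R ricci A (g t) c x) (at t within J)"
    using flow subsetD[OF interior_subset t] x c unfolding ricci_flow_def by blast
  then have "((\<lambda>\<tau>. components A (g \<tau>) c x) has_vector_derivative (-2) *\<^sub>R ricci A (g t) c x) (at t)"
    unfolding at_within_interior[OF t] .
  from bounded_linear.has_vector_derivative[OF bounded_linear_vec_nth bounded_linear.has_vector_derivative[OF bounded_linear_vec_nth this]]
  have "((\<lambda>\<tau>. M.met j k (\<tau>, x)) has_real_derivative -2 * M.Ric j k (t, x)) (at t)"
    by (simp add: M.met_def M.Ric_def ricci_def has_real_derivative_iff_has_vector_derivative)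
  moreover have "((\<lambda>\<tau>. M.met j k (\<tau>, x)) has_real_derivative dt (M.met j k) (t, x)) (at t)"
    using t x by (intro has_real_derivative_time_slice M.diff_rules(1)) auto
  ultimately show ?thesis by (rule DERIV_unique[rotated])
qed

text \<open>
  The core of the argument at a fixed time. The function \<open>s' - 2 N\<close>, with \<open>N = |Ric|\<^sup>2\<close>, is in every chart the
  divergence of \<open>V\<close>, so its integral vanishes.
\<close>

lemma ricci_flat_at_interior_times:
  fixes A :: "('m::{t2_space, second_countable_topology}, 'n::finite) chart set"
  assumes closed: "closed_manifold A" and flow: "ricci_flow A J g" and t: "t \<in> interior J"
    and le: "(\<integral>p. vector_derivative (\<lambda>\<tau>. scalar_curvature A (g \<tau>) p) (at t within J) \<partial>riemannian_volume A (g t)) \<le> 0"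
    and c: "c \<in> A" and x: "x \<in> chart_img c"
  shows "ricci A (g t) c x = 0"
proof -
  have A: "smooth_atlas A" using closed by (simp add: closed_manifold_def)
  define G where "G c t = components A (g t) c" for c t
  have G: "(\<lambda>t. components A (g t) c) = G c" for c by (simp add: G_def fun_eq_iff)
  note mf = ricci_flow_metric_family[OF A _ flow, unfolded G]
  note cc = ricci_flow_chart_change[OF A _ _ flow, unfolded G]
  note fl = ricci_flow_components[OF A _ flow, unfolded G]
  define w where "w c x = sqrt (det (G c t x))" for c x
  have dens: "metric_family.dens (G c) (t, x) = w c x" if "c \<in> A" for c x
    by (simp add: metric_family.dens_def[OF mf[OF that]] w_def)
  have in_S: "coords c p \<in> coords c ` (chart_dom c \<inter> chart_dom d)" if "p \<in> chart_dom c \<inter> chart_dom d"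
    for c d :: "('m, 'n) chart" and p
    using that by blast
  have inv: "(coords d \<circ> chart_inv c) (coords c p) = coords d p" if "c \<in> A" "p \<in> chart_dom c"
    for c d :: "('m, 'n) chart" and p
    using smooth_atlas_chart(5)[OF A that] by simp
  interpret vf: volume_family A w
  proof
    show "closed_manifold A" by fact
    fix c assume c: "c \<in> A"
    interpret M: metric_family "interior J" "chart_img c" "G c" by (rule mf[OF c])
    have "continuous_on (chart_img c) (\<lambda>x. M.dens (t, x))"
      by (rule Ck_on_imp_continuous_on[OF Ck1_space_slice[OF open_interior M.open_U M.smooth_dens t]])
    then show "continuous_on (chart_img c) (w c)" by (simp add: dens[OF c])
    show "w c x > 0" if "x \<in> chart_img c" for x
      using M.det_pos[OF SigmaI[OF t that]] by (simp add: w_def)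
    fix d p assume d: "d \<in> A" and p: "p \<in> chart_dom c \<inter> chart_dom d"
    interpret C: chart_change "interior J" "chart_img c" "chart_img d" "G c" "G d" "coords d \<circ> chart_inv c" "coords c ` (chart_dom c \<inter> chart_dom d)"
      by (rule cc[OF c d])
    have "C.Jac (coords c p) = matrix (transition_deriv c d p)"
      by (simp add: C.Jac_def C.jac_def jacobian_transition[OF A c d p, unfolded comp_def] vec_eq_iff)
    then show "w c (coords c p) = \<bar>det (matrix (transition_deriv c d p))\<bar> * w d (coords d p)"
      using C.dens_transform[OF t in_S[OF p]] p by (simp add: dens c d inv del: comp_apply)
  qed
  have vol: "vf.vol = riemannian_volume A (g t)"
    unfolding vf.vol_def riemannian_volume_def
    by (rule arg_cong[of _ _ The], rule ext) (simp only: vf.is_volume_def w_def G_def)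
  define s' where "s' p = vector_derivative (\<lambda>\<tau>. scalar_curvature A (g \<tau>) p) (at t within J)" for p
  define N where "N p = (let c = (SOME c. c \<in> A \<and> p \<in> chart_dom c) in
    form_norm_sq (matrix_inv (G c t (coords c p))) (local_ricci (G c t) (coords c p)))" for p
  have chosen: "(SOME c. c \<in> A \<and> p \<in> chart_dom c) \<in> A \<and> p \<in> chart_dom (SOME c. c \<in> A \<and> p \<in> chart_dom c)" for p
    using someI_ex[of "\<lambda>c. c \<in> A \<and> p \<in> chart_dom c"] smooth_atlas_cover[OF A] by blast
  have scal: "scalar_curvature A (g \<tau>) p = local_scalar (G c \<tau>) (coords c p)" if "c \<in> A" "p \<in> chart_dom c" "\<tau> \<in> interior J" for c p \<tau>
  proof -
    let ?d = "SOME c. c \<in> A \<and> p \<in> chart_dom c"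
    have d: "?d \<in> A" "p \<in> chart_dom ?d \<inter> chart_dom c" using chosen that by auto
    have "local_scalar (G ?d \<tau>) (coords ?d p) = local_scalar (G c \<tau>) ((coords c \<circ> chart_inv ?d) (coords ?d p))"
      by (rule chart_change.Scal_invariant[OF cc[OF d(1) that(1)] fl[OF d(1)] fl[OF that(1)] that(3) in_S[OF d(2)]])
    then show ?thesis using inv[OF d(1)] d(2) by (simp add: scalar_curvature_def Let_def G_def)
  qed
  have N_chart: "N p = form_norm_sq (matrix_inv (G c t (coords c p))) (local_ricci (G c t) (coords c p))" if "c \<in> A" "p \<in> chart_dom c" for c p
  proof -
    let ?d = "SOME c. c \<in> A \<and> p \<in> chart_dom c"
    have d: "?d \<in> A" "p \<in> chart_dom ?d \<inter> chart_dom c" using chosen that by auto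
    have "form_norm_sq (matrix_inv (G ?d t (coords ?d p))) (local_ricci (G ?d t) (coords ?d p))
      = form_norm_sq (matrix_inv (G c t ((coords c \<circ> chart_inv ?d) (coords ?d p)))) (local_ricci (G c t) ((coords c \<circ> chart_inv ?d) (coords ?d p)))"
      by (rule chart_change.ricci_norm_invariant[OF cc[OF d(1) that(1)] fl[OF d(1)] fl[OF that(1)] t in_S[OF d(2)]])
    then show ?thesis using inv[OF d(1)] d(2) by (simp add: N_def Let_def)
  qed
  have s'_chart: "s' p = dt (metric_family.Scal (G c)) (t, coords c p)" if c: "c \<in> A" and p: "p \<in> chart_dom c" for c p
  proof -
    interpret M: metric_family "interior J" "chart_img c" "G c" by (rule mf[OF c])
    have "((\<lambda>\<tau>. M.Scal (\<tau>, coords c p)) has_vector_derivative dt M.Scal (t, coords c p)) (at t)"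
      unfolding has_real_derivative_iff_has_vector_derivative[symmetric]
      using t p by (intro has_real_derivative_time_slice M.diff_rules(6)) auto
    then have "((\<lambda>\<tau>. scalar_curvature A (g \<tau>) p) has_vector_derivative dt M.Scal (t, coords c p)) (at t)"
      by (rule has_vector_derivative_transform_within_open[OF _ open_interior t]) (simp add: scal[OF c p] M.Scal_def)
    then show ?thesis unfolding s'_def at_within_interior[OF t] by (rule vector_derivative_at)
  qed
  define V where "V c i x = metric_family.Vel (G c) i (t, x)" for c i x
  have slice1: "Ck_on 1 (chart_img c) (\<lambda>x. h (t, x))" if "c \<in> A" "smooth_on (interior J \<times> chart_img c) h"
    for c :: "('m, 'n) chart" and h :: "_ \<Rightarrow> real"
    by (rule Ck1_space_slice[OF open_interior smooth_atlas_chart(2)[OF A that(1)] that(2) t])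
  have w1: "Ck_on 1 (chart_img c) (w c)" if c: "c \<in> A" for c
    using slice1[OF c metric_family.smooth_dens[OF mf[OF c]]] by (simp add: dens[OF c])
  have V1: "Ck_on 1 (chart_img c) (V c i)" if c: "c \<in> A" for c i
      using slice1[OF c metric_family.smooth_Vel[OF mf[OF c]]] by (simp add: V_def[abs_def])
  have V_change: "(\<Sum>i\<in>UNIV. dir_deriv (axis i 1) (\<lambda>y. (coords d \<circ> chart_inv c) y $ a) (coords c p) * V c i (coords c p)) = V d a (coords d p)"
    if c: "c \<in> A" and d: "d \<in> A" and p: "p \<in> chart_dom c \<inter> chart_dom d" for c d p a
    proof -
      interpret C: chart_change "interior J" "chart_img c" "chart_img d" "G c" "G d" "coords d \<circ> chart_inv c" "coords c ` (chart_dom c \<inter> chart_dom d)"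
        by (rule cc[OF c d])
      have "(coords d \<circ> chart_inv c) (coords c p) = coords d p" using inv[OF c] p by simp
      then show ?thesis using C.Vel_transform[OF t in_S[OF p], of a] unfolding C.jac_def V_def by simp
    qed
  have div_eq: "w c x * (s' (chart_inv c x) - 2 * N (chart_inv c x)) = (\<Sum>i\<in>UNIV. dir_deriv (axis i 1) (\<lambda>y. w c y * V c i y) x)"
    if c: "c \<in> A" and x: "x \<in> chart_img c" for c x
    proof -
      interpret M: metric_family "interior J" "chart_img c" "G c" by (rule mf[OF c])
      have z: "(t, x) \<in> interior J \<times> chart_img c" using t x by simp
      note ch = smooth_atlas_chart(6,7)[OF A c x]
      have "dir_deriv (axis i 1) (\<lambda>y. w c y * V c i y) x = dx i (\<lambda>z. M.dens z * M.Vel i z) (t, x)" for i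
        using dir_deriv_space_slice(2)[of "\<lambda>z. M.dens z * M.Vel i z" t x "axis i 1"] M.diff_rules(7,8)[OF z]
        by (simp add: dens[OF c] V_def differentiable_mult)
      then show ?thesis
        using M.scalar_evolution[OF z] fl[OF c t x]
        by (simp add: s'_chart[OF c ch(2)] N_chart[OF c ch(2)] ch(1) dens[OF c] algebra_simps)
    qed
  have div: "continuous_on UNIV (\<lambda>p. s' p - 2 * N p)" "(\<integral>p. s' p - 2 * N p \<partial>vf.vol) = 0"
    by (rule vf.divergence_theorem[where V = V]; (rule w1 V1 V_change div_eq; assumption))+
  have N_cont: "continuous_on UNIV N"
  proof (rule continuous_on_charts[OF A])
    fix c assume c: "c \<in> A"
    interpret M: metric_family "interior J" "chart_img c" "G c" by (rule mf[OF c])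
    have "smooth_on (interior J \<times> chart_img c) (\<lambda>z. \<Sum>i\<in>UNIV. \<Sum>j\<in>UNIV. \<Sum>k\<in>UNIV. \<Sum>l\<in>UNIV.
        M.minv i k z * M.minv j l z * M.Ric i j z * M.Ric k l z)"
      by (intro smooth_on_sum smooth_on_mult M.open_IU M.smooth_minv M.smooth_Ric)
    from Ck_on_imp_continuous_on[OF slice1[OF c this]]
    show "continuous_on (chart_img c) (\<lambda>x. N (chart_inv c x))"
      by (rule continuous_on_cong[THEN iffD1, OF refl, rotated])
        (simp add: N_chart[OF c smooth_atlas_chart(7)[OF A c]] smooth_atlas_chart(6)[OF A c] form_norm_sq_def M.minv_def M.Ric_def)
  qed
  have N_nonneg: "N p \<ge> 0" for p
  proof -
    obtain c where c: "c \<in> A" "p \<in> chart_dom c" using smooth_atlas_cover[OF A] by blast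
    then show ?thesis
      unfolding N_chart[OF c] using metric_family.sym_G[OF mf[OF c(1)] t] metric_family.pos_G[OF mf[OF c(1)] t]
      by (intro form_norm_sq_nonneg) auto
  qed
  have "integral\<^sup>L vf.vol (\<lambda>p. 2 * N p) = integral\<^sup>L vf.vol s'"
  proof -
    have "integral\<^sup>L vf.vol s' = (\<integral>p. (s' p - 2 * N p) + 2 * N p \<partial>vf.vol)" by simp
    also have "\<dots> = (\<integral>p. s' p - 2 * N p \<partial>vf.vol) + integral\<^sup>L vf.vol (\<lambda>p. 2 * N p)"
      using div(1) N_cont
      by (intro Bochner_Integration.integral_add vf.integrable_vol_continuous continuous_on_mult_left)
    finally show ?thesis by (simp only: div(2) add_0)
  qed
  then have "integral\<^sup>L vf.vol N \<le> 0" using le unfolding vol s'_def by simp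
  then have N0: "N p = 0" for p
    by (rule vf.continuous_nonneg_integral_zero[OF N_cont N_nonneg])
  note ch = smooth_atlas_chart(6,7)[OF A c x]
  have "form_norm_sq (matrix_inv (G c t x)) (local_ricci (G c t) x) = 0"
    using N0[of "chart_inv c x"] N_chart[OF c ch(2)] ch(1) by simp
  then have "local_ricci (G c t) x = 0"
    using metric_family.sym_G[OF mf[OF c] t x] metric_family.pos_G[OF mf[OF c] t x]
    by (rule form_norm_sq_eq_0D[rotated 2])
  then show ?thesis by (simp add: ricci_def G_def)
qed

theorem lemma1:
  fixes A :: "('m::{t2_space, second_countable_topology}, 'n::finite) chart set"
    and J :: "real set"
    and g :: "real \<Rightarrow> ('m, 'n) form_field"
  assumes "closed_manifold A"
    and "is_interval J" and "\<exists>a\<in>J. \<exists>b\<in>J. a < b" and "J \<subseteq> {0..}"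
    and "ricci_flow A J g"
    and "\<And>t. t \<in> J \<Longrightarrow>
           (\<integral>p. vector_derivative (\<lambda>\<tau>. scalar_curvature A (g \<tau>) p) (at t within J)
              \<partial>riemannian_volume A (g t)) \<le> 0"
  shows "trivial_flow A J g"
  unfolding trivial_flow_def
proof (intro ballI)
  fix t c x assume t: "t \<in> J" and c: "c \<in> A" and x: "x \<in> chart_img c"
  let ?\<gamma> = "\<lambda>\<tau>. components A (g \<tau>) c x"
  have deriv: "(?\<gamma> has_vector_derivative (-2) *\<^sub>R ricci A (g \<tau>) c x) (at \<tau> within J)" if "\<tau> \<in> J" for \<tau>
    using assms(5) that c x by (auto simp: ricci_flow_def)
  have less: "?\<gamma> b = ?\<gamma> a" if ab: "a \<in> J" "b \<in> J" "a < b" for a b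
  proof -
    have sub: "{a..b} \<subseteq> J" using assms(2) ab by (meson atLeastAtMost_iff is_interval_1 subsetI)
    have int: "\<tau> \<in> interior J" if "a < \<tau>" "\<tau> < b" for \<tau>
      using sub that by (intro interiorI[of "{a<..<b}"]) auto
    have "?\<gamma> b $ i $ j = ?\<gamma> a $ i $ j" for i j
    proof (rule DERIV_isconst_end[OF \<open>a < b\<close>])
      have "continuous_on J ?\<gamma>"
        using deriv by (auto simp: continuous_on_eq_continuous_within intro: has_vector_derivative_continuous)
      then show "continuous_on {a..b} (\<lambda>\<tau>. ?\<gamma> \<tau> $ i $ j)"
        by (intro continuous_on_component) (rule continuous_on_subset[OF _ sub])
      fix \<tau> assume \<tau>: "a < \<tau>" "\<tau> < b"
      have \<tau>J: "\<tau> \<in> J" using int[OF \<tau>] by (rule subsetD[OF interior_subset])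
      have flat: "ricci A (g \<tau>) c x = 0"
        by (rule ricci_flat_at_interior_times[OF assms(1,5) int[OF \<tau>] assms(6)[OF \<tau>J] c x])
      have "(?\<gamma> has_vector_derivative 0) (at \<tau>)"
        using deriv[OF \<tau>J] unfolding flat at_within_interior[OF int[OF \<tau>]] scaleR_zero_right .
      from bounded_linear.has_vector_derivative[OF bounded_linear_vec_nth bounded_linear.has_vector_derivative[OF bounded_linear_vec_nth this]]
      show "((\<lambda>\<tau>. ?\<gamma> \<tau> $ i $ j) has_real_derivative 0) (at \<tau>)"
        by (simp add: has_real_derivative_iff_has_vector_derivative)
    qed
    then show ?thesis by (simp add: vec_eq_iff)
  qed
  \<comment> \<open>So the metric does not move on all of \<open>J\<close>, and the flow equation can be read backwards at \<open>t\<close>.\<close>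
  have const: "?\<gamma> \<tau> = ?\<gamma> t" if "\<tau> \<in> J" for \<tau>
    using less[of \<tau> t] less[of t \<tau>] t that by (cases \<tau> t rule: linorder_cases) auto
  have "(?\<gamma> has_vector_derivative 0) (at t within J)"
    by (rule has_vector_derivative_transform[OF t _ has_vector_derivative_const[of "?\<gamma> t"]]) (simp add: const)
  moreover have "at t within J \<noteq> bot"
  proof -
    have "connected J" using assms(2) by (simp add: is_interval_connected)
    moreover have "\<nexists>a. J = {a}" using assms(3) by auto
    ultimately show ?thesis using t connected_imp_perfect[of J t] by (auto simp: trivial_limit_within)
  qed
  ultimately have "(-2) *\<^sub>R ricci A (g t) c x = 0"
    using vector_derivative_unique_within[OF _ deriv[OF t]] by blast
  then show "ricci A (g t) c x = 0" by simp
qed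

end
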